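(* Let $(\mathcal E,i)$ be a prop with $A_\infty$-multiplication and let $n_1,m_1,n_2,m_2\ge 0$. There is an isomorphism of chain complexes $$\mathrm{Nat}_{\mathcal E}\big((n_1,m_1),(n_2,m_2)\big)\;\cong\;\prod_{j_1,\dots,j_{n_1}\ge 1}\ \bigoplus_{k_1,\dots,k_{n_2}\ge 1}\mathcal E(j+m_1,k+m_2)\,[k-j+n_1-n_2],$$ where $j=j_1+\dots+j_{n_1}$, $k=k_1+\dots+k_{n_2}$, and where the differential on the right-hand side is the sum of the differential of $\mathcal E$, the multi-Hochschild differential (from the $n_2$ outgoing Hochschild constructions in the second variable of $\mathcal E$) and the multi-coHochschild differential (from the $n_1$ coHochschild constructions in the first variable of $\mathcal E$); that is, the right-hand side is the complex $D^{n_1}C^{n_2}\mathcal E(-,-)(m_1,m_2)$.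
   Context: Conventions: a chain complex is a differential graded $\mathbb Z$-module; $V[n]_*=V_{*-n}$. $\mathrm{Ch}$ is the dg-category of chain complexes, with $\mathrm{Hom}(V,W)$ the complex of linear maps of all degrees and $(df)(v)=(-1)^{|v|}\big(d_W(f(v))-f(d_Vv)\big)$ (morphisms act on the right, Koszul signs). A dg-functor $F:\mathcal C\to\mathrm{Ch}$ is an enriched functor (the maps $F(n)\otimes\mathcal C(n,m)\to F(m)$ are chain maps). The prop $A_\infty$: the symmetric monoidal dg-category with objects $0,1,2,\dots$, where $A_\infty(n,m)$ is generated by oriented disjoint unions of $m$ planar rooted trees (roots are outputs labelled $1,\dots,m$) with vertices of valence $\ge 3$ (the vertex-free tree, a single leaf representing an identity, is allowed) with in total $n$ incoming leaves labelled $1,\dots,n$, at least one per tree; from $0$ there is only the identity. For a graph with vertex set $V$ and half-edge set $H$ an orientation is a unit vector in $\det(\mathbb R(V\sqcup H))$, and $-G$ is $G$ with opposite orientation. The degree is $\sum_v(|v|-3)$, and the differential is the sum of all blow-ups $\hat G$ of $G$, i.e. graphs with an edge $e=(h_1,h_2)$, $h_i$ attached to $v_i$, $v_1\ne v_2$, with $\hat G/e\cong G$; if $\hat G$ is oriented by $v_1\wedge v_2\wedge h_1\wedge h_2\wedge X$ then $\hat G/e$ is oriented by $v\wedge X$. Composition glues outputs to inputs (orientations juxtaposed); the monoidal product is disjoint union. $m_k\in A_\infty(k,1)$ denotes the one-vertex tree, of degree $k-2$. Symmetric monoidal dg-functors $A_\infty\to\mathrm{Ch}$ are the (non-unital) $A_\infty$-algebras.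 A prop with $A_\infty$-multiplication is a pair $(\mathcal E,i)$ with $\mathcal E$ a symmetric monoidal dg-category with objects the natural numbers (monoidal product $+$) and $i:A_\infty\to\mathcal E$ a symmetric monoidal dg-functor that is the identity on objects. The morphisms $f_{n,k}$: let $l_n$ ($n\ge1$) be the graph with one white vertex $v$ and $n$ leaves $h_1,\dots,h_n$ in this cyclic order, oriented by $v\wedge h_1\wedge\dots\wedge h_n$, of degree $n-1$; $L_n=\mathbb Z l_n$. The differential of $l_n$ is the sum of its blow-ups: for $1\le k<n$ move $n-k+1$ cyclically consecutive leaves to a new black vertex joined by an edge to the white vertex (which then has valence $k$; its first half-edge is the new edge if $h_1$ was moved, and $h_1$ otherwise), oriented by $w\wedge b\wedge e_w\wedge e_b\wedge h_1\wedge\dots\wedge h_n$, where $w$ is the white vertex of the blow-up, $b$ the new black vertex, and $(e_w,e_b)$ the new edge with $e_w$ attached to $w$ and $e_b$ attached to $b$. Each blow-up is an element of $A_\infty(n,k)$ glued to $l_k$, so $d\,l_n=\sum_{k<n}f_{n,k}\otimes l_k$ with $f_{n,k}\in A_\infty(n,k)$; one has $f_{n,k}=\sum_{i=1}^n\pm m^i_{n-k+1}$, where $m^i_{n-k+1}$ multiplies by $m_{n-k+1}$ the entries $i,\dots,i+n-k$ modulo $n$. Hochschild complex of a dg-functor $\Phi:\mathcal E\to\mathrm{Ch}$: the dg-functor $C(\Phi):\mathcal E\to\mathrm{Ch}$ with $C(\Phi)(m)=\bigoplus_{n\ge1}\Phi(n+m)\otimes L_n$, $d(x\otimes l_n)=d_\Phi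 x\otimes l_n+(-1)^{|x|}\sum_{k=1}^{n-1}\Phi(i(f_{n,k})+id_m)(x)\otimes l_k$, and $C(\Phi)(f)=\Phi(id+f)\otimes id$. CoHochschild complex of a dg-functor $\Psi:\mathcal E^{op}\to\mathrm{Ch}$: the dg-functor $D(\Psi):\mathcal E^{op}\to\mathrm{Ch}$ with $D(\Psi)(m)=\prod_{n\ge1}\mathrm{Hom}(L_n,\Psi(n+m))$, $(dh)(l_n)=(-1)^{n-1}\big(d_\Psi(h(l_n))-\sum_{k=1}^{n-1}\Psi(i(f_{n,k})+id_m)(h(l_k))\big)$, and $D(\Psi)(f)$ postcomposition with $\Psi(id+f)$. $C^n,D^n$ denote $n$-fold iterates. $D^{n_1}C^{n_2}\mathcal E(-,-)$ is obtained from $\mathcal E(-,-)$ by applying $C^{n_2}$ in the second (covariant) variable and then $D^{n_1}$ in the first (contravariant) variable. Formal operations: $\mathrm{Fun}(\mathcal E,\mathrm{Ch})$ is the dg-category of dg-functors $\mathcal E\to\mathrm{Ch}$, with complexes of natural transformations of all degrees as morphisms (no monoidality required). $C_{\mathcal E}^{(n,m)}:\mathrm{Fun}(\mathcal E,\mathrm{Ch})\to\mathrm{Ch}$ is the dg-functor $\Phi\mapsto C^n(\Phi)(m)$, and $\mathrm{Nat}_{\mathcal E}((n_1,m_1),(n_2,m_2)):=\mathrm{Hom}(C_{\mathcal E}^{(n_1,m_1)},C_{\mathcal E}^{(n_2,m_2)})$ is the chain complex of natural transformations. For $n_1=n_2=1$ the differential on the right-hand side is explicitly the following: for $\underline g=\{g_j\}_{j\ge1}$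 with $g_j=\sum_{s=1}^{r_j} g_{j,k_s}$, $g_{j,k_s}\in\mathcal E(j+m_1,k_s+m_2)$, $d(\underline g)_j=(-1)^{j-1}\big(d_{\mathcal E}(g_j)+\sum_{s}\sum_{k=1}^{k_s-1}(-1)^{|g_{j,k_s}|}(i(f_{k_s,k})+id_{m_2})\circ g_{j,k_s}-\sum_{j'=1}^{j-1}g_{j'}\circ(i(f_{j,j'})+id_{m_1})\big)$. *)

theory Defs
  imports
    "HOL-Algebra.Product_Groups"
    "HOL-Algebra.Free_Abelian_Groups"
    "HOL-Combinatorics.Permutations"
    "HOL-Library.Poly_Mapping"
begin

section \<open>Differential graded \<open>\<int>\<close>-modules\<close>

text \<open>
  Abelian groups are commutative groups of HOL-Algebra, written multiplicatively there.  The product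
  of \<open>x\<close> and \<open>y\<close> is the sum \<open>x + y\<close>, and \<open>x [^] c\<close> with \<open>c :: int\<close> is the scalar multiple
  \<open>c x\<close>; so \<open>x [^] ksign k\<close> is \<open>(-1)^k x\<close>.  A graded module is a family of groups, one for
  every degree; consequently homogeneous elements never carry their degree, and operations on them
  take the degrees as arguments.
\<close>

definition ksign :: "int \<Rightarrow> int"
  where "ksign k = (if even k then 1 else - 1)"

record 'v dgmod =
  grp :: "int \<Rightarrow> 'v monoid"
  dif :: "int \<Rightarrow> 'v \<Rightarrow> 'v"

definition chain_complex :: "'v dgmod \<Rightarrow> bool"
  where "chain_complex V \<longleftrightarrow>
    (\<forall>p. comm_group (grp V p)) \<and>
    (\<forall>p. dif V p \<in> hom (grp V p) (grp V (p - 1))) \<and>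
    (\<forall>p. \<forall>x\<in>carrier (grp V p). dif V (p - 1) (dif V p x) = \<one>\<^bsub>grp V (p - 2)\<^esub>)"

definition chain_iso :: "'v dgmod \<Rightarrow> 'w dgmod \<Rightarrow> (int \<Rightarrow> 'v \<Rightarrow> 'w) set"
  where "chain_iso V W =
    {\<phi>. (\<forall>p. \<phi> p \<in> iso (grp V p) (grp W p)) \<and>
         (\<forall>p. \<forall>x\<in>carrier (grp V p). \<phi> (p - 1) (dif V p x) = dif W p (\<phi> p x))}"

text \<open>A chain map \<open>U \<otimes> V \<rightarrow> W\<close>, given as a bilinear map on homogeneous elements.\<close>

definition chain_pairing ::
  "'u dgmod \<Rightarrow> 'v dgmod \<Rightarrow> 'w dgmod \<Rightarrow> (int \<Rightarrow> int \<Rightarrow> 'u \<Rightarrow> 'v \<Rightarrow> 'w) \<Rightarrow> bool"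
  where "chain_pairing U V W b \<longleftrightarrow>
    (\<forall>p q. \<forall>x\<in>carrier (grp U p). (\<lambda>y. b p q x y) \<in> hom (grp V q) (grp W (p + q))) \<and>
    (\<forall>p q. \<forall>y\<in>carrier (grp V q). (\<lambda>x. b p q x y) \<in> hom (grp U p) (grp W (p + q))) \<and>
    (\<forall>p q. \<forall>x\<in>carrier (grp U p). \<forall>y\<in>carrier (grp V q).
       dif W (p + q) (b p q x y) =
         b (p - 1) q (dif U p x) y
           \<otimes>\<^bsub>grp W (p + q - 1)\<^esub>
         b p (q - 1) x (dif V q y) [^]\<^bsub>grp W (p + q - 1)\<^esub> ksign p)"

text \<open>
  The complex \<open>Hom(V, W)\<close> of linear maps of all degrees, with
  \<open>(d f)(v) = (-1)^|v| (d (f v) - f (d v))\<close>.  Since this is the differential for morphisms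
  acting on the right, a Koszul sign appears below whenever a morphism moves past something that is
  written to the left of it, and none appears for evaluation or composition.
\<close>

definition hom_cx :: "'v dgmod \<Rightarrow> 'w dgmod \<Rightarrow> (int \<Rightarrow> 'v \<Rightarrow> 'w) dgmod"
  where "hom_cx V W = \<lparr>
    grp = (\<lambda>r. \<lparr>
      carrier = {\<phi>. \<forall>q. \<phi> q \<in> hom (grp V q) (grp W (q + r)) \<inter> extensional (carrier (grp V q))},
      monoid.mult = (\<lambda>\<phi> \<psi> q. \<lambda>v\<in>carrier (grp V q). \<phi> q v \<otimes>\<^bsub>grp W (q + r)\<^esub> \<psi> q v),
      one = (\<lambda>q. \<lambda>v\<in>carrier (grp V q). \<one>\<^bsub>grp W (q + r)\<^esub>)\<rparr>),
    dif = (\<lambda>r \<phi> q. \<lambda>v\<in>carrier (grp V q).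
      (dif W (q + r) (\<phi> q v)
         \<otimes>\<^bsub>grp W (q + r - 1)\<^esub> inv\<^bsub>grp W (q + r - 1)\<^esub> \<phi> (q - 1) (dif V q v))
        [^]\<^bsub>grp W (q + r - 1)\<^esub> ksign q)\<rparr>"


section \<open>dg-categories, dg-functors and natural transformations\<close>

text \<open>
  \<open>Cmp K X Y Z p q f g\<close> is the composite \<open>g \<circ> f\<close> (first \<open>f\<close>, then \<open>g\<close>) of
  \<open>f : X \<rightarrow> Y\<close> of degree \<open>p\<close> and \<open>g : Y \<rightarrow> Z\<close> of degree \<open>q\<close>.
\<close>

record ('o, 'h) dgcat =
  Ob :: "'o set"
  Hom :: "'o \<Rightarrow> 'o \<Rightarrow> 'h dgmod"
  Cmp :: "'o \<Rightarrow> 'o \<Rightarrow> 'o \<Rightarrow> int \<Rightarrow> int \<Rightarrow> 'h \<Rightarrow> 'h \<Rightarrow> 'h"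
  Idm :: "'o \<Rightarrow> 'h"

locale dg_category =
  fixes K :: "('o, 'h, 'z) dgcat_scheme"
  assumes Hom_complex: "\<lbrakk>X \<in> Ob K; Y \<in> Ob K\<rbrakk> \<Longrightarrow> chain_complex (Hom K X Y)"
    and Cmp_chain: "\<lbrakk>X \<in> Ob K; Y \<in> Ob K; Z \<in> Ob K\<rbrakk> \<Longrightarrow>
      chain_pairing (Hom K X Y) (Hom K Y Z) (Hom K X Z) (Cmp K X Y Z)"
    and Idm_closed: "X \<in> Ob K \<Longrightarrow> Idm K X \<in> carrier (grp (Hom K X X) 0)"
    and Idm_cycle: "X \<in> Ob K \<Longrightarrow> dif (Hom K X X) 0 (Idm K X) = \<one>\<^bsub>grp (Hom K X X) (- 1)\<^esub>"
    and Cmp_Idm_left: "\<lbrakk>X \<in> Ob K; Y \<in> Ob K; f \<in> carrier (grp (Hom K X Y) p)\<rbrakk> \<Longrightarrow>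
      Cmp K X X Y 0 p (Idm K X) f = f"
    and Cmp_Idm_right: "\<lbrakk>X \<in> Ob K; Y \<in> Ob K; f \<in> carrier (grp (Hom K X Y) p)\<rbrakk> \<Longrightarrow>
      Cmp K X Y Y p 0 f (Idm K Y) = f"
    and Cmp_assoc: "\<lbrakk>X \<in> Ob K; Y \<in> Ob K; Z \<in> Ob K; W \<in> Ob K;
      f \<in> carrier (grp (Hom K X Y) p); g \<in> carrier (grp (Hom K Y Z) q);
      h \<in> carrier (grp (Hom K Z W) r)\<rbrakk> \<Longrightarrow>
      Cmp K X Z W (p + q) r (Cmp K X Y Z p q f g) h = Cmp K X Y W p (q + r) f (Cmp K Y Z W q r g h)"

text \<open>
  \<open>Act F X Y p f q x\<close> is \<open>F(f)(x)\<close> for \<open>f : X \<rightarrow> Y\<close> of degree \<open>p\<close> and \<open>x\<close> in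
  \<open>F(X)\<close> of degree \<open>q\<close>.
\<close>

record ('o, 'h, 'v) dgfun =
  Obj :: "'o \<Rightarrow> 'v dgmod"
  Act :: "'o \<Rightarrow> 'o \<Rightarrow> int \<Rightarrow> 'h \<Rightarrow> int \<Rightarrow> 'v \<Rightarrow> 'v"

definition dg_functor :: "('o, 'h, 'z) dgcat_scheme \<Rightarrow> ('o, 'h, 'v) dgfun \<Rightarrow> bool"
  where "dg_functor K F \<longleftrightarrow>
    (\<forall>X\<in>Ob K. chain_complex (Obj F X)) \<and>
    (\<forall>X\<in>Ob K. \<forall>Y\<in>Ob K.
       chain_pairing (Obj F X) (Hom K X Y) (Obj F Y) (\<lambda>q p x f. Act F X Y p f q x)) \<and>
    (\<forall>X\<in>Ob K. \<forall>q. \<forall>x\<in>carrier (grp (Obj F X) q). Act F X X 0 (Idm K X) q x = x) \<and>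
    (\<forall>X\<in>Ob K. \<forall>Y\<in>Ob K. \<forall>Z\<in>Ob K. \<forall>p q r.
       \<forall>f\<in>carrier (grp (Hom K X Y) p). \<forall>g\<in>carrier (grp (Hom K Y Z) r).
       \<forall>x\<in>carrier (grp (Obj F X) q).
         Act F X Z (p + r) (Cmp K X Y Z p r f g) q x = Act F Y Z r g (q + p) (Act F X Y p f q x))"

text \<open>
  The complex of natural transformations of all degrees: families \<open>\<alpha>\<close> of degree \<open>p\<close> with
  \<open>\<alpha>\<^sub>Y(F(f)(x)) = (-1)^(|f| p) G(f)(\<alpha>\<^sub>X(x))\<close>.
\<close>

definition nat_trans ::
  "('o, 'h, 'z) dgcat_scheme \<Rightarrow> ('o, 'h, 'v) dgfun \<Rightarrow> ('o, 'h, 'v) dgfun \<Rightarrow>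
   ('o \<Rightarrow> int \<Rightarrow> 'v \<Rightarrow> 'v) dgmod"
  where "nat_trans K F G = \<lparr>
    grp = (\<lambda>p. (product_group (Ob K) (\<lambda>X. grp (hom_cx (Obj F X) (Obj G X)) p))
      \<lparr>carrier := {\<alpha> \<in> \<Pi>\<^sub>E X\<in>Ob K. carrier (grp (hom_cx (Obj F X) (Obj G X)) p).
         \<forall>X\<in>Ob K. \<forall>Y\<in>Ob K. \<forall>r q.
           \<forall>f\<in>carrier (grp (Hom K X Y) r). \<forall>x\<in>carrier (grp (Obj F X) q).
             \<alpha> Y (q + r) (Act F X Y r f q x) =
               Act G X Y r f (q + p) (\<alpha> X q x) [^]\<^bsub>grp (Obj G Y) (q + r + p)\<^esub> ksign (r * p)}\<rparr>),
    dif = (\<lambda>p \<alpha>. \<lambda>X\<in>Ob K. dif (hom_cx (Obj F X) (Obj G X)) p (\<alpha> X))\<rparr>"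

definition Fun_cat ::
  "('o, 'h, 'z) dgcat_scheme \<Rightarrow> (('o, 'h, 'v) dgfun, 'o \<Rightarrow> int \<Rightarrow> 'v \<Rightarrow> 'v) dgcat"
  where "Fun_cat K = \<lparr>
    Ob = {F. dg_functor K F},
    Hom = nat_trans K,
    Cmp = (\<lambda>F G H p q \<alpha> \<beta>. \<lambda>X\<in>Ob K. \<lambda>r. \<lambda>x\<in>carrier (grp (Obj F X) r). \<beta> X (r + p) (\<alpha> X r x)),
    Idm = (\<lambda>F. \<lambda>X\<in>Ob K. \<lambda>r. \<lambda>x\<in>carrier (grp (Obj F X) r). x)\<rparr>"


section \<open>Symmetric monoidal dg-categories on the natural numbers\<close>

text \<open>
  \<open>Ten E n m n' m' p q f g\<close> is \<open>f \<otimes> g : n + n' \<rightarrow> m + m'\<close> for \<open>f : n \<rightarrow> m\<close> of degree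
  \<open>p\<close> and \<open>g : n' \<rightarrow> m'\<close> of degree \<open>q\<close>, and \<open>Swp E n m : n + m \<rightarrow> m + n\<close> is the
  symmetry.  The monoidal structure is strict, as it is for props.
\<close>

record 'h dgprop = "(nat, 'h) dgcat" +
  Ten :: "nat \<Rightarrow> nat \<Rightarrow> nat \<Rightarrow> nat \<Rightarrow> int \<Rightarrow> int \<Rightarrow> 'h \<Rightarrow> 'h \<Rightarrow> 'h"
  Swp :: "nat \<Rightarrow> nat \<Rightarrow> 'h"

locale dg_prop = dg_category E for E :: "'h dgprop" +
  assumes Ob_UNIV: "Ob E = UNIV"
    and Ten_chain:
      "chain_pairing (Hom E n m) (Hom E n' m') (Hom E (n + n') (m + m')) (Ten E n m n' m')"
    and Ten_Idm: "Ten E n n m m 0 0 (Idm E n) (Idm E m) = Idm E (n + m)"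
    and Ten_unit_left: "f \<in> carrier (grp (Hom E n m) p) \<Longrightarrow> Ten E 0 0 n m 0 p (Idm E 0) f = f"
    and Ten_unit_right: "f \<in> carrier (grp (Hom E n m) p) \<Longrightarrow> Ten E n m 0 0 p 0 f (Idm E 0) = f"
    and Ten_assoc: "\<lbrakk>f \<in> carrier (grp (Hom E n m) p); g \<in> carrier (grp (Hom E n' m') q);
      h \<in> carrier (grp (Hom E n'' m'') r)\<rbrakk> \<Longrightarrow>
      Ten E (n + n') (m + m') n'' m'' (p + q) r (Ten E n m n' m' p q f g) h =
      Ten E n m (n' + n'') (m' + m'') p (q + r) f (Ten E n' m' n'' m'' q r g h)"
    and interchange: "\<lbrakk>f \<in> carrier (grp (Hom E n m) p); g \<in> carrier (grp (Hom E n' m') q);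
      h \<in> carrier (grp (Hom E m k) r); l \<in> carrier (grp (Hom E m' k') s)\<rbrakk> \<Longrightarrow>
      Cmp E (n + n') (m + m') (k + k') (p + q) (r + s)
        (Ten E n m n' m' p q f g) (Ten E m k m' k' r s h l) =
      Ten E n k n' k' (p + r) (q + s) (Cmp E n m k p r f h) (Cmp E n' m' k' q s g l)
        [^]\<^bsub>grp (Hom E (n + n') (k + k')) (p + q + r + s)\<^esub> ksign (q * r)"
    and Swp_closed: "Swp E n m \<in> carrier (grp (Hom E (n + m) (m + n)) 0)"
    and Swp_cycle: "dif (Hom E (n + m) (m + n)) 0 (Swp E n m) = \<one>\<^bsub>grp (Hom E (n + m) (m + n)) (- 1)\<^esub>"
    and Swp_natural: "\<lbrakk>f \<in> carrier (grp (Hom E n m) p); g \<in> carrier (grp (Hom E n' m') q)\<rbrakk> \<Longrightarrow>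
      Cmp E (n + n') (m + m') (m' + m) (p + q) 0 (Ten E n m n' m' p q f g) (Swp E m m') =
      Cmp E (n + n') (n' + n) (m' + m) 0 (q + p) (Swp E n n') (Ten E n' m' n m q p g f)
        [^]\<^bsub>grp (Hom E (n + n') (m' + m)) (p + q)\<^esub> ksign (p * q)"
    and Swp_Swp: "Cmp E (n + m) (m + n) (n + m) 0 0 (Swp E n m) (Swp E m n) = Idm E (n + m)"
    and Swp_hexagon: "Swp E n (m + k) =
      Cmp E (n + m + k) (m + n + k) (m + k + n) 0 0
        (Ten E (n + m) (m + n) k k 0 0 (Swp E n m) (Idm E k))
        (Ten E m m (n + k) (k + n) 0 0 (Idm E m) (Swp E n k))"

locale dg_prop_functor =
  fixes A :: "'h dgprop" and E :: "'k dgprop" and i :: "nat \<Rightarrow> nat \<Rightarrow> int \<Rightarrow> 'h \<Rightarrow> 'k"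
  assumes map_hom: "i n m p \<in> hom (grp (Hom A n m) p) (grp (Hom E n m) p)"
    and map_dif: "f \<in> carrier (grp (Hom A n m) p) \<Longrightarrow>
      i n m (p - 1) (dif (Hom A n m) p f) = dif (Hom E n m) p (i n m p f)"
    and map_Cmp: "\<lbrakk>f \<in> carrier (grp (Hom A n m) p); g \<in> carrier (grp (Hom A m k) q)\<rbrakk> \<Longrightarrow>
      i n k (p + q) (Cmp A n m k p q f g) = Cmp E n m k p q (i n m p f) (i m k q g)"
    and map_Idm: "i n n 0 (Idm A n) = Idm E n"
    and map_Ten: "\<lbrakk>f \<in> carrier (grp (Hom A n m) p); g \<in> carrier (grp (Hom A n' m') q)\<rbrakk> \<Longrightarrow>
      i (n + n') (m + m') (p + q) (Ten A n m n' m' p q f g) =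
      Ten E n m n' m' p q (i n m p f) (i n' m' q g)"
    and map_Swp: "i (n + m) (m + n) 0 (Swp A n m) = Swp E n m"


section \<open>The prop \<open>A\<^sub>\<infinity>\<close>\<close>

text \<open>
  Planar rooted trees whose vertices and half-edges are named by elements of \<open>'x\<close>:
  \<open>Vertex v h\<^sub>0 [(h\<^sub>1, t\<^sub>1), \<dots>, (h\<^sub>k, t\<^sub>k)]\<close> has root vertex \<open>v\<close>, whose half-edges are the
  outgoing \<open>h\<^sub>0\<close> and the incoming \<open>h\<^sub>1, \<dots>, h\<^sub>k\<close> in planar order; \<open>h\<^sub>j\<close> is joined to the outgoing
  half-edge of the root vertex of \<open>t\<^sub>j\<close>, or is itself a labelled leaf if \<open>t\<^sub>j = Leaf a\<close>.  A
  bare \<open>Leaf a\<close> is the vertex-free tree, which contributes nothing to \<open>V \<squnion> H\<close>.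
\<close>

datatype 'x ptree = Leaf nat | Vertex 'x 'x "('x \<times> 'x ptree) list"

fun names :: "'x ptree \<Rightarrow> 'x list" where
  "names (Leaf a) = []"
| "names (Vertex v h0 cs) = v # h0 # concat (map (\<lambda>(h, t). h # names t) cs)"

fun leaves :: "'x ptree \<Rightarrow> nat list" where
  "leaves (Leaf a) = [a]"
| "leaves (Vertex v h0 cs) = concat (map (\<lambda>(h, t). leaves t) cs)"

text \<open>All vertices have valence at least 3.\<close>

fun reduced :: "'x ptree \<Rightarrow> bool" where
  "reduced (Leaf a) \<longleftrightarrow> True"
| "reduced (Vertex v h0 cs) \<longleftrightarrow> 2 \<le> length cs \<and> (\<forall>(h, t)\<in>set cs. reduced t)"

text \<open>The sum of \<open>|v| - 3\<close> over all vertices.\<close>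

fun tree_degree :: "'x ptree \<Rightarrow> int" where
  "tree_degree (Leaf a) = 0"
| "tree_degree (Vertex v h0 cs) = (int (length cs) + 1 - 3) + sum_list (map (\<lambda>(h, t). tree_degree t) cs)"

fun graft :: "(nat \<Rightarrow> 'x ptree) \<Rightarrow> 'x ptree \<Rightarrow> 'x ptree" where
  "graft s (Leaf a) = s a"
| "graft s (Vertex v h0 cs) = Vertex v h0 (map (\<lambda>(h, t). (h, graft s t)) cs)"

text \<open>
  Isomorphism classes of forests are forests without names.  The \<open>j\<close>-th tree of the list is the
  one whose root is labelled \<open>j\<close>.
\<close>

type_synonym forest = "unit ptree list"

definition shape :: "'x ptree list \<Rightarrow> forest"
  where "shape F = map (map_ptree (\<lambda>_. ())) F"

definition forest_names :: "'x ptree list \<Rightarrow> 'x list"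
  where "forest_names F = concat (map names F)"

definition forest_degree :: "'x ptree list \<Rightarrow> int"
  where "forest_degree F = sum_list (map tree_degree F)"

definition forests :: "nat \<Rightarrow> nat \<Rightarrow> forest set"
  where "forests n m =
    {F. length F = m \<and> (\<forall>t\<in>set F. reduced t) \<and>
        distinct (concat (map leaves F)) \<and> set (concat (map leaves F)) = {1..n}}"

text \<open>A choice of distinct names for a nameless forest.\<close>

fun name_tree :: "nat list \<Rightarrow> unit ptree \<Rightarrow> (nat list \<times> nat) ptree"
  and name_children ::
    "nat list \<Rightarrow> nat \<Rightarrow> (unit \<times> unit ptree) list \<Rightarrow> ((nat list \<times> nat) \<times> (nat list \<times> nat) ptree) list"
where
  "name_tree p (Leaf a) = Leaf a"
| "name_tree p (Vertex v h0 cs) = Vertex (p, 0) (p, 1) (name_children p 0 cs)"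
| "name_children p c [] = []"
| "name_children p c ((h, t) # cs) = ((p, c + 2), name_tree (p @ [c]) t) # name_children p (Suc c) cs"

definition name_forest :: "forest \<Rightarrow> (nat list \<times> nat) ptree list"
  where "name_forest F = map (\<lambda>(c, t). name_tree [c] t) (List.enumerate 0 F)"

text \<open>
  An orientation \<open>x\<^sub>1 \<and> \<dots> \<and> x\<^sub>N\<close> of a graph is given by the list of its vertices and
  half-edges.  Two such lists differ by the sign of the permutation relating them.  As trees with
  labelled leaves have no automorphisms, the oriented forests modulo \<open>(-G) = -1 \<cdot> G\<close> span the free
  abelian group on nameless forests, once each of these is oriented by its list of names in planar
  order; \<open>oriented F \<omega>\<close> is the element given by the forest \<open>F\<close> with orientation \<open>\<omega>\<close>.
\<close>

definition orient_sign :: "'x list \<Rightarrow> 'x list \<Rightarrow> int"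
  where "orient_sign xs ys = sign (THE \<pi>. \<pi> permutes {..<length ys} \<and> permute_list \<pi> ys = xs)"

definition oriented :: "'x ptree list \<Rightarrow> 'x list \<Rightarrow> forest \<Rightarrow>\<^sub>0 int"
  where "oriented F \<omega> = frag_cmul (orient_sign \<omega> (forest_names F)) (frag_of (shape F))"

text \<open>
  \<open>contracts F (v\<^sub>1, v\<^sub>2, h\<^sub>1, h\<^sub>2) F'\<close>: contracting the edge \<open>(h\<^sub>1, h\<^sub>2)\<close> between
  the vertices \<open>v\<^sub>1\<close> and \<open>v\<^sub>2\<close> of \<open>F\<close> yields \<open>F'\<close>, where the merged vertex is named
  \<open>v\<^sub>1\<close>.
\<close>

inductive contracts_tree :: "'x ptree \<Rightarrow> 'x \<times> 'x \<times> 'x \<times> 'x \<Rightarrow> 'x ptree \<Rightarrow> bool" where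
  "contracts_tree (Vertex v1 h0 (as @ (h1, Vertex v2 h2 cs) # bs)) (v1, v2, h1, h2)
     (Vertex v1 h0 (as @ cs @ bs))"
| "contracts_tree t e t' \<Longrightarrow>
   contracts_tree (Vertex v h0 (as @ (h, t) # bs)) e (Vertex v h0 (as @ (h, t') # bs))"

inductive contracts :: "'x ptree list \<Rightarrow> 'x \<times> 'x \<times> 'x \<times> 'x \<Rightarrow> 'x ptree list \<Rightarrow> bool" where
  "contracts_tree t e t' \<Longrightarrow> contracts (F @ t # G) e (F @ t' # G)"

text \<open>
  The sum of all blow-ups of \<open>G\<close>.  Each blow-up \<open>H\<close> is oriented by \<open>v\<^sub>1 \<and> v\<^sub>2 \<and> h\<^sub>1 \<and> h\<^sub>2 \<and> X\<close>
  where the contracted forest \<open>G'\<close>, a named copy of \<open>G\<close>, is oriented by \<open>v\<^sub>1 \<and> X\<close>.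
\<close>

definition blow_ups :: "forest \<Rightarrow> forest \<Rightarrow>\<^sub>0 int"
  where "blow_ups G =
    (\<Sum>(H, (v1, v2, h1, h2), G') \<in>
       {(H, e, G'). (\<forall>t\<in>set H. reduced t) \<and> contracts (name_forest H) e G' \<and> shape G' = G}.
      let X = remove1 v1 (forest_names G') in
        frag_cmul (orient_sign (v1 # X) (forest_names G'))
          (oriented (name_forest H) (v1 # v2 # h1 # h2 # X)))"

text \<open>The outputs of \<open>F\<close> are glued to the inputs of \<open>G\<close>.\<close>

definition glue :: "forest \<Rightarrow> forest \<Rightarrow> forest \<Rightarrow>\<^sub>0 int"
  where "glue F G =
    (let F' = map (map_ptree Inl) (name_forest F); G' = map (map_ptree Inr) (name_forest G) in
       oriented (map (graft (\<lambda>a. F' ! (a - 1))) G') (forest_names F' @ forest_names G'))"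

definition juxtapose :: "nat \<Rightarrow> forest \<Rightarrow> forest \<Rightarrow> forest \<Rightarrow>\<^sub>0 int"
  where "juxtapose n F G =
    (let F' = map (map_ptree Inl) (name_forest F); G' = map (map_ptree Inr) (name_forest G) in
       oriented (F' @ map (graft (\<lambda>a. Leaf (n + a))) G') (forest_names F' @ forest_names G'))"

definition A_infinity :: "(forest \<Rightarrow>\<^sub>0 int) dgprop"
  where "A_infinity = \<lparr>
    Ob = UNIV,
    Hom = (\<lambda>n m. \<lparr>
      grp = (\<lambda>p. free_Abelian_group {F \<in> forests n m. forest_degree F = p}),
      dif = (\<lambda>p. frag_extend blow_ups)\<rparr>),
    Cmp = (\<lambda>n m k p q x y. frag_extend (\<lambda>F. frag_extend (\<lambda>G. glue F G) y) x),
    Idm = (\<lambda>n. frag_of (map Leaf [1..<n + 1])),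
    Ten = (\<lambda>n m n' m' p q x y. frag_extend (\<lambda>F. frag_extend (\<lambda>G. juxtapose n F G) y) x),
    Swp = (\<lambda>n m. frag_of (map Leaf ([n + 1..<n + m + 1] @ [1..<n + 1])))\<rparr>"

definition prop_with_A_infinity_mult ::
  "'h dgprop \<Rightarrow> (nat \<Rightarrow> nat \<Rightarrow> int \<Rightarrow> (forest \<Rightarrow>\<^sub>0 int) \<Rightarrow> 'h) \<Rightarrow> bool"
  where "prop_with_A_infinity_mult E i \<longleftrightarrow> dg_prop E \<and> dg_prop_functor A_infinity E i"


section \<open>The morphisms \<open>f\<^sub>n\<^sub>,\<^sub>k\<close>\<close>

text \<open>
  A blow-up of \<open>l\<^sub>n\<close> has a white vertex \<open>White\<close>, a black vertex \<open>Black\<close>, the edge \<open>(EdgeW, EdgeB)\<close> between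
  them, and the leaves \<open>Lf 1, \<dots>, Lf n\<close>.  It is determined by the first leaf \<open>i\<close> of the
  block \<open>i, \<dots>, i + n - k\<close> (modulo \<open>n\<close>) that is moved to the black vertex.
\<close>

datatype lname = White | Black | EdgeW | EdgeB | Lf nat

definition moved :: "nat \<Rightarrow> nat \<Rightarrow> nat \<Rightarrow> nat list"
  where "moved n k i = map (\<lambda>t. (i - 1 + t) mod n + 1) [0..<n - k + 1]"

text \<open>The half-edges of the white vertex in their cyclic order, beginning with the first one.\<close>

definition white_half_edges :: "nat \<Rightarrow> nat \<Rightarrow> nat \<Rightarrow> lname list"
  where "white_half_edges n k i =
    (let rest = filter (\<lambda>a. a \<notin> set (moved n k i)) [1..<n + 1] in
       if 1 \<in> set (moved n k i) then EdgeW # map Lf rest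
       else map Lf (filter (\<lambda>a. a < i) rest) @ EdgeW # map Lf (filter (\<lambda>a. i < a) rest))"

definition black_forest :: "nat \<Rightarrow> nat \<Rightarrow> nat \<Rightarrow> lname ptree list"
  where "black_forest n k i =
    map (\<lambda>g. case g of
           Lf a \<Rightarrow> Leaf a
         | _ \<Rightarrow> Vertex Black EdgeB (map (\<lambda>a. (Lf a, Leaf a)) (moved n k i)))
      (white_half_edges n k i)"

text \<open>
  Gluing \<open>l\<^sub>k\<close>, oriented by the white vertex followed by its half-edges in order, to the forest
  oriented by \<open>\<omega>\<close> gives the orientation obtained by juxtaposition.  The coefficient compares it
  with the prescribed orientation \<open>w \<and> b \<and> e\<^sub>w \<and> e\<^sub>b \<and> h\<^sub>1 \<and> \<dots> \<and> h\<^sub>n\<close> of the blow-up.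
\<close>

definition f_mor :: "nat \<Rightarrow> nat \<Rightarrow> forest \<Rightarrow>\<^sub>0 int"
  where "f_mor n k =
    (\<Sum>i\<in>{1..n}.
      let \<omega> = forest_names (black_forest n k i) in
        frag_cmul
          (orient_sign (\<omega> @ White # white_half_edges n k i) (White # Black # EdgeW # EdgeB # map Lf [1..<n + 1]))
          (oriented (black_forest n k i) \<omega>))"

text \<open>\<open>i(f\<^sub>n\<^sub>,\<^sub>k)\<close>, which has degree \<open>n - k - 1\<close>.\<close>

abbreviation f_img ::
  "(nat \<Rightarrow> nat \<Rightarrow> int \<Rightarrow> (forest \<Rightarrow>\<^sub>0 int) \<Rightarrow> 'h) \<Rightarrow> nat \<Rightarrow> nat \<Rightarrow> 'h"
  where "f_img i n k \<equiv> i n k (int n - int k - 1) (f_mor n k)"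


section \<open>Hochschild and coHochschild constructions\<close>

text \<open>
  A universe closed under sequences.  \<open>Ch\<close> consists of the complexes with carriers in
  \<open>'a univ\<close>, so that the Hochschild and coHochschild constructions stay inside \<open>Ch\<close> and can be
  iterated.
\<close>

datatype 'a univ = Atom 'a | Fam "nat \<Rightarrow> 'a univ"

primrec unfam :: "'a univ \<Rightarrow> nat \<Rightarrow> 'a univ" where
  "unfam (Fam x) = x"

definition fam_group :: "(nat \<Rightarrow> 'a univ) monoid \<Rightarrow> 'a univ monoid"
  where "fam_group G = \<lparr>
    carrier = Fam ` carrier G,
    monoid.mult = (\<lambda>x y. Fam (unfam x \<otimes>\<^bsub>G\<^esub> unfam y)),
    one = Fam \<one>\<^bsub>G\<^esub>\<rparr>"

type_synonym 'a ufun = "(nat, 'a univ, 'a univ) dgfun"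

type_synonym 'a uprop = "'a univ dgprop"

type_synonym 'a mult_map = "nat \<Rightarrow> nat \<Rightarrow> int \<Rightarrow> (forest \<Rightarrow>\<^sub>0 int) \<Rightarrow> 'a univ"

text \<open>
  \<open>L\<^sub>n\<close> is free on \<open>l\<^sub>n\<close> of degree \<open>n - 1\<close>, so an element of degree \<open>p\<close> of
  \<open>\<Oplus>\<^sub>n \<Phi>(n + m) \<otimes> L\<^sub>n\<close> is a finitely supported family \<open>x\<close>, with \<open>x n\<close> in \<open>\<Phi>(n + m)\<close> of
  degree \<open>p - (n - 1)\<close>, standing for the sum of the \<open>x n \<otimes> l\<^sub>n\<close>.  In the action of a morphism,
  \<open>\<Phi>(id + f) \<otimes> id\<close> carries the Koszul sign \<open>(-1)^(|f| |l\<^sub>n|)\<close>.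
\<close>

definition Hoch :: "'a uprop \<Rightarrow> 'a mult_map \<Rightarrow> 'a ufun \<Rightarrow> 'a ufun"
  where "Hoch E i \<Phi> = \<lparr>
    Obj = (\<lambda>m. \<lparr>
      grp = (\<lambda>p. fam_group (sum_group {1..} (\<lambda>n. grp (Obj \<Phi> (n + m)) (p - (int n - 1))))),
      dif = (\<lambda>p x. Fam (\<lambda>k\<in>{1..}.
        let G = grp (Obj \<Phi> (k + m)) (p - (int k - 1) - 1) in
          dif (Obj \<Phi> (k + m)) (p - (int k - 1)) (unfam x k) \<otimes>\<^bsub>G\<^esub>
          finprod G
            (\<lambda>n. Act \<Phi> (n + m) (k + m) (int n - int k - 1)
                   (Ten E n k m m (int n - int k - 1) 0 (f_img i n k) (Idm E m))
                   (p - (int n - 1)) (unfam x n) [^]\<^bsub>G\<^esub> ksign (p - (int n - 1)))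
            {n. k < n \<and> unfam x n \<noteq> \<one>\<^bsub>grp (Obj \<Phi> (n + m)) (p - (int n - 1))\<^esub>}))\<rparr>),
    Act = (\<lambda>a b r f p x. Fam (\<lambda>n\<in>{1..}.
      Act \<Phi> (n + a) (n + b) r (Ten E n n a b 0 r (Idm E n) f) (p - (int n - 1)) (unfam x n)
        [^]\<^bsub>grp (Obj \<Phi> (n + b)) (p - (int n - 1) + r)\<^esub> ksign (r * (int n - 1))))\<rparr>"

text \<open>
  The action of the Hochschild construction on a natural transformation \<open>\<alpha> : \<Phi> \<rightarrow> \<Psi>\<close> of degree
  \<open>r\<close>, which is \<open>\<alpha> \<otimes> id\<close>, again with the sign \<open>(-1)^(r |l\<^sub>n|)\<close>.
\<close>

definition Hoch_map ::
  "'a ufun \<Rightarrow> int \<Rightarrow> (nat \<Rightarrow> int \<Rightarrow> 'a univ \<Rightarrow> 'a univ) \<Rightarrow> nat \<Rightarrow> int \<Rightarrow> 'a univ \<Rightarrow> 'a univ"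
  where "Hoch_map \<Psi> r \<alpha> m p x = Fam (\<lambda>n\<in>{1..}.
    \<alpha> (n + m) (p - (int n - 1)) (unfam x n)
      [^]\<^bsub>grp (Obj \<Psi> (n + m)) (p - (int n - 1) + r)\<^esub> ksign (r * (int n - 1)))"

primrec Hoch_iter_map ::
  "'a uprop \<Rightarrow> 'a mult_map \<Rightarrow> nat \<Rightarrow> 'a ufun \<Rightarrow> int \<Rightarrow>
   (nat \<Rightarrow> int \<Rightarrow> 'a univ \<Rightarrow> 'a univ) \<Rightarrow> nat \<Rightarrow> int \<Rightarrow> 'a univ \<Rightarrow> 'a univ"
where
  "Hoch_iter_map E i 0 \<Psi> r \<alpha> = \<alpha>"
| "Hoch_iter_map E i (Suc n) \<Psi> r \<alpha> = Hoch_map ((Hoch E i ^^ n) \<Psi>) r (Hoch_iter_map E i n \<Psi> r \<alpha>)"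

text \<open>
  A contravariant functor \<open>\<Psi>\<close> on \<open>E\<close> is recorded by the left action
  \<open>E(n, m) \<otimes> \<Psi>(m) \<rightarrow> \<Psi>(n)\<close>: here \<open>Act \<Psi> n m r f p x\<close>, for \<open>f : n \<rightarrow> m\<close> and \<open>x\<close> in
  \<open>\<Psi>(m)\<close>, is \<open>\<Psi>(f)(x)\<close>.  For \<open>\<Psi> = E(-, b)\<close> it is the composite \<open>x \<circ> f\<close>, without a
  sign.  An element \<open>h\<close> of \<open>\<Prod>\<^sub>n Hom(L\<^sub>n, \<Psi>(n + m))\<close> is recorded by the values \<open>h(l\<^sub>n)\<close>; the
  left action on it has the Koszul sign \<open>(-1)^(|f| |l\<^sub>n|)\<close>.
\<close>

definition coHoch :: "'a uprop \<Rightarrow> 'a mult_map \<Rightarrow> 'a ufun \<Rightarrow> 'a ufun"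
  where "coHoch E i \<Psi> = \<lparr>
    Obj = (\<lambda>m. \<lparr>
      grp = (\<lambda>p. fam_group (product_group {1..} (\<lambda>n. grp (Obj \<Psi> (n + m)) (p + (int n - 1))))),
      dif = (\<lambda>p h. Fam (\<lambda>n\<in>{1..}.
        let G = grp (Obj \<Psi> (n + m)) (p + (int n - 1) - 1) in
          (dif (Obj \<Psi> (n + m)) (p + (int n - 1)) (unfam h n) \<otimes>\<^bsub>G\<^esub>
           inv\<^bsub>G\<^esub> finprod G
             (\<lambda>k. Act \<Psi> (n + m) (k + m) (int n - int k - 1)
                    (Ten E n k m m (int n - int k - 1) 0 (f_img i n k) (Idm E m))
                    (p + (int k - 1)) (unfam h k))
             {1..<n})
          [^]\<^bsub>G\<^esub> ksign (int n - 1)))\<rparr>),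
    Act = (\<lambda>a b r f p h. Fam (\<lambda>n\<in>{1..}.
      Act \<Psi> (n + a) (n + b) r (Ten E n n a b 0 r (Idm E n) f) (p + (int n - 1)) (unfam h n)
        [^]\<^bsub>grp (Obj \<Psi> (n + a)) (p + (int n - 1) + r)\<^esub> ksign (r * (int n - 1))))\<rparr>"


section \<open>Formal operations\<close>

text \<open>The dg-functor \<open>\<Phi> \<mapsto> C\<^sup>n(\<Phi>)(m)\<close> from \<open>Fun(E, Ch)\<close> to \<open>Ch\<close>.\<close>

definition Hoch_fun ::
  "'a uprop \<Rightarrow> 'a mult_map \<Rightarrow> nat \<times> nat \<Rightarrow>
   ('a ufun, nat \<Rightarrow> int \<Rightarrow> 'a univ \<Rightarrow> 'a univ, 'a univ) dgfun"
  where "Hoch_fun E i = (\<lambda>(n, m). \<lparr>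
    Obj = (\<lambda>\<Phi>. Obj ((Hoch E i ^^ n) \<Phi>) m),
    Act = (\<lambda>\<Phi> \<Psi> r \<alpha>. Hoch_iter_map E i n \<Psi> r \<alpha> m)\<rparr>)"

definition Nat_cx ::
  "'a uprop \<Rightarrow> 'a mult_map \<Rightarrow> nat \<times> nat \<Rightarrow> nat \<times> nat \<Rightarrow>
   ('a ufun \<Rightarrow> int \<Rightarrow> 'a univ \<Rightarrow> 'a univ) dgmod"
  where "Nat_cx E i s t = nat_trans (Fun_cat E) (Hoch_fun E i s) (Hoch_fun E i t)"

definition representable :: "'a uprop \<Rightarrow> nat \<Rightarrow> 'a ufun"
  where "representable E a = \<lparr>
    Obj = Hom E a,
    Act = (\<lambda>n m p f q x. Cmp E a n m q p x f)\<rparr>"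

text \<open>
  The contravariant functor \<open>a \<mapsto> C\<^sup>n(E(a, -))(m)\<close>.  Precomposition with \<open>f : a \<rightarrow> b\<close>, as a
  natural transformation \<open>E(b, -) \<rightarrow> E(a, -)\<close> of degree \<open>|f|\<close>, sends \<open>g\<close> to
  \<open>(-1)^(|f| |g|) g \<circ> f\<close>; the second sign turns the right action of \<open>C\<^sup>n\<close> of it back into a
  left action, so that in total no sign remains and \<open>f\<close> just precomposes all components.
\<close>

definition Hoch_bimodule :: "'a uprop \<Rightarrow> 'a mult_map \<Rightarrow> nat \<Rightarrow> nat \<Rightarrow> 'a ufun"
  where "Hoch_bimodule E i n m = \<lparr>
    Obj = (\<lambda>a. Obj ((Hoch E i ^^ n) (representable E a)) m),
    Act = (\<lambda>a b r f p x.
      Hoch_iter_map E i n (representable E a) r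
        (\<lambda>c q g. Cmp E a b c r q f g [^]\<^bsub>grp (Hom E a c) (r + q)\<^esub> ksign (r * q)) m p x
        [^]\<^bsub>grp (Obj ((Hoch E i ^^ n) (representable E a)) m) (p + r)\<^esub> ksign (r * p))\<rparr>"

definition coHoch_Hoch_cx ::
  "'a uprop \<Rightarrow> 'a mult_map \<Rightarrow> nat \<times> nat \<Rightarrow> nat \<times> nat \<Rightarrow> 'a univ dgmod"
  where "coHoch_Hoch_cx E i = (\<lambda>(n1, m1) (n2, m2).
    Obj ((coHoch E i ^^ n1) (Hoch_bimodule E i n2 m2)) m1)"


section \<open>The complex in coordinates\<close>

definition indices :: "nat \<Rightarrow> nat list set"
  where "indices n = {js. length js = n \<and> (\<forall>j\<in>set js. 1 \<le> j)}"

text \<open>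
  \<open>V[s]\<^sub>p = V\<^sub>p\<^sub>-\<^sub>s\<close> with \<open>s = k - j + n\<^sub>1 - n\<^sub>2\<close>: the degree in \<open>E\<close> of the \<open>(js, ks)\<close>-component
  of an element of total degree \<open>p\<close>.
\<close>

definition op_degree :: "nat list \<Rightarrow> nat list \<Rightarrow> int \<Rightarrow> int"
  where "op_degree js ks p =
    p - (int (sum_list ks) - int (sum_list js) + int (length js) - int (length ks))"

definition op_group :: "'a uprop \<Rightarrow> nat \<Rightarrow> nat \<Rightarrow> nat list \<Rightarrow> nat list \<Rightarrow> int \<Rightarrow> 'a univ monoid"
  where "op_group E m1 m2 js ks p =
    grp (Hom E (sum_list js + m1) (sum_list ks + m2)) (op_degree js ks p)"

text \<open>\<open>id\<^sub>a + i(f\<^sub>n\<^sub>,\<^sub>k) + id\<^sub>b\<close>\<close>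

definition whisker :: "'a uprop \<Rightarrow> 'a mult_map \<Rightarrow> nat \<Rightarrow> nat \<Rightarrow> nat \<Rightarrow> nat \<Rightarrow> 'a univ"
  where "whisker E i a n k b =
    Ten E (a + n) (a + k) b b (int n - int k - 1) 0
      (Ten E a a n k 0 (int n - int k - 1) (Idm E a) (f_img i n k)) (Idm E b)"

text \<open>The sum of \<open>|l\<^sub>j|\<close> over the first \<open>t\<close> entries of the list.\<close>

definition l_degree :: "nat \<Rightarrow> nat list \<Rightarrow> int"
  where "l_degree t js = (\<Sum>j\<leftarrow>take t js. int j - 1)"

text \<open>
  The components of the multi-Hochschild and the multi-coHochschild differential.  In the
  \<open>t\<close>-th Hochschild direction \<open>l\<^sub>k\<close> is replaced by \<open>f\<^sub>k\<^sub>,\<^sub>k\<^sub>' \<otimes> l\<^sub>k\<^sub>'\<close> for \<open>k' < k\<close>.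
\<close>

definition op_Hoch ::
  "'a uprop \<Rightarrow> 'a mult_map \<Rightarrow> nat \<Rightarrow> nat \<Rightarrow> int \<Rightarrow>
   (nat list \<Rightarrow> nat list \<Rightarrow> 'a univ) \<Rightarrow> nat list \<Rightarrow> nat list \<Rightarrow> 'a univ"
  where "op_Hoch E i m1 m2 p g js ks =
    (let G = op_group E m1 m2 js ks (p - 1) in
      finprod G
        (\<lambda>(t, k).
          let ks' = ks[t := k]; q = op_degree js ks' p in
            Cmp E (sum_list js + m1) (sum_list ks' + m2) (sum_list ks + m2)
              q (int k - int (ks ! t) - 1)
              (g js ks')
              (whisker E i (sum_list (take t ks)) k (ks ! t) (sum_list (drop (Suc t) ks) + m2))
            [^]\<^bsub>G\<^esub> ksign (q + l_degree t ks * (int k - int (ks ! t))))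
        {(t, k). t < length ks \<and> ks ! t < k \<and>
           g js (ks[t := k]) \<noteq> \<one>\<^bsub>op_group E m1 m2 js (ks[t := k]) p\<^esub>})"

definition op_coHoch ::
  "'a uprop \<Rightarrow> 'a mult_map \<Rightarrow> nat \<Rightarrow> nat \<Rightarrow> int \<Rightarrow>
   (nat list \<Rightarrow> nat list \<Rightarrow> 'a univ) \<Rightarrow> nat list \<Rightarrow> nat list \<Rightarrow> 'a univ"
  where "op_coHoch E i m1 m2 p g js ks =
    (let G = op_group E m1 m2 js ks (p - 1) in
      finprod G
        (\<lambda>(t, j).
          let js' = js[t := j]; q = op_degree js' ks p in
            Cmp E (sum_list js + m1) (sum_list js' + m1) (sum_list ks + m2)
              (int (js ! t) - int j - 1) q
              (whisker E i (sum_list (take t js)) (js ! t) j (sum_list (drop (Suc t) js) + m1))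
              (g js' ks)
            [^]\<^bsub>G\<^esub> ksign (l_degree t js * (int (js ! t) - int j)))
        {(t, j). t < length js \<and> 1 \<le> j \<and> j < js ! t})"

text \<open>
  The complex \<open>\<Prod> \<Oplus> E(j + m\<^sub>1, k + m\<^sub>2)[k - j + n\<^sub>1 - n\<^sub>2]\<close>.  The overall sign
  \<open>(-1)^(|l\<^sub>j\<^sub>1| + |l\<^sub>j\<^sub>2| + \<dots>)\<close> is the one in the differential of \<open>Hom(L\<^sub>n, -)\<close>.
\<close>

definition formal_op_cx ::
  "'a uprop \<Rightarrow> 'a mult_map \<Rightarrow> nat \<times> nat \<Rightarrow> nat \<times> nat \<Rightarrow> (nat list \<Rightarrow> nat list \<Rightarrow> 'a univ) dgmod"
  where "formal_op_cx E i = (\<lambda>(n1, m1) (n2, m2). \<lparr>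
    grp = (\<lambda>p. product_group (indices n1) (\<lambda>js. sum_group (indices n2) (\<lambda>ks.
      op_group E m1 m2 js ks p))),
    dif = (\<lambda>p g. \<lambda>js\<in>indices n1. \<lambda>ks\<in>indices n2.
      let G = op_group E m1 m2 js ks (p - 1) in
        (dif (Hom E (sum_list js + m1) (sum_list ks + m2)) (op_degree js ks p) (g js ks)
           \<otimes>\<^bsub>G\<^esub> op_Hoch E i m1 m2 p g js ks
           \<otimes>\<^bsub>G\<^esub> inv\<^bsub>G\<^esub> op_coHoch E i m1 m2 p g js ks)
        [^]\<^bsub>G\<^esub> ksign (l_degree n1 js))\<rparr>)"

text \<open>
  The outermost of the iterated constructions is the one adjacent to \<open>m\<close>, and so belongs to the
  last index.
\<close>

definition coordinates :: "nat \<Rightarrow> nat \<Rightarrow> int \<Rightarrow> 'a univ \<Rightarrow> nat list \<Rightarrow> nat list \<Rightarrow> 'a univ"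
  where "coordinates n1 n2 p x =
    (\<lambda>js\<in>indices n1. \<lambda>ks\<in>indices n2. foldl unfam x (rev js @ rev ks))"

end

theory Submission
  imports Defs
begin

text \<open>
  A natural operation on \<open>\<Oplus> \<Phi>(j + m\<^sub>1) \<otimes> L\<close> is determined by its values on the elements
  \<open>id \<otimes> l\<close> for the representable functors \<open>E(j + m\<^sub>1, -)\<close>, because every \<open>x \<otimes> l\<close> is the image of
  \<open>id \<otimes> l\<close> under the Yoneda transformation of \<open>x\<close>.  Conversely these values \<open>g\<close> are arbitrary: they
  act by \<open>x \<otimes> l \<mapsto> \<Sum> \<Phi>(g)(x) \<otimes> l'\<close>, without any sign.  As \<open>id\<close> is a cycle, \<open>d(id \<otimes> l)\<close> is a sum
  of terms \<open>f \<otimes> l'\<close> with \<open>f\<close> a whiskered \<open>f\<^sub>n\<^sub>,\<^sub>k\<close>, and naturality along precomposition with \<open>f\<close> turns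
  the operation of such a term into the coHochschild differential.
\<close>

text \<open>The cancellation of signs is a parity count. For a coordinate of \<open>x\<close> at
  \<open>js\<close> of degree s and a component \<open>g js ks\<close> of degree t, signs come from
  the iterated Hochschild maps in source and target, from naturality of an operation of degree p and
  from the Yoneda transformation; the exponents are s times \<open>lsum js\<close>,
  \<open>lsum ks\<close>, p and t. The shift in \<open>op_degree\<close> says t = p + lsum js - lsum
  ks, so their sum is even.

  A product over \<open>js\<close> of sums over \<open>ks\<close> is what acts: an element meets
  only finitely many \<open>js\<close>, and each of these produces finitely many \<open>ks\<close>.

  The obstacle is the iteration, which buries an element under nested sequences. Elements are
  therefore handled by their coordinates at lists of indices, where differential and action of the
  n-fold constructions have closed formulas, each proved by induction on n. The two isomorphisms
  then share one comparison: both attach to each \<open>js\<close> an element of the bimodule,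
  either as a coordinate in the iterated product or as a value on a generator, and both families
  obey the same formula for the differential.\<close>

section \<open>Blow-ups of a white vertex with \<open>n\<close> leaves and the degree of
  \<open>f_mor\<close>\<close>

lemma
  assumes "1 \<le> k" "k < n" "1 \<le> i" "i \<le> n"
  shows distinct_moved: "distinct (moved n k i)"
    and set_moved: "set (moved n k i) \<subseteq> {1..n}"
    and length_moved: "length (moved n k i) = n - k + 1"
    and first_moved: "i \<in> set (moved n k i)"
proof -
  have "inj_on (\<lambda>t. (i - 1 + t) mod n + 1) {0..<n - k + 1}"
  proof (rule inj_onI)
    fix s t
    assume *: "s \<in> {0..<n - k + 1}" "t \<in> {0..<n - k + 1}"
      "(i - 1 + s) mod n + 1 = (i - 1 + t) mod n + 1"
    then have "s < n" "t < n" "(i - 1 + s) mod n = (i - 1 + t) mod n"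
      using assms by auto
    \<comment> \<open>Adding \<open>n - (i - 1)\<close> completes the shift \<open>i - 1\<close> to
      a full turn \<open>n\<close>, which vanishes modulo \<open>n\<close>.\<close>
    then have "s mod n = t mod n"
      using mod_add_cong[of "i - 1 + s" n "i - 1 + t" "n - (i - 1)" "n - (i - 1)"] assms
      by (simp add: add.commute add.left_commute)
    with \<open>s < n\<close> \<open>t < n\<close> show "s = t"
      by simp
  qed
  then show "distinct (moved n k i)"
    unfolding moved_def distinct_map by (metis atLeastLessThan_upt distinct_upt)
  show "set (moved n k i) \<subseteq> {1..n}"
    using assms by (auto simp: moved_def Suc_le_eq)
  show "length (moved n k i) = n - k + 1"
    by (simp add: moved_def)
  show "i \<in> set (moved n k i)"
    unfolding moved_def set_map using assms by (intro image_eqI[of _ _ 0]) auto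
qed

text \<open>The moved block may wrap around from \<open>n\<close> to 1, so its list need not be
  increasing. Multisets suffice: neither the set of leaf labels nor the degree of the black forest
  depends on the order.\<close>

lemma mset_moved_rest:
  assumes "1 \<le> k" "k < n" "1 \<le> i" "i \<le> n"
  shows "mset (moved n k i) + mset (filter (\<lambda>a. a \<notin> set (moved n k i)) [1..<n + 1]) = mset [1..<n + 1]"
proof -
  have "mset (filter (\<lambda>a. a \<in> set (moved n k i)) [1..<n + 1]) = mset (moved n k i)"
    using distinct_moved[OF assms] set_moved[OF assms]
    by (intro iffD1[OF set_eq_iff_mset_eq_distinct]) auto
  then show ?thesis
    by (metis mset_filter multiset_partition)
qed

text \<open>The two cases in \<open>white_half_edges\<close> differ only in where
  \<open>EdgeW\<close> stands. In the second one \<open>rest\<close> is split at \<open>i\<close>,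
  and nothing is lost because \<open>i\<close> itself is a moved leaf.\<close>

lemma mset_white_half_edges:
  assumes "1 \<le> k" "k < n" "1 \<le> i" "i \<le> n"
  shows "mset (white_half_edges n k i) =
    {#EdgeW#} + image_mset Lf (mset (filter (\<lambda>a. a \<notin> set (moved n k i)) [1..<n + 1]))"
proof -
  define rest where "rest = filter (\<lambda>a. a \<notin> set (moved n k i)) [1..<n + 1]"
  have i: "i \<notin> set rest"
    using first_moved[OF assms] by (simp add: rest_def)
  have "mset (filter (\<lambda>a. i < a) rest) = filter_mset (\<lambda>a. \<not> a < i) (mset rest)"
    unfolding mset_filter[symmetric] using i
    by (intro arg_cong[of _ _ mset] filter_cong) (auto simp: not_less order_le_less)
  then have "mset rest = mset (filter (\<lambda>a. a < i) rest) + mset (filter (\<lambda>a. i < a) rest)"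
    by (metis mset_filter multiset_partition)
  then have "image_mset Lf (mset rest) =
      image_mset Lf (mset (filter (\<lambda>a. a < i) rest)) + image_mset Lf (mset (filter (\<lambda>a. i < a) rest))"
    by (metis image_mset_union)
  then show ?thesis
    unfolding white_half_edges_def Let_def rest_def[symmetric] by (auto simp del: mset_filter)
qed

text \<open>Of the \<open>n\<close> leaves \<open>n - k + 1\<close> move away, so the white vertex
  keeps \<open>k - 1\<close> of them and gains the new edge.\<close>

lemma length_white_half_edges:
  assumes "1 \<le> k" "k < n" "1 \<le> i" "i \<le> n"
  shows "length (white_half_edges n k i) = k"
proof -
  have "size (mset (moved n k i)) + size (mset (filter (\<lambda>a. a \<notin> set (moved n k i)) [1..<n + 1])) = n"
    unfolding size_union[symmetric] mset_moved_rest[OF assms] by simp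
  then have "size (mset (white_half_edges n k i)) + length (moved n k i) = Suc n"
    unfolding mset_white_half_edges[OF assms] by (simp del: mset_filter upt_Suc)
  then show ?thesis
    using length_moved[OF assms] assms by simp
qed

text \<open>Labels, reducedness and degree do not see the names, so they may be computed on a named
  forest instead of its \<open>shape\<close>.\<close>

lemma leaves_map_ptree [simp]: "leaves (map_ptree f t) = leaves t"
  by (induction t) (auto intro!: arg_cong[of _ _ concat] simp: map_prod_def split: prod.splits)

lemma reduced_map_ptree [simp]: "reduced (map_ptree f t) = reduced t"
  by (induction t) (auto simp: map_prod_def split: prod.splits)

lemma tree_degree_map_ptree [simp]: "tree_degree (map_ptree f t) = tree_degree t"
  by (induction t) (auto intro!: arg_cong[of _ _ sum_list] simp: map_prod_def split: prod.splits)

text \<open>One tree is the black corolla with \<open>n - k + 1\<close> incoming half-edges, the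
  other \<open>k - 1\<close> are bare leaves. Thus \<open>k < n\<close> gives reducedness, and the
  degree is that of the corolla, (n - k + 1) + 1 - 3.\<close>

lemma shape_black_forest:
  assumes "1 \<le> k" "k < n" "1 \<le> i" "i \<le> n"
  shows "shape (black_forest n k i) \<in> forests n k"
    and "forest_degree (shape (black_forest n k i)) = int n - int k - 1"
proof -
  let ?M = "moved n k i" and ?W = "white_half_edges n k i"
  let ?rest = "filter (\<lambda>a. a \<notin> set ?M) [1..<n + 1]"
  \<comment> \<open>Every name other than some \<open>Lf a\<close> gives the black corolla, but
    \<open>EdgeW\<close> is the only such name among the white half-edges.\<close>
  define tr where "tr g = (case g of
           Lf a \<Rightarrow> Leaf a
         | _ \<Rightarrow> Vertex Black EdgeB (map (\<lambda>a. (Lf a, Leaf a)) ?M))" for g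
  have tr: "tr (Lf a) = Leaf a" "tr EdgeW = Vertex Black EdgeB (map (\<lambda>a. (Lf a, Leaf a)) ?M)" for a
    by (simp_all add: tr_def)
  have BF: "black_forest n k i = map tr ?W"
    by (simp add: black_forest_def tr_def[abs_def])
  have leavesEdge: "leaves (tr EdgeW) = ?M"
    by (simp add: tr o_def)
  have 1: "mset (concat (map leaves (shape (black_forest n k i)))) = mset [1..<n + 1]"
  proof -
    have "mset (concat (map leaves (shape (black_forest n k i)))) =
        \<Sum>\<^sub># (image_mset (\<lambda>g. mset (leaves (tr g))) (mset ?W))"
      by (simp add: BF shape_def mset_concat sum_mset_sum_list o_def flip: mset_map)
    also have "\<dots> = mset ?M + \<Sum>\<^sub># (image_mset (\<lambda>a. {#a#}) (mset ?rest))"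
      unfolding mset_white_half_edges[OF assms]
      by (simp add: leavesEdge tr multiset.map_comp o_def)
    also have "\<dots> = mset [1..<n + 1]"
      using mset_moved_rest[OF assms] by simp
    finally show ?thesis .
  qed
  have red: "reduced (tr g)" for g
    using assms by (cases g) (auto simp: tr_def length_moved[OF assms])
  have dist: "distinct (concat (map leaves (shape (black_forest n k i))))"
    using mset_eq_imp_distinct_iff[OF 1] by simp
  have set: "set (concat (map leaves (shape (black_forest n k i)))) = {1..n}"
    using mset_eq_setD[OF 1] by auto
  show "shape (black_forest n k i) \<in> forests n k"
    using dist set length_white_half_edges[OF assms]
    unfolding forests_def by (auto simp: shape_def BF red)
  have "forest_degree (shape (black_forest n k i)) =
      \<Sum>\<^sub># (image_mset (\<lambda>g. tree_degree (tr g)) (mset ?W))"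
    by (simp add: BF shape_def forest_degree_def sum_mset_sum_list o_def flip: mset_map)
  also have "\<dots> = tree_degree (tr EdgeW)"
    unfolding mset_white_half_edges[OF assms] by (simp add: tr multiset.map_comp o_def)
  also have "\<dots> = int n - int k - 1"
    using assms by (simp add: tr o_def length_moved[OF assms] of_nat_diff)
  finally show "forest_degree (shape (black_forest n k i)) = int n - int k - 1" .
qed

text \<open>Membership in a free abelian group constrains the keys alone, and the orientation signs
  merely rescale. This makes the whiskered images of \<open>f_mor\<close> composable morphisms of
  \<open>E\<close> of degree n - k - 1.\<close>

lemma f_mor_closed:
  assumes "1 \<le> k" "k < n"
  shows "f_mor n k \<in> carrier (grp (Hom A_infinity n k) (int n - int k - 1))"
proof -
  let ?S = "{F \<in> forests n k. forest_degree F = int n - int k - 1}"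
  have sum: "Poly_Mapping.keys (\<Sum>i\<in>I. g i) \<subseteq> ?S"
    if "\<And>i. i \<in> I \<Longrightarrow> Poly_Mapping.keys (g i) \<subseteq> ?S" for I and g :: "nat \<Rightarrow> forest \<Rightarrow>\<^sub>0 int"
    using that keys_sum[of g I] by blast
  have "Poly_Mapping.keys (f_mor n k) \<subseteq> ?S"
    unfolding f_mor_def
  proof (rule sum)
    fix i assume "i \<in> {1..n}"
    then have "shape (black_forest n k i) \<in> ?S"
      using shape_black_forest[OF assms] by simp
    then show "Poly_Mapping.keys (let \<omega> = forest_names (black_forest n k i) in
        frag_cmul
          (orient_sign (\<omega> @ White # white_half_edges n k i) (White # Black # EdgeW # EdgeB # map Lf [1..<n + 1]))
          (oriented (black_forest n k i) \<omega>)) \<subseteq> ?S"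
      unfolding Let_def oriented_def frag_cmul_cmul
      by (intro order_trans[OF keys_cmul]) simp
  qed
  then show ?thesis
    by (simp add: A_infinity_def)
qed


section \<open>Commutative groups\<close>

lemma ksign_add: "ksign a * ksign b = ksign (a + b)"
  by (auto simp: ksign_def)

lemma ksign_cong: "even (a - b) \<Longrightarrow> ksign a = ksign b"
  by (auto simp: ksign_def)

text \<open>The sign computations below collect all exponents in a single \<open>ksign\<close> with
  this rule and then compare parities.\<close>

lemma (in group) pow_ksign_ksign:
  "x \<in> carrier G \<Longrightarrow> (x [^] ksign a) [^] ksign b = x [^] ksign (a + b)"
  by (simp add: int_pow_pow ksign_add)

lemma (in group) pow_ksign_even: "x \<in> carrier G \<Longrightarrow> even a \<Longrightarrow> x [^] ksign a = x"
  by (simp add: ksign_def)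

text \<open>Over an infinite index set both sides are the unit by convention.\<close>

lemma hom_finprod:
  assumes "h \<in> hom G H" "comm_group G" "comm_group H" "f \<in> A \<rightarrow> carrier G"
  shows "h (finprod G f A) = finprod H (\<lambda>x. h (f x)) A"
proof -
  interpret G: comm_group G by fact
  interpret H: comm_group H by fact
  have one: "h \<one>\<^bsub>G\<^esub> = \<one>\<^bsub>H\<^esub>"
    by (rule hom_one[OF assms(1)]) unfold_locales
  show ?thesis
    using assms(4)
  proof (induction A rule: infinite_finite_induct)
    case (insert a A)
    then have "f a \<in> carrier G" "f \<in> A \<rightarrow> carrier G"
      by auto
    with insert show ?case
      using hom_mult[OF assms(1), of "f a" "finprod G f A"] hom_in_carrier[OF assms(1)]
      by (simp add: Pi_iff)
  qed (simp_all add: one)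
qed

lemma (in comm_group) pow_hom: "(\<lambda>x. x [^] (c::int)) \<in> hom G G"
  by (auto simp: hom_def int_pow_distrib)

lemma hom_pow:
  assumes "h \<in> hom G H" "comm_group H"
  shows "(\<lambda>x. h x [^]\<^bsub>H\<^esub> (c::int)) \<in> hom G H"
  using hom_compose[OF assms(1) comm_group.pow_hom[OF assms(2)]] by (simp add: o_def)

lemma hom_inv:
  assumes "h \<in> hom G H" "comm_group H"
  shows "(\<lambda>x. inv\<^bsub>H\<^esub> h x) \<in> hom G H"
proof -
  interpret H: comm_group H by fact
  show ?thesis
    using assms(1) by (auto simp: hom_def Pi_iff H.inv_mult)
qed

lemma hom_mult_hom:
  assumes "h \<in> hom G H" "h' \<in> hom G H" "comm_group H"
  shows "(\<lambda>x. h x \<otimes>\<^bsub>H\<^esub> h' x) \<in> hom G H"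
proof -
  interpret H: comm_group H by fact
  show ?thesis
    using assms(1,2) by (auto simp: hom_def Pi_iff H.m_ac)
qed

lemma hom_finprod_hom:
  assumes "\<And>i. i \<in> A \<Longrightarrow> h i \<in> hom G H" "comm_group H"
  shows "(\<lambda>x. finprod H (\<lambda>i. h i x) A) \<in> hom G H"
proof -
  interpret H: comm_group H by fact
  have "finprod H (\<lambda>i. h i (x \<otimes>\<^bsub>G\<^esub> y)) A = finprod H (\<lambda>i. h i x) A \<otimes>\<^bsub>H\<^esub> finprod H (\<lambda>i. h i y) A"
    if "x \<in> carrier G" "y \<in> carrier G" for x y
  proof -
    have *: "(\<lambda>i. h i x) \<in> A \<rightarrow> carrier H" "(\<lambda>i. h i y) \<in> A \<rightarrow> carrier H"
      using assms(1) that by (auto intro: hom_in_carrier)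
    have "finprod H (\<lambda>i. h i (x \<otimes>\<^bsub>G\<^esub> y)) A = finprod H (\<lambda>i. h i x \<otimes>\<^bsub>H\<^esub> h i y) A"
      using * assms(1) that by (intro H.finprod_cong') (auto simp: hom_mult Pi_iff)
    then show ?thesis
      using H.finprod_multf[OF *] by simp
  qed
  then show ?thesis
    using assms(1) by (auto simp: hom_def Pi_iff intro!: H.finprod_closed)
qed

lemma comm_imp_group: "comm_group G \<Longrightarrow> group G"
  by (simp add: comm_group_def)

lemma (in comm_group) finprod_pow:
  assumes "f \<in> A \<rightarrow> carrier G"
  shows "finprod G f A [^] (c::int) = finprod G (\<lambda>x. f x [^] c) A"
proof -
  have "comm_group G"
    by unfold_locales
  with assms show ?thesis
    using hom_finprod[OF pow_hom] by blast
qed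

text \<open>The induction step of the coHochschild differential in algebraic form: the inner
  differential, already carrying an overall sign \<open>c\<close>, absorbs the terms of the
  outermost direction, which carry the same sign.\<close>

lemma (in comm_group) mult_inv_pow:
  assumes "x \<in> carrier G" "y \<in> carrier G" "z \<in> carrier G"
  shows "((x \<otimes> inv y) [^] (c::int)) \<otimes> inv (z [^] c) = (x \<otimes> inv (y \<otimes> z)) [^] c"
  using assms by (simp add: int_pow_distrib int_pow_inv inv_mult m_assoc)

text \<open>The point \<open>a\<close> may be missing from \<open>A\<close> as long as its value is
  the unit. Index sets below are often cut out by a condition \<open>\<noteq> \<one>\<close>, which
  can discard even the distinguished term when it happens to vanish.\<close>

lemma (in comm_monoid) finprod_single:
  assumes "finite A" "f a \<in> carrier G" "\<And>x. x \<in> A \<Longrightarrow> x \<noteq> a \<Longrightarrow> f x = \<one>" "a \<notin> A \<Longrightarrow> f a = \<one>"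
  shows "finprod G f A = f a"
proof (cases "a \<in> A")
  case True
  have "finprod G f A = finprod G f {a}"
    using assms True by (intro finprod_mono_neutral_cong_right) (auto, metis one_closed)
  also have "\<dots> = f a"
    using assms(2) by (simp add: finprod_insert)
  finally show ?thesis .
next
  case False
  then show ?thesis
    using assms by (metis finprod_one_eqI)
qed

lemma comm_group_sum_group:
  assumes "\<And>i. i \<in> I \<Longrightarrow> comm_group (G i)"
  shows "comm_group (sum_group I G)"
proof -
  have gr: "\<And>i. i \<in> I \<Longrightarrow> group (G i)"
    using assms by (simp add: comm_group_def)
  show ?thesis
  proof (rule group.group_comm_groupI)
    show "group (sum_group I G)"
      using gr by simp
    fix x y assume "x \<in> carrier (sum_group I G)" "y \<in> carrier (sum_group I G)"
    then show "x \<otimes>\<^bsub>sum_group I G\<^esub> y = y \<otimes>\<^bsub>sum_group I G\<^esub> x"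
      using assms gr
      by (auto simp: carrier_sum_group PiE_iff comm_group_def comm_monoid.m_comm intro!: restrict_ext)
  qed
qed

lemma comm_group_product_group:
  assumes "\<And>i. i \<in> I \<Longrightarrow> comm_group (G i)"
  shows "comm_group (product_group I G)"
proof -
  have gr: "\<And>i. i \<in> I \<Longrightarrow> group (G i)"
    using assms by (simp add: comm_group_def)
  show ?thesis
  proof (rule group.group_comm_groupI)
    show "group (product_group I G)"
      using gr by simp
    fix x y assume "x \<in> carrier (product_group I G)" "y \<in> carrier (product_group I G)"
    then show "x \<otimes>\<^bsub>product_group I G\<^esub> y = y \<otimes>\<^bsub>product_group I G\<^esub> x"
      using assms
      by (auto simp: PiE_iff comm_group_def comm_monoid.m_comm intro!: restrict_ext)
  qed
qed

lemma carrier_fam_group: "carrier (fam_group G) = Fam ` carrier G"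
  and mult_fam_group: "x \<otimes>\<^bsub>fam_group G\<^esub> y = Fam (unfam x \<otimes>\<^bsub>G\<^esub> unfam y)"
  and one_fam_group: "\<one>\<^bsub>fam_group G\<^esub> = Fam \<one>\<^bsub>G\<^esub>"
  by (simp_all add: fam_group_def)

lemma comm_group_fam_group:
  assumes "comm_group G"
  shows "comm_group (fam_group G)"
proof -
  interpret G: comm_group G by fact
  show ?thesis
  proof (rule comm_groupI)
    fix x assume "x \<in> carrier (fam_group G)"
    then obtain y where y: "x = Fam y" "y \<in> carrier G"
      by (auto simp: carrier_fam_group)
    then show "\<exists>y\<in>carrier (fam_group G). y \<otimes>\<^bsub>fam_group G\<^esub> x = \<one>\<^bsub>fam_group G\<^esub>"
      by (intro bexI[of _ "Fam (inv\<^bsub>G\<^esub> y)"]) (auto simp: carrier_fam_group mult_fam_group one_fam_group)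
  qed (auto simp: carrier_fam_group mult_fam_group one_fam_group G.m_ac)
qed


section \<open>Sequences of elements\<close>

abbreviation fam_sum :: "(nat \<Rightarrow> 'a univ monoid) \<Rightarrow> 'a univ monoid"
  where "fam_sum G \<equiv> fam_group (sum_group {1..} G)"

abbreviation fam_prod :: "(nat \<Rightarrow> 'a univ monoid) \<Rightarrow> 'a univ monoid"
  where "fam_prod G \<equiv> fam_group (product_group {1..} G)"

lemma fam_prod_eqI:
  assumes "x \<in> carrier (fam_prod G)" "y \<in> carrier (fam_prod G)"
    "\<And>n. 1 \<le> n \<Longrightarrow> unfam x n = unfam y n"
  shows "x = y"
proof -
  obtain u v where uv: "x = Fam u" "y = Fam v"
      "u \<in> (\<Pi>\<^sub>E n\<in>{1..}. carrier (G n))" "v \<in> (\<Pi>\<^sub>E n\<in>{1..}. carrier (G n))"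
    using assms(1,2) by (auto simp: carrier_fam_group)
  have "u = v"
    by (rule PiE_ext[OF uv(3,4)]) (use assms(3) uv in simp)
  with uv show ?thesis
    by simp
qed

lemma unfam_fam_prod: "x \<in> carrier (fam_prod G) \<Longrightarrow> 1 \<le> n \<Longrightarrow> unfam x n \<in> carrier (G n)"
  by (auto simp: carrier_fam_group)

lemma fam_prod_memI: "(\<And>n. 1 \<le> n \<Longrightarrow> y n \<in> carrier (G n)) \<Longrightarrow> Fam (\<lambda>n\<in>{1..}. y n) \<in> carrier (fam_prod G)"
  by (auto simp: carrier_fam_group)

lemma fam_prod_homI:
  assumes "\<And>n. 1 \<le> n \<Longrightarrow> (\<lambda>x. h x n) \<in> hom H (G n)"
  shows "(\<lambda>x. Fam (\<lambda>n\<in>{1..}. h x n)) \<in> hom H (fam_prod G)"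
  using assms by (auto simp: hom_def carrier_fam_group mult_fam_group Pi_iff intro!: restrict_ext)

lemma comm_group_fam_prod: "(\<And>n. 1 \<le> n \<Longrightarrow> comm_group (G n)) \<Longrightarrow> comm_group (fam_prod G)"
  by (intro comm_group_fam_group comm_group_product_group) simp

lemma unfam_prod_hom: "1 \<le> n \<Longrightarrow> (\<lambda>x. unfam x n) \<in> hom (fam_prod G) (G n)"
  by (auto simp: hom_def carrier_fam_group mult_fam_group)

context
  fixes G :: "nat \<Rightarrow> 'a univ monoid"
  assumes G: "\<And>n. 1 \<le> n \<Longrightarrow> comm_group (G n)"
begin

lemma carrier_fam_sum:
  "carrier (fam_sum G) = {x \<in> carrier (fam_prod G). finite {n. 1 \<le> n \<and> unfam x n \<noteq> \<one>\<^bsub>G n\<^esub>}}"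
proof -
  have gr: "\<And>i. i \<in> {1..} \<Longrightarrow> group (G i)"
    using G by (simp add: comm_group_def)
  show ?thesis
    unfolding carrier_fam_group carrier_product_group
    by (subst carrier_sum_group[OF gr]) auto
qed

lemma fam_sum_eqI:
  assumes "x \<in> carrier (fam_sum G)" "y \<in> carrier (fam_sum G)"
    "\<And>n. 1 \<le> n \<Longrightarrow> unfam x n = unfam y n"
  shows "x = y"
  using assms carrier_fam_sum by (blast intro: fam_prod_eqI)

lemma unfam_fam_sum: "x \<in> carrier (fam_sum G) \<Longrightarrow> 1 \<le> n \<Longrightarrow> unfam x n \<in> carrier (G n)"
  using carrier_fam_sum by (blast intro: unfam_fam_prod)

lemma fam_sum_finite: "x \<in> carrier (fam_sum G) \<Longrightarrow> finite {n. 1 \<le> n \<and> unfam x n \<noteq> \<one>\<^bsub>G n\<^esub>}"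
  using carrier_fam_sum by blast

lemma fam_sum_memI:
  assumes "\<And>n. 1 \<le> n \<Longrightarrow> y n \<in> carrier (G n)" "finite {n. 1 \<le> n \<and> y n \<noteq> \<one>\<^bsub>G n\<^esub>}"
  shows "Fam (\<lambda>n\<in>{1..}. y n) \<in> carrier (fam_sum G)"
proof -
  have "{n. 1 \<le> n \<and> unfam (Fam (\<lambda>n\<in>{1..}. y n)) n \<noteq> \<one>\<^bsub>G n\<^esub>} = {n. 1 \<le> n \<and> y n \<noteq> \<one>\<^bsub>G n\<^esub>}"
    by auto
  with assms fam_prod_memI[of y G] show ?thesis
    unfolding carrier_fam_sum by simp
qed

lemma comm_group_fam_sum: "comm_group (fam_sum G)"
  using G by (intro comm_group_fam_group comm_group_sum_group) simp

lemma unfam_sum_hom: "1 \<le> n \<Longrightarrow> (\<lambda>x. unfam x n) \<in> hom (fam_sum G) (G n)"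
  using unfam_fam_sum by (auto simp: hom_def mult_fam_group)

lemma fam_sum_homI:
  assumes "\<And>n. 1 \<le> n \<Longrightarrow> (\<lambda>x. h x n) \<in> hom H (G n)"
    and "\<And>x. x \<in> carrier H \<Longrightarrow> finite {n. 1 \<le> n \<and> h x n \<noteq> \<one>\<^bsub>G n\<^esub>}"
  shows "(\<lambda>x. Fam (\<lambda>n\<in>{1..}. h x n)) \<in> hom H (fam_sum G)"
proof (rule homI)
  show "Fam (\<lambda>n\<in>{1..}. h x n) \<in> carrier (fam_sum G)" if "x \<in> carrier H" for x
    using hom_in_carrier[OF assms(1) that] assms(2)[OF that] by (intro fam_sum_memI) auto
  show "Fam (\<lambda>n\<in>{1..}. h (x \<otimes>\<^bsub>H\<^esub> y) n) =
      Fam (\<lambda>n\<in>{1..}. h x n) \<otimes>\<^bsub>fam_sum G\<^esub> Fam (\<lambda>n\<in>{1..}. h y n)"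
    if "x \<in> carrier H" "y \<in> carrier H" for x y
    using hom_mult[OF assms(1)] that by (auto simp: mult_fam_group intro!: restrict_ext)
qed

end

text \<open>A homomorphism preserves units, so applying one in each component cannot enlarge the
  support.\<close>

lemma fam_sum_map_hom:
  assumes "\<And>n. 1 \<le> n \<Longrightarrow> comm_group (G n)" "\<And>n. 1 \<le> n \<Longrightarrow> comm_group (H n)"
    and h: "\<And>n. 1 \<le> n \<Longrightarrow> h n \<in> hom (G n) (H n)"
  shows "(\<lambda>x. Fam (\<lambda>n\<in>{1..}. h n (unfam x n))) \<in> hom (fam_sum G) (fam_sum H)"
proof (rule fam_sum_homI)
  show "comm_group (H n)" if "1 \<le> n" for n
    using assms(2)[OF that] .
  show "(\<lambda>x. h n (unfam x n)) \<in> hom (fam_sum G) (H n)" if "1 \<le> n" for n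
    using hom_compose[OF unfam_sum_hom[where G = G, OF assms(1) that] h[OF that]] by (simp add: o_def)
  fix x assume x: "x \<in> carrier (fam_sum G)"
  have "h n \<one>\<^bsub>G n\<^esub> = \<one>\<^bsub>H n\<^esub>" if "1 \<le> n" for n
    using hom_one[OF h[OF that]] assms(1,2)[OF that] by (simp add: comm_group_def)
  then have "{n. 1 \<le> n \<and> h n (unfam x n) \<noteq> \<one>\<^bsub>H n\<^esub>} \<subseteq> {n. 1 \<le> n \<and> unfam x n \<noteq> \<one>\<^bsub>G n\<^esub>}"
    by auto
  then show "finite {n. 1 \<le> n \<and> h n (unfam x n) \<noteq> \<one>\<^bsub>H n\<^esub>}"
    using fam_sum_finite[where G = G, OF assms(1) x] by (rule finite_subset)
qed

text \<open>The shape of the Hochschild differential: besides its own component, each index receives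
  contributions from larger ones only. The summation range depends on \<open>x\<close>, so
  additivity is not termwise; for \<open>x\<close>, \<open>y\<close> and their product the ranges
  are enlarged to a common finite set, on which the new terms are units.\<close>

lemma fam_sum_triangular_hom:
  assumes G: "\<And>n. 1 \<le> n \<Longrightarrow> comm_group (G n)" and H: "\<And>n. 1 \<le> n \<Longrightarrow> comm_group (H n)"
    and d: "\<And>n. 1 \<le> n \<Longrightarrow> d n \<in> hom (G n) (H n)"
    and h: "\<And>n k. 1 \<le> k \<Longrightarrow> k < n \<Longrightarrow> h n k \<in> hom (G n) (H k)"
  shows "(\<lambda>x. Fam (\<lambda>k\<in>{1..}. d k (unfam x k) \<otimes>\<^bsub>H k\<^esub>
      finprod (H k) (\<lambda>n. h n k (unfam x n)) {n. k < n \<and> unfam x n \<noteq> \<one>\<^bsub>G n\<^esub>}))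
    \<in> hom (fam_sum G) (fam_sum H)"
proof (rule fam_sum_homI)
  show "comm_group (H n)" if "1 \<le> n" for n
    using H[OF that] .
next
  have h1: "h n k \<one>\<^bsub>G n\<^esub> = \<one>\<^bsub>H k\<^esub>" if "1 \<le> k" "k < n" for n k
    using hom_one[OF h[OF that]] that G[of n] H[of k] by (simp add: comm_group_def)
  have fin: "finite {n. k < n \<and> unfam x n \<noteq> \<one>\<^bsub>G n\<^esub>}" if "x \<in> carrier (fam_sum G)" for x k
    by (rule finite_subset[OF _ fam_sum_finite[where G = G, OF G that]]) auto
  have cl: "h n k (unfam x n) \<in> carrier (H k)"
    if "x \<in> carrier (fam_sum G)" "1 \<le> k" "k < n" for x n k
    using hom_in_carrier[OF h[OF that(2,3)]] unfam_fam_sum[where G = G, OF G that(1), of n] that by simp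
  fix k :: nat assume k: "1 \<le> k"
  interpret H: comm_group "H k" by (rule H[OF k])
  have extend: "finprod (H k) (\<lambda>n. h n k (unfam x n)) {n. k < n \<and> unfam x n \<noteq> \<one>\<^bsub>G n\<^esub>} =
      finprod (H k) (\<lambda>n. h n k (unfam x n)) S"
    if "x \<in> carrier (fam_sum G)" "finite S" "{n. k < n \<and> unfam x n \<noteq> \<one>\<^bsub>G n\<^esub>} \<subseteq> S" "S \<subseteq> {k<..}" for x S
  proof (rule H.finprod_mono_neutral_cong_left[OF that(2,3)])
    show "h n k (unfam x n) = \<one>\<^bsub>H k\<^esub>" if "n \<in> S - {n. k < n \<and> unfam x n \<noteq> \<one>\<^bsub>G n\<^esub>}" for n
      using that \<open>S \<subseteq> {k<..}\<close> h1[OF k, of n] by auto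
    show "(\<lambda>n. h n k (unfam x n)) \<in> S \<rightarrow> carrier (H k)"
      using cl[OF that(1) k] that(4) by blast
  qed simp
  have "(\<lambda>x. finprod (H k) (\<lambda>n. h n k (unfam x n)) {n. k < n \<and> unfam x n \<noteq> \<one>\<^bsub>G n\<^esub>}) \<in> hom (fam_sum G) (H k)"
  proof (rule homI)
    fix x assume x: "x \<in> carrier (fam_sum G)"
    show "finprod (H k) (\<lambda>n. h n k (unfam x n)) {n. k < n \<and> unfam x n \<noteq> \<one>\<^bsub>G n\<^esub>} \<in> carrier (H k)"
      by (intro H.finprod_closed Pi_I cl[OF x k]) simp
  next
    fix x y assume x: "x \<in> carrier (fam_sum G)" and y: "y \<in> carrier (fam_sum G)"
    let ?xy = "x \<otimes>\<^bsub>fam_sum G\<^esub> y"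
    have xy: "?xy \<in> carrier (fam_sum G)"
      using x y comm_group_fam_sum[where G = G, OF G] by (simp add: comm_group_def group_def monoid.m_closed)
    define S where "S = {n. k < n \<and> unfam x n \<noteq> \<one>\<^bsub>G n\<^esub>} \<union> {n. k < n \<and> unfam y n \<noteq> \<one>\<^bsub>G n\<^esub>}
      \<union> {n. k < n \<and> unfam ?xy n \<noteq> \<one>\<^bsub>G n\<^esub>}"
    have S: "finite S" "S \<subseteq> {k<..}"
      using fin[OF x] fin[OF y] fin[OF xy] by (auto simp: S_def)
    have Sx: "(\<lambda>n. h n k (unfam x n)) \<in> S \<rightarrow> carrier (H k)" and Sy: "(\<lambda>n. h n k (unfam y n)) \<in> S \<rightarrow> carrier (H k)"
      using cl[OF x k] cl[OF y k] S(2) by blast+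
    have "h n k (unfam ?xy n) = h n k (unfam x n) \<otimes>\<^bsub>H k\<^esub> h n k (unfam y n)" if "n \<in> S" for n
    proof -
      have n: "k < n" "1 \<le> n"
        using that S k by auto
      then show ?thesis
        using hom_mult[OF h[OF k n(1)] unfam_fam_sum[where G = G, OF G x n(2)] unfam_fam_sum[where G = G, OF G y n(2)]]
        by (simp add: mult_fam_group)
    qed
    then have "finprod (H k) (\<lambda>n. h n k (unfam ?xy n)) S =
        finprod (H k) (\<lambda>n. h n k (unfam x n) \<otimes>\<^bsub>H k\<^esub> h n k (unfam y n)) S"
      using Sx Sy by (intro H.finprod_cong') auto
    also have "\<dots> = finprod (H k) (\<lambda>n. h n k (unfam x n)) S \<otimes>\<^bsub>H k\<^esub> finprod (H k) (\<lambda>n. h n k (unfam y n)) S"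
      by (rule H.finprod_multf[OF Sx Sy])
    finally show "finprod (H k) (\<lambda>n. h n k (unfam ?xy n)) {n. k < n \<and> unfam ?xy n \<noteq> \<one>\<^bsub>G n\<^esub>} =
        finprod (H k) (\<lambda>n. h n k (unfam x n)) {n. k < n \<and> unfam x n \<noteq> \<one>\<^bsub>G n\<^esub>} \<otimes>\<^bsub>H k\<^esub>
        finprod (H k) (\<lambda>n. h n k (unfam y n)) {n. k < n \<and> unfam y n \<noteq> \<one>\<^bsub>G n\<^esub>}"
      using extend[OF x S(1)] extend[OF y S(1)] extend[OF xy S(1)] S(2) by (simp add: S_def Un_assoc subset_iff)
  qed
  moreover have "(\<lambda>x. d k (unfam x k)) \<in> hom (fam_sum G) (H k)"
    using hom_compose[OF unfam_sum_hom[where G = G, OF G k] d[OF k]] by (simp add: o_def)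
  ultimately show "(\<lambda>x. d k (unfam x k) \<otimes>\<^bsub>H k\<^esub>
      finprod (H k) (\<lambda>n. h n k (unfam x n)) {n. k < n \<and> unfam x n \<noteq> \<one>\<^bsub>G n\<^esub>}) \<in> hom (fam_sum G) (H k)"
    using H[OF k] by (intro hom_mult_hom)
next
  have d1: "d k \<one>\<^bsub>G k\<^esub> = \<one>\<^bsub>H k\<^esub>" if "1 \<le> k" for k
    using hom_one[OF d[OF that]] that G[of k] H[of k] by (simp add: comm_group_def)
  fix x assume x: "x \<in> carrier (fam_sum G)"
  let ?S = "{n. 1 \<le> n \<and> unfam x n \<noteq> \<one>\<^bsub>G n\<^esub>}"
  \<comment> \<open>Triangularity gives finiteness: a nontrivial value at \<open>k\<close> needs
    some index \<open>n \<ge> k\<close> in the support of \<open>x\<close>.\<close>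
  have "{k. 1 \<le> k \<and> d k (unfam x k) \<otimes>\<^bsub>H k\<^esub>
      finprod (H k) (\<lambda>n. h n k (unfam x n)) {n. k < n \<and> unfam x n \<noteq> \<one>\<^bsub>G n\<^esub>} \<noteq> \<one>\<^bsub>H k\<^esub>} \<subseteq> (\<Union>n\<in>?S. {..n})"
  proof clarify
    fix k :: nat assume k: "1 \<le> k" and ne: "d k (unfam x k) \<otimes>\<^bsub>H k\<^esub>
      finprod (H k) (\<lambda>n. h n k (unfam x n)) {n. k < n \<and> unfam x n \<noteq> \<one>\<^bsub>G n\<^esub>} \<noteq> \<one>\<^bsub>H k\<^esub>"
    interpret H: comm_group "H k" by (rule H[OF k])
    have "\<exists>n\<in>?S. k \<le> n"
    proof (rule ccontr)
      assume *: "\<not> (\<exists>n\<in>?S. k \<le> n)"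
      have none: "unfam x n = \<one>\<^bsub>G n\<^esub>" if "k \<le> n" for n
      proof (rule ccontr)
        assume "unfam x n \<noteq> \<one>\<^bsub>G n\<^esub>"
        then have "n \<in> ?S"
          using that k by simp
        with * that show False
          by blast
      qed
      have "unfam x k = \<one>\<^bsub>G k\<^esub>" "{n. k < n \<and> unfam x n \<noteq> \<one>\<^bsub>G n\<^esub>} = {}"
        using none by auto
      with ne show False
        using d1[OF k] by simp
    qed
    then show "k \<in> (\<Union>n\<in>?S. {..n})"
      by auto
  qed
  then show "finite {k. 1 \<le> k \<and> d k (unfam x k) \<otimes>\<^bsub>H k\<^esub>
      finprod (H k) (\<lambda>n. h n k (unfam x n)) {n. k < n \<and> unfam x n \<noteq> \<one>\<^bsub>G n\<^esub>} \<noteq> \<one>\<^bsub>H k\<^esub>}"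
    by (rule finite_subset) (intro finite_UN_I fam_sum_finite[where G = G, OF G x] finite_atMost)
qed


section \<open>Graded modules over the prop\<close>

text \<open>The degree of the tensor product of the generators \<open>l_k\<close>, each of degree k
  - 1.\<close>

definition lsum :: "nat list \<Rightarrow> int"
  where "lsum ks = (\<Sum>k\<leftarrow>ks. int k - 1)"

lemma lsum_simps [simp]: "lsum [] = 0" "lsum (ks @ [n]) = lsum ks + (int n - 1)"
  by (simp_all add: lsum_def)

lemma l_degree_eq: "l_degree t ks = lsum (take t ks)"
  by (simp add: l_degree_def lsum_def)

lemma lsum_eq: "lsum ks = int (sum_list ks) - int (length ks)"
  by (induction ks) (auto simp: lsum_def)

text \<open>Sum minus length is the degree of a string of generators, so the shift k - j + n1 - n2
  is the difference of the degrees of the two strings. The sign cancellations use the degree in this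
  form.\<close>

lemma op_degree_eq: "op_degree js ks p = p + lsum js - lsum ks"
  by (simp add: op_degree_def lsum_eq)

lemma sum_list_update_nth:
  "t < length ks \<Longrightarrow> sum_list (ks[t := k]) = sum_list (take t ks) + k + sum_list (drop (Suc t) ks)"
  for ks :: "nat list"
  by (simp add: upd_conv_take_nth_drop)

lemma sum_list_split_nth:
  "t < length ks \<Longrightarrow> sum_list ks = sum_list (take t ks) + ks ! t + sum_list (drop (Suc t) ks)"
  for ks :: "nat list"
  using sum_list_update_nth[of t ks "ks ! t"] by simp

lemma lsum_update_nth: "t < length ks \<Longrightarrow> lsum (ks[t := k]) = lsum ks + int k - int (ks ! t)"
  using sum_list_update_nth[of t ks k] sum_list_split_nth[of t ks] by (simp add: lsum_eq)

lemma indices_0: "indices 0 = {[]}"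
  by (auto simp: indices_def)

text \<open>A further iteration of a construction adds its index at the end of the list, so
  inductions on the number of iterations peel off the last entry.\<close>

lemma indices_Suc: "indices (Suc n) = {ks @ [k] | ks k. ks \<in> indices n \<and> 1 \<le> k}"
proof -
  have "js \<in> {ks @ [k] | ks k. ks \<in> indices n \<and> 1 \<le> k}" if "js \<in> indices (Suc n)" for js
    using that by (cases js rule: rev_cases) (auto simp: indices_def)
  then show ?thesis
    by (auto simp: indices_def)
qed

lemma indices_SucE:
  assumes "js \<in> indices (Suc n)"
  obtains ks k where "js = ks @ [k]" "ks \<in> indices n" "1 \<le> k"
  using assms by (auto simp: indices_Suc)

lemma indices_snoc: "ks @ [k] \<in> indices (Suc n) \<longleftrightarrow> ks \<in> indices n \<and> 1 \<le> k"
  by (auto simp: indices_Suc)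

lemma indices_length: "ks \<in> indices n \<Longrightarrow> length ks = n"
  by (simp add: indices_def)

lemma indices_nth: "ks \<in> indices n \<Longrightarrow> t < n \<Longrightarrow> 1 \<le> ks ! t"
  by (auto simp: indices_def)

lemma indices_update: "ks \<in> indices n \<Longrightarrow> 1 \<le> k \<Longrightarrow> ks[t := k] \<in> indices n"
  using set_update_subset_insert[of ks t k] by (auto simp: indices_def)

text \<open>If the positions differed, the entry at \<open>t\<close> would be \<open>j\<close> on
  the left and the larger \<open>js ! t\<close> on the right. Hence distinct terms in the
  differential of a generator have distinct indices.\<close>

lemma list_update_lower_inj:
  fixes js :: "nat list"
  assumes "js[t := j] = js[t' := j']" "t < length js" "t' < length js" "j < js ! t" "j' < js ! t'"
  shows "t = t' \<and> j = j'"
proof -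
  have "t = t'"
    using arg_cong[OF assms(1), of "\<lambda>xs. xs ! t"] assms(2-) by (cases "t = t'") auto
  then show ?thesis
    using arg_cong[OF assms(1), of "\<lambda>xs. xs ! t"] assms(2) by simp
qed

text \<open>
  Only degreewise linearity is recorded: it suffices for computing with coordinates and is
  inherited by the iterated constructions without any computation.
\<close>

definition graded_covariant :: "'a uprop \<Rightarrow> 'a ufun \<Rightarrow> bool"
  where "graded_covariant E \<Phi> \<longleftrightarrow>
    (\<forall>m p. comm_group (grp (Obj \<Phi> m) p)) \<and>
    (\<forall>m p. dif (Obj \<Phi> m) p \<in> hom (grp (Obj \<Phi> m) p) (grp (Obj \<Phi> m) (p - 1))) \<and>
    (\<forall>a b r p. \<forall>f\<in>carrier (grp (Hom E a b) r).
       Act \<Phi> a b r f p \<in> hom (grp (Obj \<Phi> a) p) (grp (Obj \<Phi> b) (p + r)))"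

definition graded_contravariant :: "'a uprop \<Rightarrow> 'a ufun \<Rightarrow> bool"
  where "graded_contravariant E \<Psi> \<longleftrightarrow>
    (\<forall>m p. comm_group (grp (Obj \<Psi> m) p)) \<and>
    (\<forall>m p. dif (Obj \<Psi> m) p \<in> hom (grp (Obj \<Psi> m) p) (grp (Obj \<Psi> m) (p - 1))) \<and>
    (\<forall>a b r p. \<forall>f\<in>carrier (grp (Hom E a b) r).
       Act \<Psi> a b r f p \<in> hom (grp (Obj \<Psi> b) p) (grp (Obj \<Psi> a) (p + r)))"

lemma covariantD:
  assumes "graded_covariant E \<Phi>"
  shows "comm_group (grp (Obj \<Phi> m) p)"
    and "q = p - 1 \<Longrightarrow> dif (Obj \<Phi> m) p \<in> hom (grp (Obj \<Phi> m) p) (grp (Obj \<Phi> m) q)"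
    and "f \<in> carrier (grp (Hom E a b) r) \<Longrightarrow> q = p + r \<Longrightarrow>
      Act \<Phi> a b r f p \<in> hom (grp (Obj \<Phi> a) p) (grp (Obj \<Phi> b) q)"
  using assms by (auto simp: graded_covariant_def)

lemma contravariantD:
  assumes "graded_contravariant E \<Psi>"
  shows "comm_group (grp (Obj \<Psi> m) p)"
    and "q = p - 1 \<Longrightarrow> dif (Obj \<Psi> m) p \<in> hom (grp (Obj \<Psi> m) p) (grp (Obj \<Psi> m) q)"
    and "f \<in> carrier (grp (Hom E a b) r) \<Longrightarrow> q = p + r \<Longrightarrow>
      Act \<Psi> a b r f p \<in> hom (grp (Obj \<Psi> b) p) (grp (Obj \<Psi> a) q)"
  using assms by (auto simp: graded_contravariant_def)

lemma chain_pairingD: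
  assumes "chain_pairing U V W b"
  shows "x \<in> carrier (grp U p) \<Longrightarrow> (\<lambda>y. b p q x y) \<in> hom (grp V q) (grp W (p + q))"
    and "y \<in> carrier (grp V q) \<Longrightarrow> (\<lambda>x. b p q x y) \<in> hom (grp U p) (grp W (p + q))"
    and "x \<in> carrier (grp U p) \<Longrightarrow> y \<in> carrier (grp V q) \<Longrightarrow> b p q x y \<in> carrier (grp W (p + q))"
  using assms by (auto simp: chain_pairing_def intro: hom_in_carrier[of "b p q x" "grp V q"])

definition coord :: "'a univ \<Rightarrow> nat list \<Rightarrow> 'a univ"
  where "coord x ks = foldl unfam x (rev ks)"

lemma coord_simps [simp]: "coord x [] = x" "coord x (ks @ [k]) = coord (unfam x k) ks"
  by (simp_all add: coord_def)

text \<open>Degreewise linearity, apart from naturality, is what the coordinate formula for the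
  iterated map requires. It also covers transformations given by formulas that are not restricted to
  carriers.\<close>

definition graded_map ::
  "'a ufun \<Rightarrow> 'a ufun \<Rightarrow> int \<Rightarrow> (nat \<Rightarrow> int \<Rightarrow> 'a univ \<Rightarrow> 'a univ) \<Rightarrow> bool"
  where "graded_map \<Phi> \<Psi> r \<alpha> \<longleftrightarrow> (\<forall>m q. \<alpha> m q \<in> hom (grp (Obj \<Phi> m) q) (grp (Obj \<Psi> m) (q + r)))"

lemma graded_mapD: "graded_map \<Phi> \<Psi> r \<alpha> \<Longrightarrow> s = q + r \<Longrightarrow> \<alpha> m q \<in> hom (grp (Obj \<Phi> m) q) (grp (Obj \<Psi> m) s)"
  by (simp add: graded_map_def)

locale A_infinity_prop = dg_prop E + dg_prop_functor A_infinity E i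
  for E :: "'a uprop" and i :: "'a mult_map"
begin

lemma comm_group_Hom: "comm_group (grp (Hom E a b) p)"
  using Hom_complex Ob_UNIV by (simp add: chain_complex_def)

lemma group_Hom: "group (grp (Hom E a b) p)"
  using comm_group_Hom by (simp add: comm_group_def)

lemmas Cmp_pairing = Cmp_chain[unfolded Ob_UNIV, OF UNIV_I UNIV_I UNIV_I]

lemma Idm_in: "Idm E a \<in> carrier (grp (Hom E a a) 0)"
  using Idm_closed Ob_UNIV by simp

lemma Cmp_closed:
  assumes "f \<in> carrier (grp (Hom E a b) p)" "g \<in> carrier (grp (Hom E b c) q)" "r = p + q"
  shows "Cmp E a b c p q f g \<in> carrier (grp (Hom E a c) r)"
  using chain_pairingD(3)[OF Cmp_pairing assms(1,2)] assms(3) by simp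

lemma Cmp_hom1:
  "f \<in> carrier (grp (Hom E a b) p) \<Longrightarrow> r = p + q \<Longrightarrow>
    Cmp E a b c p q f \<in> hom (grp (Hom E b c) q) (grp (Hom E a c) r)"
  using chain_pairingD(1)[OF Cmp_pairing] by simp

lemma Cmp_hom2:
  "g \<in> carrier (grp (Hom E b c) q) \<Longrightarrow> r = p + q \<Longrightarrow>
    (\<lambda>f. Cmp E a b c p q f g) \<in> hom (grp (Hom E a b) p) (grp (Hom E a c) r)"
  using chain_pairingD(2)[OF Cmp_pairing] by simp

lemma Ten_closed:
  assumes "f \<in> carrier (grp (Hom E n m) p)" "g \<in> carrier (grp (Hom E n' m') q)" "r = p + q"
  shows "Ten E n m n' m' p q f g \<in> carrier (grp (Hom E (n + n') (m + m')) r)"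
  using chain_pairingD(3)[OF Ten_chain assms(1,2)] assms(3) by simp

lemma f_img_closed:
  assumes "1 \<le> k" "k < n"
  shows "f_img i n k \<in> carrier (grp (Hom E n k) (int n - int k - 1))"
  using hom_in_carrier[OF map_hom f_mor_closed[OF assms]] .

lemma Ten_Idm_closed:
  "f \<in> carrier (grp (Hom E a b) r) \<Longrightarrow> Ten E n n a b 0 r (Idm E n) f \<in> carrier (grp (Hom E (n + a) (n + b)) r)"
  by (intro Ten_closed Idm_in) auto

lemma Ten_f_img_closed:
  assumes "1 \<le> k" "k < n"
  shows "Ten E n k m m (int n - int k - 1) 0 (f_img i n k) (Idm E m)
    \<in> carrier (grp (Hom E (n + m) (k + m)) (int n - int k - 1))"
  using assms by (intro Ten_closed f_img_closed Idm_in) auto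

lemma whisker_closed:
  assumes "1 \<le> k" "k < n"
  shows "whisker E i a n k b \<in> carrier (grp (Hom E (a + n + b) (a + k + b)) (int n - int k - 1))"
  unfolding whisker_def using assms by (intro Ten_closed f_img_closed Idm_in) auto

text \<open>In a Hochschild direction the morphism runs from the list with the larger entry
  \<open>k\<close> down to \<open>ks\<close>; both total sums are split at position \<open>t\<close>
  to match source and target.\<close>

lemma whisker_closed_nth:
  assumes "t < length ks" "1 \<le> ks ! t" "ks ! t < k"
  shows "whisker E i (sum_list (take t ks)) k (ks ! t) (sum_list (drop (Suc t) ks) + m)
    \<in> carrier (grp (Hom E (sum_list (ks[t := k]) + m) (sum_list ks + m)) (int k - int (ks ! t) - 1))"
  using whisker_closed[OF assms(2,3), of "sum_list (take t ks)" "sum_list (drop (Suc t) ks) + m"]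
  by (simp add: sum_list_update_nth[OF assms(1)] sum_list_split_nth[OF assms(1)] add.assoc)

text \<open>Each iteration tensors a morphism with one more identity on the left. Strict
  associativity fuses these into the identity of the sum of the indices.\<close>

lemma Ten_Idm_Ten_Idm:
  assumes "f \<in> carrier (grp (Hom E a b) r)"
  shows "Ten E s s (n + a) (n + b) 0 r (Idm E s) (Ten E n n a b 0 r (Idm E n) f) =
    Ten E (s + n) (s + n) a b 0 r (Idm E (s + n)) f"
  using Ten_assoc[OF Idm_in Idm_in assms, of s n] by (simp add: Ten_Idm)

text \<open>A term of the outermost differential has its \<open>f_img\<close> next to the identity
  of \<open>m\<close>; the inner constructions add an identity on the left, which produces the
  three-part \<open>whisker\<close>.\<close>

lemma Ten_Idm_f_img:
  assumes "1 \<le> k" "k < n"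
  shows "Ten E s s (n + m) (k + m) 0 (int n - int k - 1) (Idm E s)
      (Ten E n k m m (int n - int k - 1) 0 (f_img i n k) (Idm E m)) = whisker E i s n k m"
  unfolding whisker_def using Ten_assoc[OF Idm_in f_img_closed[OF assms] Idm_in, of s m] by simp


section \<open>The Hochschild construction in coordinates\<close>

abbreviation Hoch_grp :: "nat \<Rightarrow> 'a ufun \<Rightarrow> nat \<Rightarrow> int \<Rightarrow> 'a univ monoid"
  where "Hoch_grp n \<Phi> m p \<equiv> grp (Obj ((Hoch E i ^^ n) \<Phi>) m) p"

lemma grp_Hoch: "grp (Obj (Hoch E i \<Phi>) m) p = fam_sum (\<lambda>n. grp (Obj \<Phi> (n + m)) (p - (int n - 1)))"
  by (simp add: Hoch_def)

lemma graded_Hoch: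
  assumes "graded_covariant E \<Phi>"
  shows "graded_covariant E (Hoch E i \<Phi>)"
  unfolding graded_covariant_def
proof (intro conjI allI ballI)
  note \<Phi> = covariantD[OF assms]
  show "comm_group (grp (Obj (Hoch E i \<Phi>) m) p)" for m p
    unfolding grp_Hoch using \<Phi>(1) by (rule comm_group_fam_sum)
  show "dif (Obj (Hoch E i \<Phi>) m) p \<in> hom (grp (Obj (Hoch E i \<Phi>) m) p) (grp (Obj (Hoch E i \<Phi>) m) (p - 1))" for m p
  proof -
    let ?G = "\<lambda>n. grp (Obj \<Phi> (n + m)) (p - (int n - 1))" and ?H = "\<lambda>n. grp (Obj \<Phi> (n + m)) (p - 1 - (int n - 1))"
    have deg: "p - (int n - 1) - 1 = p - 1 - (int n - 1)" for n
      by simp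
    have "(\<lambda>x. Fam (\<lambda>k\<in>{1..}. dif (Obj \<Phi> (k + m)) (p - (int k - 1)) (unfam x k) \<otimes>\<^bsub>?H k\<^esub>
        finprod (?H k) (\<lambda>n. Act \<Phi> (n + m) (k + m) (int n - int k - 1)
                   (Ten E n k m m (int n - int k - 1) 0 (f_img i n k) (Idm E m))
                   (p - (int n - 1)) (unfam x n) [^]\<^bsub>?H k\<^esub> ksign (p - (int n - 1)))
          {n. k < n \<and> unfam x n \<noteq> \<one>\<^bsub>?G n\<^esub>})) \<in> hom (fam_sum ?G) (fam_sum ?H)"
      by (rule fam_sum_triangular_hom) (intro \<Phi> hom_pow Ten_f_img_closed; simp)+
    then show ?thesis
      by (simp add: Hoch_def Let_def deg)
  qed
  fix a b r p f assume f: "f \<in> carrier (grp (Hom E a b) r)"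
  let ?G = "\<lambda>n. grp (Obj \<Phi> (n + a)) (p - (int n - 1))" and ?H = "\<lambda>n. grp (Obj \<Phi> (n + b)) (p + r - (int n - 1))"
  have deg: "p - (int n - 1) + r = p + r - (int n - 1)" for n
    by simp
  have "(\<lambda>x. Fam (\<lambda>n\<in>{1..}. Act \<Phi> (n + a) (n + b) r (Ten E n n a b 0 r (Idm E n) f) (p - (int n - 1)) (unfam x n)
        [^]\<^bsub>?H n\<^esub> ksign (r * (int n - 1)))) \<in> hom (fam_sum ?G) (fam_sum ?H)"
    by (rule fam_sum_map_hom) (intro \<Phi> hom_pow Ten_Idm_closed f; simp)+
  then show "Act (Hoch E i \<Phi>) a b r f p \<in> hom (grp (Obj (Hoch E i \<Phi>) a) p) (grp (Obj (Hoch E i \<Phi>) b) (p + r))"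
    by (simp add: Hoch_def deg)
qed

lemma graded_Hoch_iter: "graded_covariant E \<Phi> \<Longrightarrow> graded_covariant E ((Hoch E i ^^ n) \<Phi>)"
  by (induction n) (simp_all add: graded_Hoch)

abbreviation Hoch_comp :: "'a ufun \<Rightarrow> nat \<Rightarrow> int \<Rightarrow> nat list \<Rightarrow> 'a univ monoid"
  where "Hoch_comp \<Phi> m p ks \<equiv> grp (Obj \<Phi> (sum_list ks + m)) (p - lsum ks)"

context
  fixes \<Phi> :: "'a ufun"
  assumes \<Phi>: "graded_covariant E \<Phi>"
begin

lemmas iterD = covariantD[OF graded_Hoch_iter[OF \<Phi>]]

lemma
  shows iter_unfam_hom: "1 \<le> k \<Longrightarrow> (\<lambda>x. unfam x k) \<in>
      hom (Hoch_grp (Suc n) \<Phi> m p) (Hoch_grp n \<Phi> (k + m) (p - (int k - 1)))"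
    and iter_finite: "x \<in> carrier (Hoch_grp (Suc n) \<Phi> m p) \<Longrightarrow>
      finite {k. 1 \<le> k \<and> unfam x k \<noteq> \<one>\<^bsub>Hoch_grp n \<Phi> (k + m) (p - (int k - 1))\<^esub>}"
    and iter_eqI: "x \<in> carrier (Hoch_grp (Suc n) \<Phi> m p) \<Longrightarrow>
      y \<in> carrier (Hoch_grp (Suc n) \<Phi> m p) \<Longrightarrow>
      (\<And>k. 1 \<le> k \<Longrightarrow> unfam x k = unfam y k) \<Longrightarrow> x = y"
    and iter_memI: "(\<And>k. 1 \<le> k \<Longrightarrow> z k \<in> carrier (Hoch_grp n \<Phi> (k + m) (p - (int k - 1)))) \<Longrightarrow>
      finite {k. 1 \<le> k \<and> z k \<noteq> \<one>\<^bsub>Hoch_grp n \<Phi> (k + m) (p - (int k - 1))\<^esub>} \<Longrightarrow>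
      Fam (\<lambda>k\<in>{1..}. z k) \<in> carrier (Hoch_grp (Suc n) \<Phi> m p)"
proof -
  let ?G = "\<lambda>k. Hoch_grp n \<Phi> (k + m) (p - (int k - 1))"
  have G: "comm_group (?G k)" for k
    by (rule iterD)
  have eq: "Hoch_grp (Suc n) \<Phi> m p = fam_sum ?G"
    by (simp add: grp_Hoch)
  show "1 \<le> k \<Longrightarrow> (\<lambda>x. unfam x k) \<in> hom (Hoch_grp (Suc n) \<Phi> m p) (?G k)"
    unfolding eq using unfam_sum_hom[where G = ?G, OF G] .
  show "x \<in> carrier (Hoch_grp (Suc n) \<Phi> m p) \<Longrightarrow> finite {k. 1 \<le> k \<and> unfam x k \<noteq> \<one>\<^bsub>?G k\<^esub>}"
    unfolding eq using fam_sum_finite[where G = ?G, OF G] .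
  show "x \<in> carrier (Hoch_grp (Suc n) \<Phi> m p) \<Longrightarrow>
      y \<in> carrier (Hoch_grp (Suc n) \<Phi> m p) \<Longrightarrow>
      (\<And>k. 1 \<le> k \<Longrightarrow> unfam x k = unfam y k) \<Longrightarrow> x = y"
    unfolding eq using fam_sum_eqI[where G = ?G, OF G] by blast
  show "(\<And>k. 1 \<le> k \<Longrightarrow> z k \<in> carrier (?G k)) \<Longrightarrow> finite {k. 1 \<le> k \<and> z k \<noteq> \<one>\<^bsub>?G k\<^esub>} \<Longrightarrow>
      Fam (\<lambda>k\<in>{1..}. z k) \<in> carrier (Hoch_grp (Suc n) \<Phi> m p)"
    unfolding eq using fam_sum_memI[where G = ?G, OF G] by blast
qed

lemma coord_hom:
  "ks \<in> indices n \<Longrightarrow> (\<lambda>x. coord x ks) \<in> hom (Hoch_grp n \<Phi> m p) (Hoch_comp \<Phi> m p ks)"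
proof (induction n arbitrary: m p ks)
  case 0
  then show ?case
    by (simp add: indices_0 hom_def)
next
  case (Suc n)
  from Suc.prems obtain ls k where ks: "ks = ls @ [k]" "ls \<in> indices n" "1 \<le> k"
    by (rule indices_SucE)
  have "(\<lambda>x. coord x ls) \<circ> (\<lambda>x. unfam x k) \<in>
      hom (Hoch_grp (Suc n) \<Phi> m p) (Hoch_comp \<Phi> (k + m) (p - (int k - 1)) ls)"
    by (rule hom_compose[OF iter_unfam_hom[OF ks(3)] Suc.IH[OF ks(2)]])
  then show ?case
    by (simp add: ks o_def algebra_simps)
qed

lemmas coord_closed = hom_in_carrier[OF coord_hom]
lemmas coord_mult = hom_mult[OF coord_hom]
lemmas coord_one = hom_one[OF coord_hom comm_imp_group[OF iterD(1)] comm_imp_group[OF covariantD(1)[OF \<Phi>]]]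
lemmas coord_finprod = hom_finprod[OF coord_hom iterD(1) covariantD(1)[OF \<Phi>]]
lemmas coord_pow = hom_int_pow[OF coord_hom _ comm_imp_group[OF iterD(1)] comm_imp_group[OF covariantD(1)[OF \<Phi>]]]

lemma coord_eqI:
  "x \<in> carrier (Hoch_grp n \<Phi> m p) \<Longrightarrow> y \<in> carrier (Hoch_grp n \<Phi> m p) \<Longrightarrow>
    (\<And>ks. ks \<in> indices n \<Longrightarrow> coord x ks = coord y ks) \<Longrightarrow> x = y"
proof (induction n arbitrary: m p x y)
  case 0
  then show ?case
    by (simp add: indices_0)
next
  case (Suc n)
  show ?case
  proof (rule iter_eqI[OF Suc.prems(1,2)])
    fix k :: nat assume k: "1 \<le> k"
    show "unfam x k = unfam y k"
    proof (rule Suc.IH)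
      show "coord (unfam x k) ks = coord (unfam y k) ks" if "ks \<in> indices n" for ks
        using Suc.prems(3)[of "ks @ [k]"] that k by (simp add: indices_snoc)
    qed (use hom_in_carrier[OF iter_unfam_hom[OF k]] Suc.prems in blast)+
  qed
qed

text \<open>The support fibres over its last entries: finitely many of these occur, and over each
  one the induction hypothesis applies.\<close>

lemma coord_finite:
  "x \<in> carrier (Hoch_grp n \<Phi> m p) \<Longrightarrow>
    finite {ks \<in> indices n. coord x ks \<noteq> \<one>\<^bsub>Hoch_comp \<Phi> m p ks\<^esub>}"
proof (induction n arbitrary: m p x)
  case 0
  then show ?case
    by (simp add: indices_0)
next
  case (Suc n)
  let ?G = "\<lambda>k. Hoch_grp n \<Phi> (k + m) (p - (int k - 1))"
  let ?S = "{k. 1 \<le> k \<and> unfam x k \<noteq> \<one>\<^bsub>?G k\<^esub>}"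
  let ?T = "\<lambda>k. {ks \<in> indices n. coord (unfam x k) ks \<noteq> \<one>\<^bsub>Hoch_comp \<Phi> (k + m) (p - (int k - 1)) ks\<^esub>}"
  have "{ks \<in> indices (Suc n). coord x ks \<noteq> \<one>\<^bsub>Hoch_comp \<Phi> m p ks\<^esub>} \<subseteq> (\<Union>k\<in>?S. (\<lambda>ks. ks @ [k]) ` ?T k)"
  proof clarify
    fix ks assume "ks \<in> indices (Suc n)" and ne: "coord x ks \<noteq> \<one>\<^bsub>Hoch_comp \<Phi> m p ks\<^esub>"
    then obtain ls k where ks: "ks = ls @ [k]" "ls \<in> indices n" "1 \<le> k"
      by (elim indices_SucE)
    have ne': "coord (unfam x k) ls \<noteq> \<one>\<^bsub>Hoch_comp \<Phi> (k + m) (p - (int k - 1)) ls\<^esub>"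
      using ne by (simp add: ks algebra_simps)
    then have "unfam x k \<noteq> \<one>\<^bsub>?G k\<^esub>"
      using coord_one[OF ks(2)] by metis
    with ne' ks show "ks \<in> (\<Union>k\<in>?S. (\<lambda>ks. ks @ [k]) ` ?T k)"
      by blast
  qed
  moreover have "finite (?T k)" if "1 \<le> k" for k
    using Suc.IH[OF hom_in_carrier[OF iter_unfam_hom[OF that] Suc.prems]] .
  then have "finite (\<Union>k\<in>?S. (\<lambda>ks. ks @ [k]) ` ?T k)"
    using iter_finite[OF Suc.prems] by (intro finite_UN_I finite_imageI) auto
  ultimately show ?case
    by (rule finite_subset)
qed

text \<open>Together with \<open>coord_eqI\<close> and \<open>coord_finite\<close> this identifies
  the n-fold construction with a direct sum over lists of indices, so elements can be specified by
  coordinates instead of nested sequences.\<close>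

lemma coord_surj:
  "(\<And>ks. ks \<in> indices n \<Longrightarrow> y ks \<in> carrier (Hoch_comp \<Phi> m p ks)) \<Longrightarrow>
    finite {ks \<in> indices n. y ks \<noteq> \<one>\<^bsub>Hoch_comp \<Phi> m p ks\<^esub>} \<Longrightarrow>
    \<exists>x\<in>carrier (Hoch_grp n \<Phi> m p). \<forall>ks\<in>indices n. coord x ks = y ks"
proof (induction n arbitrary: m p y)
  case 0
  then show ?case
    by (simp add: indices_0)
next
  case (Suc n)
  let ?G = "\<lambda>k. Hoch_grp n \<Phi> (k + m) (p - (int k - 1))"
  let ?C = "\<lambda>k ks. Hoch_comp \<Phi> (k + m) (p - (int k - 1)) ks"
  let ?S = "{ks \<in> indices (Suc n). y ks \<noteq> \<one>\<^bsub>Hoch_comp \<Phi> m p ks\<^esub>}"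
  have C: "Hoch_comp \<Phi> m p (ks @ [k]) = ?C k ks" for ks k
    by (simp add: algebra_simps)
  have "\<exists>x\<in>carrier (?G k). \<forall>ks\<in>indices n. coord x ks = y (ks @ [k])" if k: "1 \<le> k" for k
  proof (rule Suc.IH)
    show "y (ks @ [k]) \<in> carrier (?C k ks)" if "ks \<in> indices n" for ks
      using Suc.prems(1)[of "ks @ [k]"] that k unfolding C by (simp add: indices_snoc)
    have "(\<lambda>ks. ks @ [k]) ` {ks \<in> indices n. y (ks @ [k]) \<noteq> \<one>\<^bsub>?C k ks\<^esub>} \<subseteq> ?S"
      using k C by (auto simp: indices_snoc)
    then show "finite {ks \<in> indices n. y (ks @ [k]) \<noteq> \<one>\<^bsub>?C k ks\<^esub>}"
      using Suc.prems(2) by (rule finite_subset[THEN finite_imageD]) (auto simp: inj_on_def)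
  qed
  then obtain z where z: "\<And>k. 1 \<le> k \<Longrightarrow> z k \<in> carrier (?G k)"
      "\<And>k ks. 1 \<le> k \<Longrightarrow> ks \<in> indices n \<Longrightarrow> coord (z k) ks = y (ks @ [k])"
    by metis
  \<comment> \<open>A nontrivial \<open>z k\<close> has a nontrivial coordinate, so \<open>k\<close>
    is the last entry of some list in the support of \<open>y\<close>.\<close>
  have "{k. 1 \<le> k \<and> z k \<noteq> \<one>\<^bsub>?G k\<^esub>} \<subseteq> last ` ?S"
  proof clarify
    fix k assume k: "1 \<le> k" and ne: "z k \<noteq> \<one>\<^bsub>?G k\<^esub>"
    have "\<exists>ks\<in>indices n. coord (z k) ks \<noteq> coord \<one>\<^bsub>?G k\<^esub> ks"
      using coord_eqI[OF z(1)[OF k]] ne monoid.one_closed[OF group.is_monoid[OF comm_imp_group[OF iterD(1)]]]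
      by metis
    then obtain ks where ks: "ks \<in> indices n" "y (ks @ [k]) \<noteq> \<one>\<^bsub>?C k ks\<^esub>"
      using coord_one z(2)[OF k] by metis
    then have "ks @ [k] \<in> ?S"
      using k by (simp add: C indices_snoc del: lsum_simps sum_list_append)
    then show "k \<in> last ` ?S"
      by (rule rev_image_eqI) simp
  qed
  then have fin: "finite {k. 1 \<le> k \<and> z k \<noteq> \<one>\<^bsub>?G k\<^esub>}"
    by (rule finite_subset) (intro finite_imageI Suc.prems(2))
  show ?case
  proof (intro bexI ballI)
    show "Fam (\<lambda>k\<in>{1..}. z k) \<in> carrier (Hoch_grp (Suc n) \<Phi> m p)"
      using z(1) fin by (rule iter_memI)
    show "coord (Fam (\<lambda>k\<in>{1..}. z k)) ks = y ks" if "ks \<in> indices (Suc n)" for ks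
      using that z(2) by (elim indices_SucE) simp
  qed
qed

text \<open>Each construction contributes the sign for moving \<open>f\<close> past one generator,
  of exponent \<open>r * (k - 1)\<close>; the exponents add up to
  \<open>r * lsum ks\<close>.\<close>

lemma coord_Act:
  "ks \<in> indices n \<Longrightarrow> x \<in> carrier (Hoch_grp n \<Phi> a p) \<Longrightarrow> f \<in> carrier (grp (Hom E a b) r) \<Longrightarrow>
    coord (Act ((Hoch E i ^^ n) \<Phi>) a b r f p x) ks =
    Act \<Phi> (sum_list ks + a) (sum_list ks + b) r
      (Ten E (sum_list ks) (sum_list ks) a b 0 r (Idm E (sum_list ks)) f) (p - lsum ks) (coord x ks)
      [^]\<^bsub>Hoch_comp \<Phi> b (p + r) ks\<^esub> ksign (r * lsum ks)"
proof (induction n arbitrary: ks a b p f x)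
  case 0
  have "Act \<Phi> a b r f p x \<in> carrier (grp (Obj \<Phi> b) (p + r))"
    using hom_in_carrier[OF covariantD(3)[OF \<Phi>]] 0 by simp
  with 0 show ?case
    using group.int_pow_1[OF comm_imp_group[OF covariantD(1)[OF \<Phi>]]]
    by (simp add: indices_0 Ten_unit_left ksign_def)
next
  case (Suc n)
  from Suc.prems(1) obtain ls k where ks: "ks = ls @ [k]" "ls \<in> indices n" "1 \<le> k"
    by (rule indices_SucE)
  let ?q = "p - (int k - 1)"
  let ?f = "Ten E k k a b 0 r (Idm E k) f"
  let ?s = "sum_list ls"
  note xk = hom_in_carrier[OF iter_unfam_hom[OF ks(3)] Suc.prems(2)]
  note f = Ten_Idm_closed[OF Suc.prems(3), of k]
  have Act: "Act ((Hoch E i ^^ n) \<Phi>) (k + a) (k + b) r ?f ?q (unfam x k)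
      \<in> carrier (Hoch_grp n \<Phi> (k + b) (?q + r))"
    by (rule hom_in_carrier[OF iterD(3) xk]) (use f in auto)
  let ?H = "Hoch_comp \<Phi> (k + b) (?q + r) ls"
  let ?v = "Act \<Phi> (?s + (k + a)) (?s + (k + b)) r (Ten E ?s ?s (k + a) (k + b) 0 r (Idm E ?s) ?f)
      (?q - lsum ls) (coord (unfam x k) ls)"
  have v: "?v \<in> carrier ?H"
    by (rule hom_in_carrier[OF covariantD(3)[OF \<Phi>] coord_closed[OF ks(2) xk]])
      (use Ten_Idm_closed[OF f] in auto)
  have "coord (Act ((Hoch E i ^^ Suc n) \<Phi>) a b r f p x) ks =
      coord (Act ((Hoch E i ^^ n) \<Phi>) (k + a) (k + b) r ?f ?q (unfam x k)
        [^]\<^bsub>Hoch_grp n \<Phi> (k + b) (?q + r)\<^esub> ksign (r * (int k - 1))) ls"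
    using ks by (simp add: Hoch_def)
  also have "\<dots> = coord (Act ((Hoch E i ^^ n) \<Phi>) (k + a) (k + b) r ?f ?q (unfam x k)) ls
        [^]\<^bsub>?H\<^esub> ksign (r * (int k - 1))"
    by (rule coord_pow[OF ks(2) Act])
  also have "\<dots> = (?v [^]\<^bsub>?H\<^esub> ksign (r * lsum ls)) [^]\<^bsub>?H\<^esub> ksign (r * (int k - 1))"
    by (subst Suc.IH[OF ks(2) xk f]) simp
  also have "\<dots> = ?v [^]\<^bsub>?H\<^esub> ksign (r * lsum ls + r * (int k - 1))"
    by (rule group.pow_ksign_ksign[OF comm_imp_group[OF covariantD(1)[OF \<Phi>]] v])
  finally show ?case
    unfolding Ten_Idm_Ten_Idm[OF Suc.prems(3)] by (simp add: ks algebra_simps)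
qed

end

text \<open>The same accumulation of signs, now for moving \<alpha> past the whole string of
  generators. The linearity in the first part places the intermediate stages in the groups whose
  coordinates are taken.\<close>

lemma coord_iter_map:
  assumes \<Phi>: "graded_covariant E \<Phi>" and \<Psi>: "graded_covariant E \<Psi>" and \<alpha>: "graded_map \<Phi> \<Psi> r \<alpha>"
  shows "graded_map ((Hoch E i ^^ n) \<Phi>) ((Hoch E i ^^ n) \<Psi>) r (Hoch_iter_map E i n \<Psi> r \<alpha>)"
    and "ks \<in> indices n \<Longrightarrow> x \<in> carrier (Hoch_grp n \<Phi> m p) \<Longrightarrow>
      coord (Hoch_iter_map E i n \<Psi> r \<alpha> m p x) ks =
      \<alpha> (sum_list ks + m) (p - lsum ks) (coord x ks) [^]\<^bsub>Hoch_comp \<Psi> m (p + r) ks\<^esub> ksign (r * lsum ks)"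
proof -
  show gm: "graded_map ((Hoch E i ^^ n) \<Phi>) ((Hoch E i ^^ n) \<Psi>) r (Hoch_iter_map E i n \<Psi> r \<alpha>)" for n
  proof (induction n)
    case (Suc n)
    show ?case
      unfolding graded_map_def
    proof (intro allI)
      fix m p
      let ?H = "\<lambda>k. Hoch_grp n \<Psi> (k + m) (p + r - (int k - 1))"
      have deg: "p - (int k - 1) + r = p + r - (int k - 1)" for k
        by simp
      have "(\<lambda>x. Fam (\<lambda>k\<in>{1..}. Hoch_iter_map E i n \<Psi> r \<alpha> (k + m) (p - (int k - 1)) (unfam x k)
          [^]\<^bsub>?H k\<^esub> ksign (r * (int k - 1))))
        \<in> hom (fam_sum (\<lambda>k. Hoch_grp n \<Phi> (k + m) (p - (int k - 1)))) (fam_sum ?H)"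
        by (rule fam_sum_map_hom) (intro hom_pow graded_mapD[OF Suc.IH] iterD \<Phi> \<Psi>; simp)+
      then show "Hoch_iter_map E i (Suc n) \<Psi> r \<alpha> m p
          \<in> hom (Hoch_grp (Suc n) \<Phi> m p) (Hoch_grp (Suc n) \<Psi> m (p + r))"
        by (simp add: Hoch_map_def[abs_def] grp_Hoch deg)
    qed
  qed (use \<alpha> in simp)
  show "ks \<in> indices n \<Longrightarrow> x \<in> carrier (Hoch_grp n \<Phi> m p) \<Longrightarrow>
      coord (Hoch_iter_map E i n \<Psi> r \<alpha> m p x) ks =
      \<alpha> (sum_list ks + m) (p - lsum ks) (coord x ks) [^]\<^bsub>Hoch_comp \<Psi> m (p + r) ks\<^esub> ksign (r * lsum ks)"
  proof (induction n arbitrary: ks m p x)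
    case 0
    have "\<alpha> m p x \<in> carrier (grp (Obj \<Psi> m) (p + r))"
      using hom_in_carrier[OF graded_mapD[OF \<alpha>]] 0 by simp
    with 0 show ?case
      using group.int_pow_1[OF comm_imp_group[OF covariantD(1)[OF \<Psi>]]]
      by (simp add: indices_0 ksign_def)
  next
    case (Suc n)
    from Suc.prems(1) obtain ls k where ks: "ks = ls @ [k]" "ls \<in> indices n" "1 \<le> k"
      by (rule indices_SucE)
    let ?q = "p - (int k - 1)"
    note xk = hom_in_carrier[OF iter_unfam_hom[OF \<Phi> ks(3)] Suc.prems(2)]
    let ?w = "Hoch_iter_map E i n \<Psi> r \<alpha> (k + m) ?q (unfam x k)"
    have w: "?w \<in> carrier (Hoch_grp n \<Psi> (k + m) (?q + r))"
      by (rule hom_in_carrier[OF graded_mapD[OF gm] xk]) simp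
    let ?H = "Hoch_comp \<Psi> (k + m) (?q + r) ls"
    let ?v = "\<alpha> (sum_list ls + (k + m)) (?q - lsum ls) (coord (unfam x k) ls)"
    have v: "?v \<in> carrier ?H"
      by (rule hom_in_carrier[OF graded_mapD[OF \<alpha>] coord_closed[OF \<Phi> ks(2) xk]]) simp
    have "coord (Hoch_iter_map E i (Suc n) \<Psi> r \<alpha> m p x) ks =
        coord (?w [^]\<^bsub>Hoch_grp n \<Psi> (k + m) (?q + r)\<^esub> ksign (r * (int k - 1))) ls"
      using ks by (simp add: Hoch_map_def)
    also have "\<dots> = coord ?w ls [^]\<^bsub>?H\<^esub> ksign (r * (int k - 1))"
      by (rule coord_pow[OF \<Psi> ks(2) w])
    also have "\<dots> = (?v [^]\<^bsub>?H\<^esub> ksign (r * lsum ls)) [^]\<^bsub>?H\<^esub> ksign (r * (int k - 1))"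
      by (subst Suc.IH[OF ks(2) xk]) simp
    also have "\<dots> = ?v [^]\<^bsub>?H\<^esub> ksign (r * lsum ls + r * (int k - 1))"
      by (rule group.pow_ksign_ksign[OF comm_imp_group[OF covariantD(1)[OF \<Psi>]] v])
    finally show ?case
      by (simp add: ks algebra_simps)
  qed
qed

text \<open>The contribution of the coordinate at \<open>ks[t := k]\<close> to the one at
  \<open>ks\<close>. In the exponent, \<open>p - lsum (ks[t := k])\<close> is the degree of
  \<open>v\<close>. The differential prescribes instead the degree of the element of the inner
  construction, larger by \<open>lsum (take t ks)\<close>; this excess turns the degree k - ks ! t -
  1 of the whiskered morphism into the k - ks ! t of the second summand.\<close>

definition Hoch_term :: "'a ufun \<Rightarrow> nat \<Rightarrow> int \<Rightarrow> nat list \<Rightarrow> nat \<Rightarrow> nat \<Rightarrow> 'a univ \<Rightarrow> 'a univ"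
  where "Hoch_term \<Phi> m p ks t k v =
    Act \<Phi> (sum_list (ks[t := k]) + m) (sum_list ks + m) (int k - int (ks ! t) - 1)
      (whisker E i (sum_list (take t ks)) k (ks ! t) (sum_list (drop (Suc t) ks) + m))
      (p - lsum (ks[t := k])) v
      [^]\<^bsub>Hoch_comp \<Phi> m (p - 1) ks\<^esub> ksign (p - lsum (ks[t := k]) + lsum (take t ks) * (int k - int (ks ! t)))"

context
  fixes \<Phi> :: "'a ufun"
  assumes \<Phi>: "graded_covariant E \<Phi>"
begin

lemma Hoch_term_hom:
  assumes "ks \<in> indices n" "t < n" "ks ! t < k"
  shows "Hoch_term \<Phi> m p ks t k \<in> hom (Hoch_comp \<Phi> m p (ks[t := k])) (Hoch_comp \<Phi> m (p - 1) ks)"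
proof -
  have t: "t < length ks" "1 \<le> ks ! t"
    using assms indices_nth[of ks n t] by (auto simp: indices_length)
  show ?thesis
    unfolding Hoch_term_def using t assms(3)
    by (intro hom_pow covariantD[OF \<Phi>] whisker_closed_nth) (simp_all add: lsum_update_nth)
qed

text \<open>The pair is recovered from \<open>t\<close> and the updated list, and the latter lies in
  the finite support of \<open>x\<close>.\<close>

lemma finite_coord_update:
  assumes "x \<in> carrier (Hoch_grp n \<Phi> m p)" "ks \<in> indices n"
  shows "finite {(t, k). t < n \<and> ks ! t < k \<and> coord x (ks[t := k]) \<noteq> \<one>\<^bsub>Hoch_comp \<Phi> m p (ks[t := k])\<^esub>}"
proof -
  let ?S = "{ks \<in> indices n. coord x ks \<noteq> \<one>\<^bsub>Hoch_comp \<Phi> m p ks\<^esub>}"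
  have "{(t, k). t < n \<and> ks ! t < k \<and> coord x (ks[t := k]) \<noteq> \<one>\<^bsub>Hoch_comp \<Phi> m p (ks[t := k])\<^esub>}
      \<subseteq> (\<lambda>(t, ls). (t, ls ! t)) ` ({..<n} \<times> ?S)"
  proof clarify
    fix t k assume *: "t < n" "ks ! t < k" "coord x (ks[t := k]) \<noteq> \<one>\<^bsub>Hoch_comp \<Phi> m p (ks[t := k])\<^esub>"
    then have "ks[t := k] \<in> ?S"
      using assms(2) by (simp add: indices_update)
    moreover have "(t, k) = (case (t, ks[t := k]) of (t, ls) \<Rightarrow> (t, ls ! t))"
      using * indices_length[OF assms(2)] by simp
    ultimately show "(t, k) \<in> (\<lambda>(t, ls). (t, ls ! t)) ` ({..<n} \<times> ?S)"
      using *(1) by (intro image_eqI[of _ _ "(t, ks[t := k])"]) auto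
  qed
  then show ?thesis
    by (rule finite_subset) (intro finite_imageI finite_cartesian_product coord_finite[OF \<Phi> assms(1)] finite_lessThan)
qed

text \<open>An appended index \<open>k0\<close> is the outermost one. For the inner directions it
  only shifts \<open>m\<close> and \<open>p\<close>; position \<open>n\<close> is the new direction,
  with all other generators to its left.\<close>

lemma Hoch_term_snoc:
  assumes "length ls = n"
  shows "t < n \<Longrightarrow> Hoch_term \<Phi> m p (ls @ [k0]) t k v = Hoch_term \<Phi> (k0 + m) (p - (int k0 - 1)) ls t k v"
    and "Hoch_term \<Phi> m p (ls @ [k0]) n k v =
      Act \<Phi> (sum_list ls + (k + m)) (sum_list ls + (k0 + m)) (int k - int k0 - 1)
        (whisker E i (sum_list ls) k k0 m) (p - (int k - 1) - lsum ls) v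
        [^]\<^bsub>Hoch_comp \<Phi> (k0 + m) (p - 1 - (int k0 - 1)) ls\<^esub>
          ksign (p - (int k - 1) - lsum ls + lsum ls * (int k - int k0))"
  using assms by (simp_all add: Hoch_term_def list_update_append nth_append algebra_simps)

text \<open>The outermost differential applies the inner one to the component at \<open>k0\<close>
  and adds the terms in which a larger outermost index drops to \<open>k0\<close>. Induction turns
  the former into the internal differential and the directions \<open>t < n\<close>; the latter are
  the direction \<open>t = n\<close>.\<close>

lemma coord_dif:
  "ks \<in> indices n \<Longrightarrow> x \<in> carrier (Hoch_grp n \<Phi> m p) \<Longrightarrow>
    coord (dif (Obj ((Hoch E i ^^ n) \<Phi>) m) p x) ks =
    dif (Obj \<Phi> (sum_list ks + m)) (p - lsum ks) (coord x ks)
      \<otimes>\<^bsub>Hoch_comp \<Phi> m (p - 1) ks\<^esub>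
    finprod (Hoch_comp \<Phi> m (p - 1) ks) (\<lambda>(t, k). Hoch_term \<Phi> m p ks t k (coord x (ks[t := k])))
      {(t, k). t < n \<and> ks ! t < k \<and> coord x (ks[t := k]) \<noteq> \<one>\<^bsub>Hoch_comp \<Phi> m p (ks[t := k])\<^esub>}"
proof (induction n arbitrary: ks m p x)
  case 0
  interpret G: comm_group "grp (Obj \<Phi> m) (p - 1)"
    by (rule covariantD(1)[OF \<Phi>])
  have "dif (Obj \<Phi> m) p x \<in> carrier (grp (Obj \<Phi> m) (p - 1))"
    using hom_in_carrier[OF covariantD(2)[OF \<Phi>]] 0 by simp
  with 0 show ?case
    by (simp add: indices_0)
next
  case (Suc n)
  from Suc.prems(1) obtain ls k0 where ks: "ks = ls @ [k0]" "ls \<in> indices n" "1 \<le> k0"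
    by (rule indices_SucE)
  have len: "length ls = n"
    using ks(2) by (rule indices_length)
  let ?q = "p - (int k0 - 1)"
  let ?s = "sum_list ls"
  let ?F = "(Hoch E i ^^ n) \<Phi>"
  let ?Gk = "grp (Obj ?F (k0 + m)) (?q - 1)"
  let ?G = "Hoch_comp \<Phi> (k0 + m) (?q - 1) ls"
  interpret G: comm_group ?G
    by (rule covariantD(1)[OF \<Phi>])
  interpret Gk: comm_group ?Gk
    by (rule iterD(1)[OF \<Phi>])
  have Geq: "Hoch_comp \<Phi> m (p - 1) ks = ?G"
    by (simp add: ks algebra_simps)
  have xk: "unfam x k \<in> carrier (grp (Obj ?F (k + m)) (p - (int k - 1)))" if "1 \<le> k" for k
    using hom_in_carrier[OF iter_unfam_hom[OF \<Phi> that] Suc.prems(2)] .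
  let ?f = "\<lambda>k. Ten E k k0 m m (int k - int k0 - 1) 0 (f_img i k k0) (Idm E m)"
  let ?A = "\<lambda>k. Act ?F (k + m) (k0 + m) (int k - int k0 - 1) (?f k) (p - (int k - 1)) (unfam x k)"
  let ?S = "{k. k0 < k \<and> unfam x k \<noteq> \<one>\<^bsub>grp (Obj ?F (k + m)) (p - (int k - 1))\<^esub>}"
  have A: "?A k \<in> carrier ?Gk" if "k0 < k" for k
    by (rule hom_in_carrier[OF iterD(3)[OF \<Phi>] xk]) (use that ks(3) Ten_f_img_closed in auto)
  have D: "dif (Obj ?F (k0 + m)) ?q (unfam x k0) \<in> carrier ?Gk"
    by (rule hom_in_carrier[OF iterD(2)[OF \<Phi>] xk[OF ks(3)]]) simp
  have A_term: "coord (?A k [^]\<^bsub>?Gk\<^esub> ksign (p - (int k - 1))) ls =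
      Hoch_term \<Phi> m p ks n k (coord x (ks[n := k]))" if k: "k0 < k" for k
  proof -
    let ?v = "Act \<Phi> (?s + (k + m)) (?s + (k0 + m)) (int k - int k0 - 1) (whisker E i ?s k k0 m)
        (p - (int k - 1) - lsum ls) (coord (unfam x k) ls)"
    have k': "1 \<le> k"
      using k ks(3) by simp
    have w: "whisker E i ?s k k0 m \<in> carrier (grp (Hom E (?s + (k + m)) (?s + (k0 + m))) (int k - int k0 - 1))"
      using whisker_closed[OF ks(3) k, of ?s m] by (simp add: add.assoc)
    have v: "?v \<in> carrier ?G"
      by (rule hom_in_carrier[OF covariantD(3)[OF \<Phi> w] coord_closed[OF \<Phi> ks(2) xk[OF k']]]) simp
    have deg: "p - (int k - 1) + (int k - int k0 - 1) = ?q - 1"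
      by simp
    have "coord (?A k) ls = ?v [^]\<^bsub>?G\<^esub> ksign ((int k - int k0 - 1) * lsum ls)"
      using coord_Act[OF \<Phi> ks(2) xk[OF k'] Ten_f_img_closed[OF ks(3) k]]
      unfolding Ten_Idm_f_img[OF ks(3) k] deg .
    then have "coord (?A k [^]\<^bsub>?Gk\<^esub> ksign (p - (int k - 1))) ls =
        ?v [^]\<^bsub>?G\<^esub> ksign ((int k - int k0 - 1) * lsum ls + (p - (int k - 1)))"
      using coord_pow[OF \<Phi> ks(2) A[OF k]] G.pow_ksign_ksign[OF v] by simp
    also have "\<dots> = Hoch_term \<Phi> m p ks n k (coord x (ks[n := k]))"
      unfolding ks(1) Hoch_term_snoc(2)[OF len] using len by (simp add: list_update_append algebra_simps)
    finally show ?thesis .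
  qed
  have trm: "Hoch_term \<Phi> m p ks t k (coord x (ks[t := k])) \<in> carrier ?G"
    if "t < Suc n" "ks ! t < k" for t k
    using hom_in_carrier[OF Hoch_term_hom[OF Suc.prems(1) that, of m p]
        coord_closed[OF \<Phi> indices_update[OF Suc.prems(1)] Suc.prems(2)]] that
    unfolding Geq by simp
  let ?T = "\<lambda>(t, k). Hoch_term \<Phi> m p ks t k (coord x (ks[t := k]))"
  let ?P = "{(t, k). t < Suc n \<and> ks ! t < k \<and> coord x (ks[t := k]) \<noteq> \<one>\<^bsub>Hoch_comp \<Phi> m p (ks[t := k])\<^esub>}"
  let ?P1 = "{(t, k). t < n \<and> ls ! t < k \<and>
      coord (unfam x k0) (ls[t := k]) \<noteq> \<one>\<^bsub>Hoch_comp \<Phi> (k0 + m) ?q (ls[t := k])\<^esub>}"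
  let ?S2 = "{k. k0 < k \<and> coord (unfam x k) ls \<noteq> \<one>\<^bsub>Hoch_comp \<Phi> (k + m) (p - (int k - 1)) ls\<^esub>}"
  have comp1: "Hoch_comp \<Phi> m p (ks[t := k]) = Hoch_comp \<Phi> (k0 + m) ?q (ls[t := k])"
    "coord x (ks[t := k]) = coord (unfam x k0) (ls[t := k])" "ks ! t = ls ! t" if "t < n" for t k
    using that len by (simp_all add: ks list_update_append nth_append algebra_simps)
  have comp2: "Hoch_comp \<Phi> m p (ks[n := k]) = Hoch_comp \<Phi> (k + m) (p - (int k - 1)) ls"
    "coord x (ks[n := k]) = coord (unfam x k) ls" "ks ! n = k0" for k
    using len by (simp_all add: ks list_update_append nth_append algebra_simps)
  define Q where "Q t k \<longleftrightarrow> ks ! t < k \<and> coord x (ks[t := k]) \<noteq> \<one>\<^bsub>Hoch_comp \<Phi> m p (ks[t := k])\<^esub>" for t k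
  have "Q t k \<longleftrightarrow> ls ! t < k \<and>
      coord (unfam x k0) (ls[t := k]) \<noteq> \<one>\<^bsub>Hoch_comp \<Phi> (k0 + m) ?q (ls[t := k])\<^esub>" if "t < n" for t k
    unfolding Q_def comp1[OF that] ..
  moreover have "Q n k \<longleftrightarrow> k0 < k \<and> coord (unfam x k) ls \<noteq> \<one>\<^bsub>Hoch_comp \<Phi> (k + m) (p - (int k - 1)) ls\<^esub>" for k
    unfolding Q_def comp2 ..
  ultimately have "?P1 = {(t, k). t < n \<and> Q t k}" "?S2 = {k. Q n k}"
    by blast+
  moreover have "?P = {(t, k). t < Suc n \<and> Q t k}"
    unfolding Q_def ..
  ultimately have P: "?P = ?P1 \<union> Pair n ` ?S2"
    by (auto simp: less_Suc_eq)
  have finP: "finite ?P"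
    by (rule finite_coord_update[OF Suc.prems(2,1)])
  then have fin: "finite ?P1" "finite (Pair n ` ?S2)" "finite ?S2"
    unfolding P by (auto dest: finite_imageD simp: inj_on_def)
  have TP: "?T \<in> ?P \<rightarrow> carrier ?G"
    using trm by auto
  have T: "?T \<in> ?P1 \<rightarrow> carrier ?G" "?T \<in> Pair n ` ?S2 \<rightarrow> carrier ?G"
    using TP unfolding P by auto
  have finS: "finite ?S"
    by (rule finite_subset[OF _ iter_finite[OF \<Phi> Suc.prems(2)]]) auto
  \<comment> \<open>The differential is summed where \<open>unfam x k\<close> is nontrivial, the
    formula where its coordinate at \<open>ls\<close> is; the additional terms are values of
    homomorphisms at units.\<close>
  have S2S: "finprod ?G (\<lambda>k. Hoch_term \<Phi> m p ks n k (coord x (ks[n := k]))) ?S =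
      finprod ?G (\<lambda>k. Hoch_term \<Phi> m p ks n k (coord x (ks[n := k]))) ?S2"
  proof (rule G.finprod_mono_neutral_cong_right[OF finS])
    have "coord \<one>\<^bsub>grp (Obj ?F (k + m)) (p - (int k - 1))\<^esub> ls = \<one>\<^bsub>Hoch_comp \<Phi> (k + m) (p - (int k - 1)) ls\<^esub>" for k
      by (rule coord_one[OF \<Phi> ks(2)])
    then show "?S2 \<subseteq> ?S"
      by auto
    fix k assume k: "k \<in> ?S - ?S2"
    then have k0: "k0 < k" and one: "coord x (ks[n := k]) = \<one>\<^bsub>Hoch_comp \<Phi> m p (ks[n := k])\<^esub>"
      unfolding comp2(1,2) by auto
    have "Hoch_term \<Phi> m p ks n k \<in> hom (Hoch_comp \<Phi> m p (ks[n := k])) ?G"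
      using Hoch_term_hom[OF Suc.prems(1), of n k m p] k0 comp2(3) unfolding Geq by simp
    then show "Hoch_term \<Phi> m p ks n k (coord x (ks[n := k])) = \<one>\<^bsub>?G\<^esub>"
      unfolding one by (rule hom_one) (intro comm_imp_group covariantD(1)[OF \<Phi>])+
  next
    show "(\<lambda>k. Hoch_term \<Phi> m p ks n k (coord x (ks[n := k]))) \<in> ?S \<rightarrow> carrier ?G"
      using trm[of n] comp2(3) by auto
  qed simp
  have "coord (dif (Obj ((Hoch E i ^^ Suc n) \<Phi>) m) p x) ks =
      coord (dif (Obj ?F (k0 + m)) ?q (unfam x k0) \<otimes>\<^bsub>?Gk\<^esub>
        finprod ?Gk (\<lambda>k. ?A k [^]\<^bsub>?Gk\<^esub> ksign (p - (int k - 1))) ?S) ls"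
    using ks by (simp add: Hoch_def Let_def)
  also have "\<dots> = coord (dif (Obj ?F (k0 + m)) ?q (unfam x k0)) ls \<otimes>\<^bsub>?G\<^esub>
      finprod ?G (\<lambda>k. coord (?A k [^]\<^bsub>?Gk\<^esub> ksign (p - (int k - 1))) ls) ?S"
  proof -
    have A': "(\<lambda>k. ?A k [^]\<^bsub>?Gk\<^esub> ksign (p - (int k - 1))) \<in> ?S \<rightarrow> carrier ?Gk"
      by (intro Pi_I Gk.int_pow_closed A) simp
    show ?thesis
      by (simp only: coord_mult[OF \<Phi> ks(2) D Gk.finprod_closed[OF A']] coord_finprod[OF \<Phi> ks(2) A'])
  qed
  also have "finprod ?G (\<lambda>k. coord (?A k [^]\<^bsub>?Gk\<^esub> ksign (p - (int k - 1))) ls) ?S =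
      finprod ?G (\<lambda>k. Hoch_term \<Phi> m p ks n k (coord x (ks[n := k]))) ?S"
    using A_term trm[of n] comp2(3) by (intro G.finprod_cong') auto
  also have "\<dots> = finprod ?G (\<lambda>k. ?T (n, k)) ?S2"
    unfolding S2S by simp
  also have "\<dots> = finprod ?G ?T (Pair n ` ?S2)"
    by (rule G.finprod_reindex[symmetric, OF T(2)]) (simp add: inj_on_def)
  also have "coord (dif (Obj ?F (k0 + m)) ?q (unfam x k0)) ls =
      dif (Obj \<Phi> (?s + (k0 + m))) (?q - lsum ls) (coord (unfam x k0) ls) \<otimes>\<^bsub>?G\<^esub>
      finprod ?G (\<lambda>(t, k). Hoch_term \<Phi> (k0 + m) ?q ls t k (coord (unfam x k0) (ls[t := k]))) ?P1"
    by (rule Suc.IH[OF ks(2) xk[OF ks(3)]])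
  also have "finprod ?G (\<lambda>(t, k). Hoch_term \<Phi> (k0 + m) ?q ls t k (coord (unfam x k0) (ls[t := k]))) ?P1 =
      finprod ?G ?T ?P1"
  proof (rule G.finprod_cong'[OF refl T(1)])
    fix z assume "z \<in> ?P1"
    then show "(case z of (t, k) \<Rightarrow> Hoch_term \<Phi> (k0 + m) ?q ls t k (coord (unfam x k0) (ls[t := k]))) = ?T z"
      using Hoch_term_snoc(1)[OF len] comp1(2) ks(1) by auto
  qed
  also have "dif (Obj \<Phi> (?s + (k0 + m))) (?q - lsum ls) (coord (unfam x k0) ls) \<otimes>\<^bsub>?G\<^esub> finprod ?G ?T ?P1 \<otimes>\<^bsub>?G\<^esub>
        finprod ?G ?T (Pair n ` ?S2) =
      dif (Obj \<Phi> (?s + (k0 + m))) (?q - lsum ls) (coord (unfam x k0) ls) \<otimes>\<^bsub>?G\<^esub> finprod ?G ?T ?P"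
  proof -
    have "dif (Obj \<Phi> (?s + (k0 + m))) (?q - lsum ls) (coord (unfam x k0) ls) \<in> carrier ?G"
      by (rule hom_in_carrier[OF covariantD(2)[OF \<Phi>] coord_closed[OF \<Phi> ks(2) xk[OF ks(3)]]]) simp
    moreover have "finprod ?G ?T ?P = finprod ?G ?T ?P1 \<otimes>\<^bsub>?G\<^esub> finprod ?G ?T (Pair n ` ?S2)"
      unfolding P by (rule G.finprod_Un_disjoint[OF fin(1,2) _ T]) auto
    ultimately show ?thesis
      using T by (simp only: G.m_assoc G.finprod_closed)
  qed
  finally show ?case
    unfolding Geq by (simp add: ks add.assoc diff_diff_eq add.commute[of "lsum ls"])
qed

end


section \<open>The coHochschild construction in coordinates\<close>

abbreviation coHoch_grp :: "nat \<Rightarrow> 'a ufun \<Rightarrow> nat \<Rightarrow> int \<Rightarrow> 'a univ monoid"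
  where "coHoch_grp n \<Psi> m p \<equiv> grp (Obj ((coHoch E i ^^ n) \<Psi>) m) p"

lemma grp_coHoch: "grp (Obj (coHoch E i \<Psi>) m) p = fam_prod (\<lambda>n. grp (Obj \<Psi> (n + m)) (p + (int n - 1)))"
  by (simp add: coHoch_def)

text \<open>The sums in the coHochschild differential range over the fixed finite sets
  \<open>{1..<n}\<close> and the target is a product, so linearity can be checked term by term and
  component by component.\<close>

lemma graded_coHoch:
  assumes "graded_contravariant E \<Psi>"
  shows "graded_contravariant E (coHoch E i \<Psi>)"
  unfolding graded_contravariant_def
proof (intro conjI allI ballI)
  note \<Psi> = contravariantD[OF assms]
  have un: "(\<lambda>x. h (unfam x n)) \<in> hom (grp (Obj (coHoch E i \<Psi>) m) p) K"
    if "h \<in> hom (grp (Obj \<Psi> (n + m)) (p + (int n - 1))) K" "1 \<le> n" for h n m p and K :: "'a univ monoid"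
    using hom_compose[OF unfam_prod_hom[OF that(2), of "\<lambda>n. grp (Obj \<Psi> (n + m)) (p + (int n - 1))"] that(1)]
    by (simp add: grp_coHoch o_def)
  show "comm_group (grp (Obj (coHoch E i \<Psi>) m) p)" for m p
    unfolding grp_coHoch using \<Psi>(1) by (rule comm_group_fam_prod)
  show "dif (Obj (coHoch E i \<Psi>) m) p \<in> hom (grp (Obj (coHoch E i \<Psi>) m) p) (grp (Obj (coHoch E i \<Psi>) m) (p - 1))" for m p
  proof -
    let ?H = "\<lambda>n. grp (Obj \<Psi> (n + m)) (p - 1 + (int n - 1))"
    have deg: "p + (int n - 1) - 1 = p - 1 + (int n - 1)" for n
      by simp
    have "(\<lambda>h. Fam (\<lambda>n\<in>{1..}. (dif (Obj \<Psi> (n + m)) (p + (int n - 1)) (unfam h n) \<otimes>\<^bsub>?H n\<^esub>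
        inv\<^bsub>?H n\<^esub> finprod (?H n) (\<lambda>k. Act \<Psi> (n + m) (k + m) (int n - int k - 1)
                   (Ten E n k m m (int n - int k - 1) 0 (f_img i n k) (Idm E m))
                   (p + (int k - 1)) (unfam h k)) {1..<n}) [^]\<^bsub>?H n\<^esub> ksign (int n - 1)))
      \<in> hom (grp (Obj (coHoch E i \<Psi>) m) p) (fam_prod ?H)"
      by (rule fam_prod_homI)
        (intro hom_pow hom_mult_hom hom_inv hom_finprod_hom un \<Psi> Ten_f_img_closed; simp)
    then show ?thesis
      by (simp add: coHoch_def Let_def deg)
  qed
  fix a b r p f assume f: "f \<in> carrier (grp (Hom E a b) r)"
  let ?H = "\<lambda>n. grp (Obj \<Psi> (n + a)) (p + r + (int n - 1))"
  have deg: "p + (int n - 1) + r = p + r + (int n - 1)" for n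
    by simp
  have "(\<lambda>h. Fam (\<lambda>n\<in>{1..}. Act \<Psi> (n + a) (n + b) r (Ten E n n a b 0 r (Idm E n) f) (p + (int n - 1)) (unfam h n)
        [^]\<^bsub>?H n\<^esub> ksign (r * (int n - 1)))) \<in> hom (grp (Obj (coHoch E i \<Psi>) b) p) (fam_prod ?H)"
    by (rule fam_prod_homI) (intro hom_pow un \<Psi> Ten_Idm_closed f; simp)
  then show "Act (coHoch E i \<Psi>) a b r f p \<in> hom (grp (Obj (coHoch E i \<Psi>) b) p) (grp (Obj (coHoch E i \<Psi>) a) (p + r))"
    by (simp add: coHoch_def deg)
qed

lemma graded_coHoch_iter: "graded_contravariant E \<Psi> \<Longrightarrow> graded_contravariant E ((coHoch E i ^^ n) \<Psi>)"
  by (induction n) (simp_all add: graded_coHoch)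

abbreviation coHoch_comp :: "'a ufun \<Rightarrow> nat \<Rightarrow> int \<Rightarrow> nat list \<Rightarrow> 'a univ monoid"
  where "coHoch_comp \<Psi> m p js \<equiv> grp (Obj \<Psi> (sum_list js + m)) (p + lsum js)"

text \<open>The contribution of \<open>js[t := j]\<close> to \<open>js\<close>, without the overall
  sign of exponent \<open>lsum js\<close>. That sign is pulled out of the iterated differential, and
  its part from the inner generators changes the factor js ! t - j - 1, the degree of the whiskered
  morphism, into js ! t - j.\<close>

definition coHoch_term :: "'a ufun \<Rightarrow> nat \<Rightarrow> int \<Rightarrow> nat list \<Rightarrow> nat \<Rightarrow> nat \<Rightarrow> 'a univ \<Rightarrow> 'a univ"
  where "coHoch_term \<Psi> m p js t j v =
    Act \<Psi> (sum_list js + m) (sum_list (js[t := j]) + m) (int (js ! t) - int j - 1)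
      (whisker E i (sum_list (take t js)) (js ! t) j (sum_list (drop (Suc t) js) + m))
      (p + lsum (js[t := j])) v
      [^]\<^bsub>coHoch_comp \<Psi> m (p - 1) js\<^esub> ksign (lsum (take t js) * (int (js ! t) - int j))"

lemma whisker_closed_lower:
  assumes "t < length js" "1 \<le> j" "j < js ! t"
  shows "whisker E i (sum_list (take t js)) (js ! t) j (sum_list (drop (Suc t) js) + m)
    \<in> carrier (grp (Hom E (sum_list js + m) (sum_list (js[t := j]) + m)) (int (js ! t) - int j - 1))"
  using whisker_closed[OF assms(2,3), of "sum_list (take t js)" "sum_list (drop (Suc t) js) + m"]
  by (simp add: sum_list_update_nth[OF assms(1)] sum_list_split_nth[OF assms(1)] add.assoc)

context
  fixes \<Psi> :: "'a ufun"
  assumes \<Psi>: "graded_contravariant E \<Psi>"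
begin

lemmas co_iterD = contravariantD[OF graded_coHoch_iter[OF \<Psi>]]

lemma co_iter_unfam_hom: "1 \<le> k \<Longrightarrow> (\<lambda>x. unfam x k) \<in>
    hom (coHoch_grp (Suc n) \<Psi> m p) (coHoch_grp n \<Psi> (k + m) (p + (int k - 1)))"
  using unfam_prod_hom[of k "\<lambda>k. coHoch_grp n \<Psi> (k + m) (p + (int k - 1))"]
  by (simp add: grp_coHoch)

lemma co_coord_hom:
  "ks \<in> indices n \<Longrightarrow> (\<lambda>x. coord x ks) \<in> hom (coHoch_grp n \<Psi> m p) (coHoch_comp \<Psi> m p ks)"
proof (induction n arbitrary: m p ks)
  case 0
  then show ?case
    by (simp add: indices_0 hom_def)
next
  case (Suc n)
  from Suc.prems obtain ls k where ks: "ks = ls @ [k]" "ls \<in> indices n" "1 \<le> k"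
    by (rule indices_SucE)
  have "(\<lambda>x. coord x ls) \<circ> (\<lambda>x. unfam x k) \<in>
      hom (coHoch_grp (Suc n) \<Psi> m p) (coHoch_comp \<Psi> (k + m) (p + (int k - 1)) ls)"
    by (rule hom_compose[OF co_iter_unfam_hom[OF ks(3)] Suc.IH[OF ks(2)]])
  then show ?case
    by (simp add: ks o_def algebra_simps)
qed

lemmas co_coord_closed = hom_in_carrier[OF co_coord_hom]
lemmas co_coord_mult = hom_mult[OF co_coord_hom]
lemmas co_coord_finprod = hom_finprod[OF co_coord_hom co_iterD(1) contravariantD(1)[OF \<Psi>]]
lemmas co_coord_pow = hom_int_pow[OF co_coord_hom _ comm_imp_group[OF co_iterD(1)] comm_imp_group[OF contravariantD(1)[OF \<Psi>]]]

lemma co_coord_eqI: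
  "x \<in> carrier (coHoch_grp n \<Psi> m p) \<Longrightarrow> y \<in> carrier (coHoch_grp n \<Psi> m p) \<Longrightarrow>
    (\<And>ks. ks \<in> indices n \<Longrightarrow> coord x ks = coord y ks) \<Longrightarrow> x = y"
proof (induction n arbitrary: m p x y)
  case 0
  then show ?case
    by (simp add: indices_0)
next
  case (Suc n)
  have eq: "coHoch_grp (Suc n) \<Psi> m p =
      fam_prod (\<lambda>k. coHoch_grp n \<Psi> (k + m) (p + (int k - 1)))"
    by (simp add: grp_coHoch)
  show ?case
  proof (rule fam_prod_eqI[OF Suc.prems(1,2)[unfolded eq]])
    fix k :: nat assume k: "1 \<le> k"
    show "unfam x k = unfam y k"
    proof (rule Suc.IH)
      show "coord (unfam x k) ks = coord (unfam y k) ks" if "ks \<in> indices n" for ks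
        using Suc.prems(3)[of "ks @ [k]"] that k by (simp add: indices_snoc)
    qed (use hom_in_carrier[OF co_iter_unfam_hom[OF k]] Suc.prems in blast)+
  qed
qed

lemma co_coord_surj:
  "(\<And>ks. ks \<in> indices n \<Longrightarrow> y ks \<in> carrier (coHoch_comp \<Psi> m p ks)) \<Longrightarrow>
    \<exists>x\<in>carrier (coHoch_grp n \<Psi> m p). \<forall>ks\<in>indices n. coord x ks = y ks"
proof (induction n arbitrary: m p y)
  case 0
  then show ?case
    by (simp add: indices_0)
next
  case (Suc n)
  let ?G = "\<lambda>k. coHoch_grp n \<Psi> (k + m) (p + (int k - 1))"
  have "\<exists>x\<in>carrier (?G k). \<forall>ks\<in>indices n. coord x ks = y (ks @ [k])" if k: "1 \<le> k" for k
  proof (rule Suc.IH)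
    show "y (ks @ [k]) \<in> carrier (coHoch_comp \<Psi> (k + m) (p + (int k - 1)) ks)" if "ks \<in> indices n" for ks
      using Suc.prems(1)[of "ks @ [k]"] that k by (simp add: indices_snoc algebra_simps)
  qed
  then obtain z where z: "\<And>k. 1 \<le> k \<Longrightarrow> z k \<in> carrier (?G k)"
      "\<And>k ks. 1 \<le> k \<Longrightarrow> ks \<in> indices n \<Longrightarrow> coord (z k) ks = y (ks @ [k])"
    by metis
  show ?case
  proof (intro bexI ballI)
    show "Fam (\<lambda>k\<in>{1..}. z k) \<in> carrier (coHoch_grp (Suc n) \<Psi> m p)"
      using fam_prod_memI[of z ?G] z(1) by (simp add: grp_coHoch)
    show "coord (Fam (\<lambda>k\<in>{1..}. z k)) ks = y ks" if "ks \<in> indices (Suc n)" for ks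
      using that z(2) by (elim indices_SucE) simp
  qed
qed

lemma co_coord_Act:
  "ks \<in> indices n \<Longrightarrow> x \<in> carrier (coHoch_grp n \<Psi> b p) \<Longrightarrow> f \<in> carrier (grp (Hom E a b) r) \<Longrightarrow>
    coord (Act ((coHoch E i ^^ n) \<Psi>) a b r f p x) ks =
    Act \<Psi> (sum_list ks + a) (sum_list ks + b) r
      (Ten E (sum_list ks) (sum_list ks) a b 0 r (Idm E (sum_list ks)) f) (p + lsum ks) (coord x ks)
      [^]\<^bsub>coHoch_comp \<Psi> a (p + r) ks\<^esub> ksign (r * lsum ks)"
proof (induction n arbitrary: ks a b p f x)
  case 0
  have "Act \<Psi> a b r f p x \<in> carrier (grp (Obj \<Psi> a) (p + r))"
    using hom_in_carrier[OF contravariantD(3)[OF \<Psi>]] 0 by simp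
  with 0 show ?case
    using group.int_pow_1[OF comm_imp_group[OF contravariantD(1)[OF \<Psi>]]]
    by (simp add: indices_0 Ten_unit_left ksign_def)
next
  case (Suc n)
  from Suc.prems(1) obtain ls k where ks: "ks = ls @ [k]" "ls \<in> indices n" "1 \<le> k"
    by (rule indices_SucE)
  let ?q = "p + (int k - 1)"
  let ?f = "Ten E k k a b 0 r (Idm E k) f"
  let ?s = "sum_list ls"
  note xk = hom_in_carrier[OF co_iter_unfam_hom[OF ks(3)] Suc.prems(2)]
  note f = Ten_Idm_closed[OF Suc.prems(3), of k]
  have Act: "Act ((coHoch E i ^^ n) \<Psi>) (k + a) (k + b) r ?f ?q (unfam x k)
      \<in> carrier (coHoch_grp n \<Psi> (k + a) (?q + r))"
    by (rule hom_in_carrier[OF co_iterD(3) xk]) (use f in auto)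
  let ?H = "coHoch_comp \<Psi> (k + a) (?q + r) ls"
  let ?v = "Act \<Psi> (?s + (k + a)) (?s + (k + b)) r (Ten E ?s ?s (k + a) (k + b) 0 r (Idm E ?s) ?f)
      (?q + lsum ls) (coord (unfam x k) ls)"
  have v: "?v \<in> carrier ?H"
    by (rule hom_in_carrier[OF contravariantD(3)[OF \<Psi>] co_coord_closed[OF ks(2) xk]])
      (use Ten_Idm_closed[OF f] in auto)
  have "coord (Act ((coHoch E i ^^ Suc n) \<Psi>) a b r f p x) ks =
      coord (Act ((coHoch E i ^^ n) \<Psi>) (k + a) (k + b) r ?f ?q (unfam x k)
        [^]\<^bsub>coHoch_grp n \<Psi> (k + a) (?q + r)\<^esub> ksign (r * (int k - 1))) ls"
    using ks by (simp add: coHoch_def)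
  also have "\<dots> = coord (Act ((coHoch E i ^^ n) \<Psi>) (k + a) (k + b) r ?f ?q (unfam x k)) ls
        [^]\<^bsub>?H\<^esub> ksign (r * (int k - 1))"
    by (rule co_coord_pow[OF ks(2) Act])
  also have "\<dots> = (?v [^]\<^bsub>?H\<^esub> ksign (r * lsum ls)) [^]\<^bsub>?H\<^esub> ksign (r * (int k - 1))"
    by (subst Suc.IH[OF ks(2) xk f]) simp
  also have "\<dots> = ?v [^]\<^bsub>?H\<^esub> ksign (r * lsum ls + r * (int k - 1))"
    by (rule group.pow_ksign_ksign[OF comm_imp_group[OF contravariantD(1)[OF \<Psi>]] v])
  finally show ?case
    unfolding Ten_Idm_Ten_Idm[OF Suc.prems(3)] by (simp add: ks algebra_simps)
qed

lemma coHoch_term_hom: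
  assumes "js \<in> indices n" "t < n" "1 \<le> j" "j < js ! t"
  shows "coHoch_term \<Psi> m p js t j \<in> hom (coHoch_comp \<Psi> m p (js[t := j])) (coHoch_comp \<Psi> m (p - 1) js)"
proof -
  have t: "t < length js"
    using assms by (auto simp: indices_length)
  show ?thesis
    unfolding coHoch_term_def using t assms(3,4)
    by (intro hom_pow contravariantD[OF \<Psi>] whisker_closed_lower) (simp_all add: lsum_update_nth)
qed

lemma coHoch_term_snoc:
  assumes "length ls = n"
  shows "t < n \<Longrightarrow> coHoch_term \<Psi> m p (ls @ [k0]) t k v = coHoch_term \<Psi> (k0 + m) (p + (int k0 - 1)) ls t k v"
    and "coHoch_term \<Psi> m p (ls @ [k0]) n k v =
      Act \<Psi> (sum_list ls + (k0 + m)) (sum_list ls + (k + m)) (int k0 - int k - 1)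
        (whisker E i (sum_list ls) k0 k m) (p + (int k - 1) + lsum ls) v
        [^]\<^bsub>coHoch_comp \<Psi> (k0 + m) (p - 1 + (int k0 - 1)) ls\<^esub>
          ksign (lsum ls * (int k0 - int k))"
  using assms by (simp_all add: coHoch_term_def list_update_append nth_append algebra_simps)

text \<open>The directions \<open>t < n\<close> come from the inner differential and
  \<open>t = n\<close> from the outermost one. The inner differential has the sign of exponent
  \<open>lsum ls\<close>; extracting the same sign from the outermost terms leaves a common factor,
  to which the outermost generator adds its degree k0 - 1.\<close>

lemma co_coord_dif:
  "js \<in> indices n \<Longrightarrow> x \<in> carrier (coHoch_grp n \<Psi> m p) \<Longrightarrow>
    coord (dif (Obj ((coHoch E i ^^ n) \<Psi>) m) p x) js =
    (dif (Obj \<Psi> (sum_list js + m)) (p + lsum js) (coord x js)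
      \<otimes>\<^bsub>coHoch_comp \<Psi> m (p - 1) js\<^esub> inv\<^bsub>coHoch_comp \<Psi> m (p - 1) js\<^esub>
    finprod (coHoch_comp \<Psi> m (p - 1) js) (\<lambda>(t, j). coHoch_term \<Psi> m p js t j (coord x (js[t := j])))
      {(t, j). t < n \<and> 1 \<le> j \<and> j < js ! t}) [^]\<^bsub>coHoch_comp \<Psi> m (p - 1) js\<^esub> ksign (lsum js)"
proof (induction n arbitrary: js m p x)
  case 0
  interpret G: comm_group "grp (Obj \<Psi> m) (p - 1)"
    by (rule contravariantD(1)[OF \<Psi>])
  have "dif (Obj \<Psi> m) p x \<in> carrier (grp (Obj \<Psi> m) (p - 1))"
    using hom_in_carrier[OF contravariantD(2)[OF \<Psi>]] 0 by simp
  with 0 show ?case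
    by (simp add: indices_0 ksign_def)
next
  case (Suc n)
  from Suc.prems(1) obtain ls k0 where ks: "js = ls @ [k0]" "ls \<in> indices n" "1 \<le> k0"
    by (rule indices_SucE)
  have len: "length ls = n"
    using ks(2) by (rule indices_length)
  let ?q = "p + (int k0 - 1)"
  let ?s = "sum_list ls"
  let ?F = "(coHoch E i ^^ n) \<Psi>"
  let ?Gk = "grp (Obj ?F (k0 + m)) (?q - 1)"
  let ?G = "coHoch_comp \<Psi> (k0 + m) (?q - 1) ls"
  interpret G: comm_group ?G
    by (rule contravariantD(1)[OF \<Psi>])
  interpret Gk: comm_group ?Gk
    by (rule co_iterD(1))
  have Geq: "coHoch_comp \<Psi> m (p - 1) js = ?G"
    by (simp add: ks algebra_simps)
  have xk: "unfam x k \<in> carrier (grp (Obj ?F (k + m)) (p + (int k - 1)))" if "1 \<le> k" for k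
    using hom_in_carrier[OF co_iter_unfam_hom[OF that] Suc.prems(2)] .
  let ?f = "\<lambda>k. Ten E k0 k m m (int k0 - int k - 1) 0 (f_img i k0 k) (Idm E m)"
  let ?A = "\<lambda>k. Act ?F (k0 + m) (k + m) (int k0 - int k - 1) (?f k) (p + (int k - 1)) (unfam x k)"
  let ?c = "ksign (lsum ls)"
  have A: "?A k \<in> carrier ?Gk" if "1 \<le> k" "k < k0" for k
    by (rule hom_in_carrier[OF co_iterD(3) xk]) (use that Ten_f_img_closed in auto)
  have D: "dif (Obj ?F (k0 + m)) ?q (unfam x k0) \<in> carrier ?Gk"
    by (rule hom_in_carrier[OF co_iterD(2) xk[OF ks(3)]]) simp
  have trm: "coHoch_term \<Psi> m p js t k (coord x (js[t := k])) \<in> carrier ?G"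
    if "t < Suc n" "1 \<le> k" "k < js ! t" for t k
    using hom_in_carrier[OF coHoch_term_hom[OF Suc.prems(1) that, of m p]
        co_coord_closed[OF indices_update[OF Suc.prems(1)] Suc.prems(2)]] that
    unfolding Geq by simp
  have nth: "js ! n = k0" "\<And>t. t < n \<Longrightarrow> js ! t = ls ! t"
    using len by (simp_all add: ks nth_append)
  have A_term: "coord (?A k) ls = coHoch_term \<Psi> m p js n k (coord x (js[n := k])) [^]\<^bsub>?G\<^esub> ?c"
    if k: "1 \<le> k" "k < k0" for k
  proof -
    let ?v = "Act \<Psi> (?s + (k0 + m)) (?s + (k + m)) (int k0 - int k - 1) (whisker E i ?s k0 k m)
        (p + (int k - 1) + lsum ls) (coord (unfam x k) ls)"
    have w: "whisker E i ?s k0 k m \<in> carrier (grp (Hom E (?s + (k0 + m)) (?s + (k + m))) (int k0 - int k - 1))"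
      using whisker_closed[OF k, of ?s m] by (simp add: add.assoc)
    have v: "?v \<in> carrier ?G"
      by (rule hom_in_carrier[OF contravariantD(3)[OF \<Psi> w] co_coord_closed[OF ks(2) xk[OF k(1)]]]) simp
    have deg: "p + (int k - 1) + (int k0 - int k - 1) = ?q - 1" "p - 1 + (int k0 - 1) = ?q - 1"
      by simp_all
    have "coord (?A k) ls = ?v [^]\<^bsub>?G\<^esub> ksign ((int k0 - int k - 1) * lsum ls)"
      using co_coord_Act[OF ks(2) xk[OF k(1)] Ten_f_img_closed[OF k]]
      unfolding Ten_Idm_f_img[OF k] deg .
    \<comment> \<open>The exponents differ by twice \<open>lsum ls\<close>: for signs, subtracting
      it is the same as adding it.\<close>
    also have "ksign ((int k0 - int k - 1) * lsum ls) = ksign (lsum ls * (int k0 - int k) + lsum ls)"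
      by (rule ksign_cong) (auto simp: algebra_simps)
    also have "?v [^]\<^bsub>?G\<^esub> \<dots> = (?v [^]\<^bsub>?G\<^esub> ksign (lsum ls * (int k0 - int k))) [^]\<^bsub>?G\<^esub> ?c"
      by (rule G.pow_ksign_ksign[OF v, symmetric])
    also have "?v [^]\<^bsub>?G\<^esub> ksign (lsum ls * (int k0 - int k)) = coHoch_term \<Psi> m p js n k (coord x (js[n := k]))"
      unfolding ks(1) coHoch_term_snoc(2)[OF len] deg using len by (simp add: list_update_append)
    finally show ?thesis .
  qed
  let ?T = "\<lambda>(t, k). coHoch_term \<Psi> m p js t k (coord x (js[t := k]))"
  let ?P = "{(t, j). t < Suc n \<and> 1 \<le> j \<and> j < js ! t}"
  let ?P1 = "{(t, j). t < n \<and> 1 \<le> j \<and> j < ls ! t}"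
  have P: "?P = ?P1 \<union> Pair n ` {1..<k0}"
    using nth by (auto simp: less_Suc_eq)
  have "?P1 \<subseteq> Sigma {..<n} (\<lambda>t. {..<ls ! t})"
    by auto
  then have fin: "finite ?P1"
    by (rule finite_subset) auto
  have T: "?T \<in> ?P1 \<rightarrow> carrier ?G" "?T \<in> Pair n ` {1..<k0} \<rightarrow> carrier ?G"
    using trm nth by auto
  have T': "(\<lambda>k. ?T (n, k)) \<in> {1..<k0} \<rightarrow> carrier ?G"
    using trm[of n] nth(1) by auto
  have A': "?A \<in> {1..<k0} \<rightarrow> carrier ?Gk"
    by (intro Pi_I A) auto
  let ?D = "dif (Obj \<Psi> (?s + (k0 + m))) (?q + lsum ls) (coord (unfam x k0) ls)"
  have D': "?D \<in> carrier ?G"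
    by (rule hom_in_carrier[OF contravariantD(2)[OF \<Psi>] co_coord_closed[OF ks(2) xk[OF ks(3)]]]) simp
  have F1: "finprod ?G (\<lambda>(t, k). coHoch_term \<Psi> (k0 + m) ?q ls t k (coord (unfam x k0) (ls[t := k]))) ?P1 =
      finprod ?G ?T ?P1"
  proof (rule G.finprod_cong'[OF refl T(1)])
    fix z assume "z \<in> ?P1"
    then show "(case z of (t, k) \<Rightarrow> coHoch_term \<Psi> (k0 + m) ?q ls t k (coord (unfam x k0) (ls[t := k]))) = ?T z"
      using coHoch_term_snoc(1)[OF len] ks(1) len by (auto simp: list_update_append)
  qed
  have "coord (inv\<^bsub>?Gk\<^esub> finprod ?Gk ?A {1..<k0}) ls = inv\<^bsub>?G\<^esub> finprod ?G (\<lambda>k. coord (?A k) ls) {1..<k0}"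
    using group_hom.hom_inv[OF group_hom.intro[OF Gk.is_group G.is_group group_hom_axioms.intro[OF co_coord_hom[OF ks(2)]]]
      Gk.finprod_closed[OF A']] by (simp only: co_coord_finprod[OF ks(2) A'])
  also have "finprod ?G (\<lambda>k. coord (?A k) ls) {1..<k0} = finprod ?G (\<lambda>k. ?T (n, k) [^]\<^bsub>?G\<^esub> ?c) {1..<k0}"
  proof (rule G.finprod_cong'[OF refl])
    show "(\<lambda>k. ?T (n, k) [^]\<^bsub>?G\<^esub> ?c) \<in> {1..<k0} \<rightarrow> carrier ?G"
      by (intro Pi_I G.int_pow_closed funcset_mem[OF T'])
    show "coord (?A k) ls = ?T (n, k) [^]\<^bsub>?G\<^esub> ?c" if "k \<in> {1..<k0}" for k
      using A_term[of k] that by (simp only: atLeastLessThan_iff prod.case)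
  qed
  also have "\<dots> = finprod ?G (\<lambda>k. ?T (n, k)) {1..<k0} [^]\<^bsub>?G\<^esub> ?c"
    by (rule G.finprod_pow[OF T', symmetric])
  also have "finprod ?G (\<lambda>k. ?T (n, k)) {1..<k0} = finprod ?G ?T (Pair n ` {1..<k0})"
    by (rule G.finprod_reindex[symmetric, OF T(2)]) (simp add: inj_on_def)
  finally have inv: "coord (inv\<^bsub>?Gk\<^esub> finprod ?Gk ?A {1..<k0}) ls =
      inv\<^bsub>?G\<^esub> (finprod ?G ?T (Pair n ` {1..<k0}) [^]\<^bsub>?G\<^esub> ?c)" .
  have "coord (dif (Obj ((coHoch E i ^^ Suc n) \<Psi>) m) p x) js =
      coord ((dif (Obj ?F (k0 + m)) ?q (unfam x k0) \<otimes>\<^bsub>?Gk\<^esub>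
        inv\<^bsub>?Gk\<^esub> finprod ?Gk ?A {1..<k0}) [^]\<^bsub>?Gk\<^esub> ksign (int k0 - 1)) ls"
    using ks by (simp add: coHoch_def Let_def)
  also have "\<dots> = (coord (dif (Obj ?F (k0 + m)) ?q (unfam x k0)) ls \<otimes>\<^bsub>?G\<^esub>
      coord (inv\<^bsub>?Gk\<^esub> finprod ?Gk ?A {1..<k0}) ls) [^]\<^bsub>?G\<^esub> ksign (int k0 - 1)"
    using co_coord_pow[OF ks(2) Gk.m_closed[OF D Gk.inv_closed[OF Gk.finprod_closed[OF A']]]]
    by (simp only: co_coord_mult[OF ks(2) D Gk.inv_closed[OF Gk.finprod_closed[OF A']]])
  also have "coord (dif (Obj ?F (k0 + m)) ?q (unfam x k0)) ls = (?D \<otimes>\<^bsub>?G\<^esub> inv\<^bsub>?G\<^esub> finprod ?G ?T ?P1) [^]\<^bsub>?G\<^esub> ?c"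
    using Suc.IH[OF ks(2) xk[OF ks(3)]] unfolding F1 .
  also have "\<dots> \<otimes>\<^bsub>?G\<^esub> coord (inv\<^bsub>?Gk\<^esub> finprod ?Gk ?A {1..<k0}) ls =
      (?D \<otimes>\<^bsub>?G\<^esub> inv\<^bsub>?G\<^esub> (finprod ?G ?T ?P1 \<otimes>\<^bsub>?G\<^esub> finprod ?G ?T (Pair n ` {1..<k0}))) [^]\<^bsub>?G\<^esub> ?c"
    unfolding inv by (rule G.mult_inv_pow[OF D' G.finprod_closed[OF T(1)] G.finprod_closed[OF T(2)]])
  also have "finprod ?G ?T ?P1 \<otimes>\<^bsub>?G\<^esub> finprod ?G ?T (Pair n ` {1..<k0}) = finprod ?G ?T ?P"
    unfolding P by (rule G.finprod_Un_disjoint[symmetric, OF fin _ _ T]) auto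
  also have "((?D \<otimes>\<^bsub>?G\<^esub> inv\<^bsub>?G\<^esub> finprod ?G ?T ?P) [^]\<^bsub>?G\<^esub> ?c) [^]\<^bsub>?G\<^esub> ksign (int k0 - 1) =
      (?D \<otimes>\<^bsub>?G\<^esub> inv\<^bsub>?G\<^esub> finprod ?G ?T ?P) [^]\<^bsub>?G\<^esub> ksign (lsum ls + (int k0 - 1))"
  proof (rule G.pow_ksign_ksign)
    have "finprod ?G ?T ?P \<in> carrier ?G"
      unfolding P by (intro G.finprod_closed G.funcset_Un_left[THEN iffD2] conjI T)
    then show "?D \<otimes>\<^bsub>?G\<^esub> inv\<^bsub>?G\<^esub> finprod ?G ?T ?P \<in> carrier ?G"
      using D' by (simp only: G.m_closed G.inv_closed)
  qed
  finally show ?case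
    unfolding Geq by (simp add: ks algebra_simps)
qed

end

end


section \<open>The bimodule of operations\<close>

lemma dg_functor_graded:
  assumes "dg_functor E \<Phi>" "Ob E = UNIV"
  shows "graded_covariant E \<Phi>"
  unfolding graded_covariant_def
proof (intro conjI allI ballI)
  fix a b r p f assume "f \<in> carrier (grp (Hom E a b) r)"
  moreover have "chain_pairing (Obj \<Phi> a) (Hom E a b) (Obj \<Phi> b) (\<lambda>q p x f. Act \<Phi> a b p f q x)"
    using assms by (simp add: dg_functor_def)
  ultimately show "Act \<Phi> a b r f p \<in> hom (grp (Obj \<Phi> a) p) (grp (Obj \<Phi> b) (p + r))"
    using chain_pairingD(2) by fastforce
qed (use assms in \<open>simp_all add: dg_functor_def chain_complex_def\<close>)

context A_infinity_prop
begin

text \<open>This puts the representables among the objects of \<open>Fun_cat E\<close>, so that an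
  operation has components there. The types permit it because the morphisms of \<open>E\<close> live
  in the same universe \<open>'a univ\<close> as the values of the functors.\<close>

lemma dg_representable: "dg_functor E (representable E a)"
  unfolding dg_functor_def representable_def
  using Hom_complex Cmp_pairing Cmp_Idm_right Cmp_assoc[symmetric] by (simp add: Ob_UNIV)

lemmas graded_rep = dg_functor_graded[OF dg_representable Ob_UNIV]

lemma representable_simps:
  "Obj (representable E a) = Hom E a"
  "Act (representable E a) c d p f q x = Cmp E a c d q p x f"
  by (simp_all add: representable_def)

definition precomp :: "nat \<Rightarrow> nat \<Rightarrow> int \<Rightarrow> 'a univ \<Rightarrow> nat \<Rightarrow> int \<Rightarrow> 'a univ \<Rightarrow> 'a univ"
  where "precomp a b r f = (\<lambda>c q g. Cmp E a b c r q f g [^]\<^bsub>grp (Hom E a c) (r + q)\<^esub> ksign (r * q))"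

lemma precomp_graded_map:
  "f \<in> carrier (grp (Hom E a b) r) \<Longrightarrow> graded_map (representable E b) (representable E a) r (precomp a b r f)"
  unfolding graded_map_def precomp_def representable_simps add.commute[of r]
  by (intro allI hom_pow Cmp_hom1 comm_group_Hom) simp_all

lemma Hoch_bimodule_simps:
  "Obj (Hoch_bimodule E i n m) a = Obj ((Hoch E i ^^ n) (representable E a)) m"
  "Act (Hoch_bimodule E i n m) a b r f p x =
    Hoch_iter_map E i n (representable E a) r (precomp a b r f) m p x
      [^]\<^bsub>Hoch_grp n (representable E a) m (p + r)\<^esub> ksign (r * p)"
  by (simp_all add: Hoch_bimodule_def precomp_def)

lemma graded_bimodule: "graded_contravariant E (Hoch_bimodule E i n m)"
  unfolding graded_contravariant_def
proof (intro conjI allI ballI)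
  show "comm_group (grp (Obj (Hoch_bimodule E i n m) a) p)"
    "dif (Obj (Hoch_bimodule E i n m) a) p \<in>
      hom (grp (Obj (Hoch_bimodule E i n m) a) p) (grp (Obj (Hoch_bimodule E i n m) a) (p - 1))" for a p
    unfolding Hoch_bimodule_simps by (intro iterD[OF graded_rep] refl)+
  fix a b r p f assume f: "f \<in> carrier (grp (Hom E a b) r)"
  have "(\<lambda>x. Hoch_iter_map E i n (representable E a) r (precomp a b r f) m p x
      [^]\<^bsub>Hoch_grp n (representable E a) m (p + r)\<^esub> ksign (r * p))
    \<in> hom (Hoch_grp n (representable E b) m p)
        (Hoch_grp n (representable E a) m (p + r))"
    by (intro hom_pow iterD[OF graded_rep] refl
      graded_mapD[OF coord_iter_map(1)[OF graded_rep graded_rep precomp_graded_map[OF f]]])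
  then show "Act (Hoch_bimodule E i n m) a b r f p
      \<in> hom (grp (Obj (Hoch_bimodule E i n m) b) p) (grp (Obj (Hoch_bimodule E i n m) a) (p + r))"
    by (simp add: Hoch_bimodule_simps(1) Hoch_bimodule_simps(2)[abs_def])
qed

text \<open>Three signs meet: \<open>r * (p - lsum ks)\<close> from precomposition as a natural
  transformation, \<open>r * lsum ks\<close> from the iterated map and \<open>r * p\<close> from the
  bimodule. Their sum \<open>2 * r * p\<close> is even, and plain precomposition remains.\<close>

lemma coord_Act_bimodule:
  assumes f: "f \<in> carrier (grp (Hom E a b) r)" and ks: "ks \<in> indices n"
    and x: "x \<in> carrier (grp (Obj (Hoch_bimodule E i n m) b) p)"
  shows "coord (Act (Hoch_bimodule E i n m) a b r f p x) ks =
    Cmp E a b (sum_list ks + m) r (p - lsum ks) f (coord x ks)"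
proof -
  note x = x[unfolded Hoch_bimodule_simps]
  note gm = precomp_graded_map[OF f]
  let ?y = "Hoch_iter_map E i n (representable E a) r (precomp a b r f) m p x"
  let ?q = "p - lsum ks"
  let ?c = "Cmp E a b (sum_list ks + m) r ?q f (coord x ks)"
  let ?G = "grp (Hom E a (sum_list ks + m)) (r + ?q)"
  interpret G: comm_group ?G
    by (rule comm_group_Hom)
  have c: "?c \<in> carrier ?G"
    using coord_closed[OF graded_rep ks x] by (intro Cmp_closed f) (simp_all add: representable_simps)
  have y: "?y \<in> carrier (Hoch_grp n (representable E a) m (p + r))"
    using hom_in_carrier[OF graded_mapD[OF coord_iter_map(1)[OF graded_rep graded_rep gm]] x]
    by simp
  have Geq: "Hoch_comp (representable E a) m (p + r) ks = ?G"
    by (simp add: representable_simps algebra_simps)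
  have "coord (Act (Hoch_bimodule E i n m) a b r f p x) ks = coord ?y ks [^]\<^bsub>?G\<^esub> ksign (r * p)"
    unfolding Hoch_bimodule_simps coord_pow[OF graded_rep ks y] Geq ..
  also have "coord ?y ks = (?c [^]\<^bsub>?G\<^esub> ksign (r * ?q)) [^]\<^bsub>?G\<^esub> ksign (r * lsum ks)"
    unfolding coord_iter_map(2)[OF graded_rep graded_rep gm ks x] Geq
    by (simp add: precomp_def)
  also have "\<dots> [^]\<^bsub>?G\<^esub> ksign (r * p) = ?c [^]\<^bsub>?G\<^esub> ksign (r * ?q + r * lsum ks + r * p)"
    using c by (simp only: G.pow_ksign_ksign G.int_pow_closed)
  also have "\<dots> = ?c"
    using c by (intro G.pow_ksign_even) (simp_all add: algebra_simps)
  finally show ?thesis .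
qed

end


section \<open>Natural transformations\<close>

text \<open>Naturality separated from the extensionality built into \<open>nat_trans\<close>, so
  that transformations may be given by formulas; \<open>restrict_nat_trans\<close> recovers elements
  of the complex.\<close>

definition natural ::
  "'a uprop \<Rightarrow> 'a ufun \<Rightarrow> 'a ufun \<Rightarrow> int \<Rightarrow> (nat \<Rightarrow> int \<Rightarrow> 'a univ \<Rightarrow> 'a univ) \<Rightarrow> bool"
  where "natural E \<Phi> \<Psi> r \<beta> \<longleftrightarrow>
    (\<forall>X Y s q. \<forall>f\<in>carrier (grp (Hom E X Y) s). \<forall>x\<in>carrier (grp (Obj \<Phi> X) q).
       \<beta> Y (q + s) (Act \<Phi> X Y s f q x) =
         Act \<Psi> X Y s f (q + r) (\<beta> X q x) [^]\<^bsub>grp (Obj \<Psi> Y) (q + s + r)\<^esub> ksign (s * r))"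

lemma carrier_hom_cx:
  "\<phi> \<in> carrier (grp (hom_cx V W) r) \<longleftrightarrow>
    (\<forall>q. \<phi> q \<in> hom (grp V q) (grp W (q + r)) \<inter> extensional (carrier (grp V q)))"
  by (simp add: hom_cx_def)

lemma carrier_nat_trans:
  "\<alpha> \<in> carrier (grp (nat_trans K F G) p) \<longleftrightarrow>
    \<alpha> \<in> (\<Pi>\<^sub>E X\<in>Ob K. carrier (grp (hom_cx (Obj F X) (Obj G X)) p)) \<and>
    (\<forall>X\<in>Ob K. \<forall>Y\<in>Ob K. \<forall>r q. \<forall>f\<in>carrier (grp (Hom K X Y) r). \<forall>x\<in>carrier (grp (Obj F X) q).
      \<alpha> Y (q + r) (Act F X Y r f q x) =
        Act G X Y r f (q + p) (\<alpha> X q x) [^]\<^bsub>grp (Obj G Y) (q + r + p)\<^esub> ksign (r * p))"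
  by (simp add: nat_trans_def)

context A_infinity_prop
begin

lemma nat_transD:
  assumes "\<beta> \<in> carrier (grp (nat_trans E \<Phi> \<Psi>) r)"
  shows "graded_map \<Phi> \<Psi> r \<beta>" "natural E \<Phi> \<Psi> r \<beta>"
proof -
  show "graded_map \<Phi> \<Psi> r \<beta>"
    using assms unfolding carrier_nat_trans graded_map_def by (simp add: Ob_UNIV PiE_iff carrier_hom_cx)
  show "natural E \<Phi> \<Psi> r \<beta>"
    using assms unfolding carrier_nat_trans natural_def by (simp add: Ob_UNIV)
qed

lemma restrict_nat_trans:
  assumes "graded_map \<Phi> \<Psi> r \<beta>" "natural E \<Phi> \<Psi> r \<beta>" "graded_covariant E \<Phi>"
  shows "(\<lambda>X q. restrict (\<beta> X q) (carrier (grp (Obj \<Phi> X) q))) \<in> carrier (grp (nat_trans E \<Phi> \<Psi>) r)"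
proof -
  have hom: "restrict h (carrier G) \<in> hom G H" if "h \<in> hom G H" "comm_group G"
    for h and G H :: "'a univ monoid"
    using that by (auto simp: hom_def comm_group_def group_def monoid.m_closed Pi_iff)
  show ?thesis
    using assms(1,2) hom[OF _ covariantD(1)[OF assms(3)]] hom_in_carrier[OF covariantD(3)[OF assms(3)]]
    unfolding carrier_nat_trans graded_map_def natural_def
    by (simp add: Ob_UNIV PiE_iff carrier_hom_cx)
qed

text \<open>The iterated map sees \<beta> only through its values at coordinates, which lie in
  carriers. Hence restricting a transformation to carriers does not change its effect.\<close>

lemma Hoch_iter_map_cong:
  assumes \<Phi>: "graded_covariant E \<Phi>" and \<Psi>: "graded_covariant E \<Psi>"
    and "graded_map \<Phi> \<Psi> r \<beta>" "graded_map \<Phi> \<Psi> r \<beta>'"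
    and eq: "\<And>X q x. x \<in> carrier (grp (Obj \<Phi> X) q) \<Longrightarrow> \<beta> X q x = \<beta>' X q x"
    and x: "x \<in> carrier (Hoch_grp n \<Phi> m p)"
  shows "Hoch_iter_map E i n \<Psi> r \<beta> m p x = Hoch_iter_map E i n \<Psi> r \<beta>' m p x"
proof (rule coord_eqI[OF \<Psi>])
  show "Hoch_iter_map E i n \<Psi> r \<beta> m p x \<in> carrier (Hoch_grp n \<Psi> m (p + r))"
    "Hoch_iter_map E i n \<Psi> r \<beta>' m p x \<in> carrier (Hoch_grp n \<Psi> m (p + r))"
    by (rule hom_in_carrier[OF graded_mapD[OF coord_iter_map(1)[OF \<Phi> \<Psi>]] x], fact, simp)+
  show "coord (Hoch_iter_map E i n \<Psi> r \<beta> m p x) ks = coord (Hoch_iter_map E i n \<Psi> r \<beta>' m p x) ks"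
    if "ks \<in> indices n" for ks
    using eq[OF coord_closed[OF \<Phi> that x]] coord_iter_map(2)[OF \<Phi> \<Psi> _ that x] assms(3,4) by simp
qed

text \<open>Associativity gives commutation with postcomposition. The sign of naturality arises
  because postcomposition with \<open>h\<close> raises the degree of \<open>g\<close> by
  \<open>s\<close>, and hence the exponent by \<open>r * s\<close>.\<close>

lemma natural_precomp:
  assumes f: "f \<in> carrier (grp (Hom E a b) r)"
  shows "natural E (representable E b) (representable E a) r (precomp a b r f)"
  unfolding natural_def
proof (intro allI ballI)
  fix X Y s q h g
  assume h: "h \<in> carrier (grp (Hom E X Y) s)" and "g \<in> carrier (grp (Obj (representable E b) X) q)"
  then have g: "g \<in> carrier (grp (Hom E b X) q)"
    by (simp add: representable_simps)
  let ?G = "grp (Hom E a Y) (q + s + r)"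
  interpret G: comm_group ?G
    by (rule comm_group_Hom)
  have deg: "r + (q + s) = q + s + r" "q + r = r + q" "r + q + s = q + s + r"
    by simp_all
  let ?c = "Cmp E a b Y r (q + s) f (Cmp E b X Y q s g h)"
  have c: "?c \<in> carrier ?G"
    by (intro Cmp_closed f g h) simp_all
  have "Cmp E a X Y (r + q) s (Cmp E a b X r q f g [^]\<^bsub>grp (Hom E a X) (r + q)\<^esub> ksign (r * q)) h =
      Cmp E a X Y (r + q) s (Cmp E a b X r q f g) h [^]\<^bsub>?G\<^esub> ksign (r * q)"
    using hom_int_pow[OF Cmp_hom2[OF h, of "q + s + r" "r + q"] Cmp_closed[OF f g refl] group_Hom group_Hom] by simp
  also have "Cmp E a X Y (r + q) s (Cmp E a b X r q f g) h = ?c"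
    using Cmp_assoc[OF _ _ _ _ f g h] by (simp add: Ob_UNIV)
  finally have "Cmp E a X Y (r + q) s (Cmp E a b X r q f g [^]\<^bsub>grp (Hom E a X) (r + q)\<^esub> ksign (r * q)) h
      [^]\<^bsub>?G\<^esub> ksign (s * r) = ?c [^]\<^bsub>?G\<^esub> ksign (r * q + s * r)"
    by (simp add: G.pow_ksign_ksign[OF c])
  then show "precomp a b r f Y (q + s) (Act (representable E b) X Y s h q g) =
      Act (representable E a) X Y s h (q + r) (precomp a b r f X q g)
        [^]\<^bsub>grp (Obj (representable E a) Y) (q + s + r)\<^esub> ksign (s * r)"
    unfolding precomp_def representable_simps deg by (simp add: algebra_simps)
qed

text \<open>
  The transformation \<open>E(a, -) \<rightarrow> \<Phi>\<close> of degree \<open>|x|\<close> which sends the identity to \<open>x\<close>.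
\<close>

definition yoneda :: "'a ufun \<Rightarrow> nat \<Rightarrow> int \<Rightarrow> 'a univ \<Rightarrow> nat \<Rightarrow> int \<Rightarrow> 'a univ \<Rightarrow> 'a univ"
  where "yoneda \<Phi> a s x = (\<lambda>c q h. Act \<Phi> a c q h s x [^]\<^bsub>grp (Obj \<Phi> c) (s + q)\<^esub> ksign (q * s))"

context
  fixes \<Phi> :: "'a ufun"
  assumes \<Phi>: "dg_functor E \<Phi>"
begin

lemmas graded = dg_functor_graded[OF \<Phi> Ob_UNIV]

lemma Act_hom1:
  assumes "x \<in> carrier (grp (Obj \<Phi> a) q)" "s = q + p"
  shows "(\<lambda>f. Act \<Phi> a b p f q x) \<in> hom (grp (Hom E a b) p) (grp (Obj \<Phi> b) s)"
proof -
  have "chain_pairing (Obj \<Phi> a) (Hom E a b) (Obj \<Phi> b) (\<lambda>q p x f. Act \<Phi> a b p f q x)"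
    using \<Phi> by (simp add: dg_functor_def Ob_UNIV)
  from chain_pairingD(1)[OF this assms(1)] show ?thesis
    using assms(2) by simp
qed

lemma Act_Cmp:
  assumes "f \<in> carrier (grp (Hom E a b) p)" "g \<in> carrier (grp (Hom E b c) r)" "x \<in> carrier (grp (Obj \<Phi> a) q)"
  shows "Act \<Phi> a c (p + r) (Cmp E a b c p r f g) q x = Act \<Phi> b c r g (q + p) (Act \<Phi> a b p f q x)"
  using \<Phi> assms by (simp add: dg_functor_def Ob_UNIV)

lemma Act_Idm: "x \<in> carrier (grp (Obj \<Phi> a) q) \<Longrightarrow> Act \<Phi> a a 0 (Idm E a) q x = x"
  using \<Phi> by (simp add: dg_functor_def Ob_UNIV)

lemma yoneda_graded_map:
  assumes "x \<in> carrier (grp (Obj \<Phi> a) s)"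
  shows "graded_map (representable E a) \<Phi> s (yoneda \<Phi> a s x)"
  unfolding graded_map_def yoneda_def representable_simps add.commute[of s]
  by (intro allI hom_pow Act_hom1 covariantD[OF graded] assms) simp

text \<open>Functoriality identifies the two values; the exponent \<open>(q + t) * s\<close> splits
  into \<open>q * s\<close> and the \<open>t * s\<close> required by naturality.\<close>

lemma natural_yoneda:
  assumes x: "x \<in> carrier (grp (Obj \<Phi> a) s)"
  shows "natural E (representable E a) \<Phi> s (yoneda \<Phi> a s x)"
  unfolding natural_def
proof (intro allI ballI)
  fix X Y t q f h
  assume f: "f \<in> carrier (grp (Hom E X Y) t)" and "h \<in> carrier (grp (Obj (representable E a) X) q)"
  then have h: "h \<in> carrier (grp (Hom E a X) q)"
    by (simp add: representable_simps)
  let ?G = "grp (Obj \<Phi> Y) (q + t + s)"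
  interpret G: comm_group ?G
    by (rule covariantD(1)[OF graded])
  have deg: "s + (q + t) = q + t + s" "q + s = s + q"
    by simp_all
  let ?c = "Act \<Phi> X Y t f (s + q) (Act \<Phi> a X q h s x)"
  have hx: "Act \<Phi> a X q h s x \<in> carrier (grp (Obj \<Phi> X) (s + q))"
    by (rule hom_in_carrier[OF Act_hom1[OF x refl] h])
  have hom: "Act \<Phi> X Y t f (s + q) \<in> hom (grp (Obj \<Phi> X) (s + q)) ?G"
    by (rule covariantD(3)[OF graded f]) simp
  have "Act \<Phi> X Y t f (s + q) (Act \<Phi> a X q h s x [^]\<^bsub>grp (Obj \<Phi> X) (s + q)\<^esub> ksign (q * s)) =
      ?c [^]\<^bsub>?G\<^esub> ksign (q * s)"
    by (rule hom_int_pow[OF hom hx]) (intro comm_imp_group covariantD(1)[OF graded])+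
  then show "yoneda \<Phi> a s x Y (q + t) (Act (representable E a) X Y t f q h) =
      Act \<Phi> X Y t f (q + s) (yoneda \<Phi> a s x X q h) [^]\<^bsub>?G\<^esub> ksign (t * s)"
    unfolding yoneda_def representable_simps deg Act_Cmp[OF h f x]
    by (simp only: G.pow_ksign_ksign[OF hom_in_carrier[OF hom hx]]) (simp add: algebra_simps)
qed

end


section \<open>Elements concentrated in one component\<close>

text \<open>The element \<open>v \<otimes> l\<close> with \<open>l\<close> the string of generators
  indexed by \<open>js\<close>. It is specified by its coordinates, which determine it, rather than
  by a nested sequence.\<close>

definition single :: "'a ufun \<Rightarrow> nat \<Rightarrow> nat \<Rightarrow> nat list \<Rightarrow> int \<Rightarrow> 'a univ \<Rightarrow> 'a univ"
  where "single \<Phi> n m js q v = (SOME x. x \<in> carrier (Hoch_grp n \<Phi> m (q + lsum js)) \<and>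
    (\<forall>ks\<in>indices n. coord x ks = (if ks = js then v else \<one>\<^bsub>Hoch_comp \<Phi> m (q + lsum js) ks\<^esub>)))"

lemma
  assumes \<Phi>: "graded_covariant E \<Phi>" and js: "js \<in> indices n" and v: "v \<in> carrier (grp (Obj \<Phi> (sum_list js + m)) q)"
  shows single_closed: "s = q + lsum js \<Longrightarrow> single \<Phi> n m js q v \<in> carrier (Hoch_grp n \<Phi> m s)"
    and coord_single: "ks \<in> indices n \<Longrightarrow> coord (single \<Phi> n m js q v) ks =
      (if ks = js then v else \<one>\<^bsub>Hoch_comp \<Phi> m (q + lsum js) ks\<^esub>)"
proof -
  let ?y = "\<lambda>ks. if ks = js then v else \<one>\<^bsub>Hoch_comp \<Phi> m (q + lsum js) ks\<^esub>"
  have "\<exists>x\<in>carrier (Hoch_grp n \<Phi> m (q + lsum js)). \<forall>ks\<in>indices n. coord x ks = ?y ks"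
  proof (rule coord_surj[OF \<Phi>])
    show "?y ks \<in> carrier (Hoch_comp \<Phi> m (q + lsum js) ks)" for ks
      using v monoid.one_closed[OF group.is_monoid[OF comm_imp_group[OF covariantD(1)[OF \<Phi>]]]] by simp
    show "finite {ks \<in> indices n. ?y ks \<noteq> \<one>\<^bsub>Hoch_comp \<Phi> m (q + lsum js) ks\<^esub>}"
      by (rule finite_subset[of _ "{js}"]) auto
  qed
  then have "single \<Phi> n m js q v \<in> carrier (Hoch_grp n \<Phi> m (q + lsum js)) \<and>
      (\<forall>ks\<in>indices n. coord (single \<Phi> n m js q v) ks = ?y ks)"
    unfolding single_def by (rule someI2_bex) blast
  then show "s = q + lsum js \<Longrightarrow> single \<Phi> n m js q v \<in> carrier (Hoch_grp n \<Phi> m s)"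
    "ks \<in> indices n \<Longrightarrow> coord (single \<Phi> n m js q v) ks = ?y ks"
    by auto
qed

text \<open>At an index \<open>ks\<close> every summand but that of \<open>ks\<close> has the unit
  as coordinate; if \<open>ks\<close> lies outside the support, \<open>x\<close> has the unit there
  as well.\<close>

lemma finprod_single_coord:
  assumes \<Phi>: "graded_covariant E \<Phi>" and x: "x \<in> carrier (Hoch_grp n \<Phi> m q)"
  shows "x = finprod (Hoch_grp n \<Phi> m q) (\<lambda>js. single \<Phi> n m js (q - lsum js) (coord x js))
    {js \<in> indices n. coord x js \<noteq> \<one>\<^bsub>Hoch_comp \<Phi> m q js\<^esub>}" (is "_ = finprod ?K ?f ?S")
proof (rule coord_eqI[OF \<Phi> x])
  interpret K: comm_group ?K
    by (rule iterD(1)[OF \<Phi>])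
  have v: "coord x js \<in> carrier (grp (Obj \<Phi> (sum_list js + m)) (q - lsum js))" if "js \<in> indices n" for js
    by (rule coord_closed[OF \<Phi> that x])
  have f: "?f \<in> ?S \<rightarrow> carrier ?K"
    using single_closed[OF \<Phi> _ v] by auto
  then show "finprod ?K ?f ?S \<in> carrier ?K"
    by (rule K.finprod_closed)
  fix ks assume ks: "ks \<in> indices n"
  interpret G: comm_group "Hoch_comp \<Phi> m q ks"
    by (rule covariantD(1)[OF \<Phi>])
  have c: "coord (?f js) ks = (if ks = js then coord x js else \<one>\<^bsub>Hoch_comp \<Phi> m q ks\<^esub>)" if "js \<in> indices n" for js
    using coord_single[OF \<Phi> that v[OF that] ks] by simp
  have "coord (finprod ?K ?f ?S) ks = finprod (Hoch_comp \<Phi> m q ks) (\<lambda>js. coord (?f js) ks) ?S"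
    by (rule coord_finprod[OF \<Phi> ks f])
  also have "\<dots> = coord (?f ks) ks"
  proof (rule G.finprod_single[OF coord_finite[OF \<Phi> x]])
    show "coord (?f ks) ks \<in> carrier (Hoch_comp \<Phi> m q ks)"
      unfolding c[OF ks] using v[OF ks] by simp
    show "coord (?f js) ks = \<one>\<^bsub>Hoch_comp \<Phi> m q ks\<^esub>" if "js \<in> ?S" "js \<noteq> ks" for js
      using c[of js] that by simp
    show "coord (?f ks) ks = \<one>\<^bsub>Hoch_comp \<Phi> m q ks\<^esub>" if "ks \<notin> ?S"
      unfolding c[OF ks] using that ks by simp
  qed
  finally show "coord x ks = coord (finprod ?K ?f ?S) ks"
    using c[OF ks] by simp
qed

end


section \<open>Families of operations\<close>

locale operation_complexes = A_infinity_prop E i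
  for E :: "'a uprop" and i :: "'a mult_map" +
  fixes n1 m1 n2 m2 :: nat
begin

text \<open>The common last step of both isomorphisms: \<open>h\<close> is \<open>coord x\<close>
  for an element of the iterated coHochschild construction, and \<open>evaluate \<alpha>\<close> for
  an operation. The restricted abstractions fix the values outside the index sets, as the product
  and sum groups demand.\<close>

definition operations :: "(nat list \<Rightarrow> 'a univ) \<Rightarrow> nat list \<Rightarrow> nat list \<Rightarrow> 'a univ"
  where "operations h = (\<lambda>js\<in>indices n1. \<lambda>ks\<in>indices n2. coord (h js) ks)"

abbreviation (input) bim :: "'a ufun"
  where "bim \<equiv> Hoch_bimodule E i n2 m2"

abbreviation Rep :: "nat list \<Rightarrow> 'a ufun"
  where "Rep js \<equiv> representable E (sum_list js + m1)"

abbreviation src :: "'a ufun \<Rightarrow> int \<Rightarrow> 'a univ monoid"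
  where "src \<Phi> q \<equiv> Hoch_grp n1 \<Phi> m1 q"

abbreviation tgt :: "'a ufun \<Rightarrow> int \<Rightarrow> 'a univ monoid"
  where "tgt \<Phi> q \<equiv> Hoch_grp n2 \<Phi> m2 q"

abbreviation op_cx :: "(nat list \<Rightarrow> nat list \<Rightarrow> 'a univ) dgmod"
  where "op_cx \<equiv> formal_op_cx E i (n1, m1) (n2, m2)"

lemma op_group_eq:
  "op_group E m1 m2 js ks p = Hoch_comp (Rep js) m2 (p + lsum js) ks"
  by (simp add: op_group_def representable_simps op_degree_eq)

lemma comm_group_op_group: "comm_group (op_group E m1 m2 js ks p)"
  by (simp add: op_group_def comm_group_Hom)

lemma carrier_sum_op_group:
  "carrier (sum_group (indices n2) (\<lambda>ks. op_group E m1 m2 js ks p)) =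
    {x \<in> \<Pi>\<^sub>E ks\<in>indices n2. carrier (op_group E m1 m2 js ks p).
      finite {ks \<in> indices n2. x ks \<noteq> \<one>\<^bsub>op_group E m1 m2 js ks p\<^esub>}}"
  by (rule carrier_sum_group) (rule comm_imp_group[OF comm_group_op_group])

lemma grp_op_cx:
  "grp op_cx p = product_group (indices n1) (\<lambda>js. sum_group (indices n2) (\<lambda>ks. op_group E m1 m2 js ks p))"
  by (simp add: formal_op_cx_def)

lemma operations_closed:
  assumes "\<And>js. js \<in> indices n1 \<Longrightarrow> h js \<in> carrier (coHoch_comp bim m1 p js)"
  shows "operations h \<in> carrier (grp op_cx p)"
  unfolding grp_op_cx carrier_product_group operations_def
proof (rule restrict_PiE_iff[THEN iffD2], rule ballI)
  fix js assume "js \<in> indices n1"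
  then have h: "h js \<in> carrier (Hoch_grp n2 (Rep js) m2 (p + lsum js))"
    using assms by (simp add: Hoch_bimodule_simps)
  have "{ks \<in> indices n2. (\<lambda>ks\<in>indices n2. coord (h js) ks) ks \<noteq> \<one>\<^bsub>op_group E m1 m2 js ks p\<^esub>} =
      {ks \<in> indices n2. coord (h js) ks \<noteq> \<one>\<^bsub>op_group E m1 m2 js ks p\<^esub>}"
    by auto
  then show "(\<lambda>ks\<in>indices n2. coord (h js) ks) \<in> carrier (sum_group (indices n2) (\<lambda>ks. op_group E m1 m2 js ks p))"
    using coord_closed[OF graded_rep _ h] coord_finite[OF graded_rep h]
    unfolding carrier_sum_op_group by (simp add: op_group_eq)
qed

lemma operations_mult:
  assumes "\<And>js. js \<in> indices n1 \<Longrightarrow> h js \<in> carrier (coHoch_comp bim m1 p js)"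
    and "\<And>js. js \<in> indices n1 \<Longrightarrow> h' js \<in> carrier (coHoch_comp bim m1 p js)"
    and "\<And>js. js \<in> indices n1 \<Longrightarrow> h'' js = h js \<otimes>\<^bsub>coHoch_comp bim m1 p js\<^esub> h' js"
  shows "operations h'' = operations h \<otimes>\<^bsub>grp op_cx p\<^esub> operations h'"
  unfolding grp_op_cx operations_def
  using assms coord_mult[OF graded_rep]
  by (auto simp: Hoch_bimodule_simps op_group_eq intro!: restrict_ext)

lemma operations_eqD:
  assumes "\<And>js. js \<in> indices n1 \<Longrightarrow> h js \<in> carrier (coHoch_comp bim m1 p js)"
    and "\<And>js. js \<in> indices n1 \<Longrightarrow> h' js \<in> carrier (coHoch_comp bim m1 p js)"
    and "operations h = operations h'" and js: "js \<in> indices n1"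
  shows "h js = h' js"
proof (rule coord_eqI[OF graded_rep])
  show "h js \<in> carrier (Hoch_grp n2 (Rep js) m2 (p + lsum js))"
    "h' js \<in> carrier (Hoch_grp n2 (Rep js) m2 (p + lsum js))"
    using assms(1,2)[OF js] by (simp_all add: Hoch_bimodule_simps)
  show "coord (h js) ks = coord (h' js) ks" if "ks \<in> indices n2" for ks
    using fun_cong[OF fun_cong[OF assms(3)], of js ks] js that by (simp add: operations_def)
qed

lemma operations_surj:
  assumes g: "g \<in> carrier (grp op_cx p)"
  shows "\<exists>h. (\<forall>js\<in>indices n1. h js \<in> carrier (coHoch_comp bim m1 p js)) \<and> operations h = g"
proof -
  have "\<exists>x\<in>carrier (coHoch_comp bim m1 p js). \<forall>ks\<in>indices n2. coord x ks = g js ks" if js: "js \<in> indices n1" for js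
  proof -
    have "g js \<in> carrier (sum_group (indices n2) (\<lambda>ks. op_group E m1 m2 js ks p))"
      using g js unfolding grp_op_cx by auto
    then show ?thesis
      unfolding carrier_sum_op_group Hoch_bimodule_simps
      by (intro coord_surj[OF graded_rep]) (auto simp: op_group_eq)
  qed
  then obtain h where h: "\<And>js. js \<in> indices n1 \<Longrightarrow> h js \<in> carrier (coHoch_comp bim m1 p js)"
      "\<And>js ks. js \<in> indices n1 \<Longrightarrow> ks \<in> indices n2 \<Longrightarrow> coord (h js) ks = g js ks"
    by metis
  have "operations h = g"
  proof
    fix js
    show "operations h js = g js"
    proof (cases "js \<in> indices n1")
      case True
      then have "g js \<in> carrier (sum_group (indices n2) (\<lambda>ks. op_group E m1 m2 js ks p))"
        using g unfolding grp_op_cx by auto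
      then have "g js \<in> extensional (indices n2)"
        unfolding carrier_sum_op_group by (auto simp: PiE_iff)
      with True h(2) show ?thesis
        by (auto simp: operations_def extensional_def fun_eq_iff)
    next
      case False
      with g show ?thesis
        unfolding grp_op_cx by (auto simp: operations_def PiE_iff extensional_def)
    qed
  qed
  with h(1) show ?thesis
    by blast
qed

lemma finite_lower_updates: "finite {(t, j). t < n \<and> 1 \<le> j \<and> j < js ! t}" for n :: nat and js :: "nat list"
proof (rule finite_subset)
  show "{(t, j). t < n \<and> 1 \<le> j \<and> j < js ! t} \<subseteq> Sigma {..<n} (\<lambda>t. {..<js ! t})"
    by auto
qed auto

lemma coHoch_term_bim_closed:
  assumes "\<And>js. js \<in> indices n1 \<Longrightarrow> h js \<in> carrier (coHoch_comp bim m1 p js)"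
    and "js \<in> indices n1" "t < n1" "1 \<le> j" "j < js ! t"
  shows "coHoch_term bim m1 p js t j (h (js[t := j])) \<in> carrier (coHoch_comp bim m1 (p - 1) js)"
  using assms by (intro hom_in_carrier[OF coHoch_term_hom[OF graded_bimodule]] assms(1) indices_update)

text \<open>The formula for \<open>h'\<close> is the one obtained both from
  \<open>co_coord_dif\<close> and from \<open>evaluate_dif\<close>, so the differential of
  \<open>formal_op_cx\<close> is matched only once. The internal differential of the bimodule yields
  that of \<open>E\<close> and \<open>op_Hoch\<close>; the action terms yield
  \<open>op_coHoch\<close>, since \<open>coord_Act_bimodule\<close> introduces no sign.\<close>

lemma operations_dif:
  assumes h: "\<And>js. js \<in> indices n1 \<Longrightarrow> h js \<in> carrier (coHoch_comp bim m1 p js)"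
    and h': "\<And>js. js \<in> indices n1 \<Longrightarrow> h' js =
      (dif (Obj bim (sum_list js + m1)) (p + lsum js) (h js)
        \<otimes>\<^bsub>coHoch_comp bim m1 (p - 1) js\<^esub> inv\<^bsub>coHoch_comp bim m1 (p - 1) js\<^esub>
      finprod (coHoch_comp bim m1 (p - 1) js) (\<lambda>(t, j). coHoch_term bim m1 p js t j (h (js[t := j])))
        {(t, j). t < n1 \<and> 1 \<le> j \<and> j < js ! t}) [^]\<^bsub>coHoch_comp bim m1 (p - 1) js\<^esub> ksign (lsum js)"
  shows "operations h' = dif op_cx p (operations h)"
proof -
  have "coord (h' js) ks =
      (dif (Hom E (sum_list js + m1) (sum_list ks + m2)) (op_degree js ks p) (operations h js ks)
           \<otimes>\<^bsub>op_group E m1 m2 js ks (p - 1)\<^esub> op_Hoch E i m1 m2 p (operations h) js ks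
           \<otimes>\<^bsub>op_group E m1 m2 js ks (p - 1)\<^esub> inv\<^bsub>op_group E m1 m2 js ks (p - 1)\<^esub>
         op_coHoch E i m1 m2 p (operations h) js ks)
        [^]\<^bsub>op_group E m1 m2 js ks (p - 1)\<^esub> ksign (l_degree n1 js)"
    if js: "js \<in> indices n1" and ks: "ks \<in> indices n2" for js ks
  proof -
    let ?a = "sum_list js + m1"
    let ?K = "coHoch_comp bim m1 (p - 1) js"
    let ?G = "op_group E m1 m2 js ks (p - 1)"
    let ?P = "{(t, j). t < n1 \<and> 1 \<le> j \<and> j < js ! t}"
    let ?T = "\<lambda>(t, j). coHoch_term bim m1 p js t j (h (js[t := j]))"
    let ?D = "dif (Obj bim ?a) (p + lsum js) (h js)"
    interpret K: comm_group ?K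
      by (rule contravariantD(1)[OF graded_bimodule])
    interpret G: comm_group ?G
      by (rule comm_group_op_group)
    have len: "length js = n1" "length ks = n2"
      using js ks by (simp_all add: indices_length)
    have Kc: "(\<lambda>x. coord x ks) \<in> hom ?K ?G"
      using coord_hom[OF graded_rep ks, of ?a m2 "p - 1 + lsum js"]
      by (simp add: Hoch_bimodule_simps op_group_eq)
    have T: "?T \<in> ?P \<rightarrow> carrier ?K"
      using coHoch_term_bim_closed[OF h js] by auto
    have D: "?D \<in> carrier ?K"
      by (rule hom_in_carrier[OF contravariantD(2)[OF graded_bimodule] h[OF js]]) simp
    have hjs: "h js \<in> carrier (Hoch_grp n2 (representable E ?a) m2 (p + lsum js))"
      using h[OF js] by (simp add: Hoch_bimodule_simps)
    have deg: "p + lsum js - 1 = p - 1 + lsum js"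
      by simp
    have ops: "operations h ls ms = coord (h ls) ms" if "ls \<in> indices n1" "ms \<in> indices n2" for ls ms
      using that by (simp add: operations_def)
    have Dc: "coord ?D ks = dif (Hom E ?a (sum_list ks + m2)) (op_degree js ks p) (operations h js ks)
        \<otimes>\<^bsub>?G\<^esub> op_Hoch E i m1 m2 p (operations h) js ks"
    proof -
      let ?\<Phi> = "representable E ?a"
      let ?S = "{(t, k). t < n2 \<and> ks ! t < k \<and> coord (h js) (ks[t := k]) \<noteq> \<one>\<^bsub>Hoch_comp ?\<Phi> m2 (p + lsum js) (ks[t := k])\<^esub>}"
      have upd: "ks[t := k] \<in> indices n2" if "ks ! t < k" for t k
        using ks that by (simp add: indices_update)
      have S: "?S = {(t, k). t < length ks \<and> ks ! t < k \<and>
           operations h js (ks[t := k]) \<noteq> \<one>\<^bsub>op_group E m1 m2 js (ks[t := k]) p\<^esub>}"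
        using ops[OF js upd] by (auto simp: len op_group_eq)
      have cl: "Hoch_term ?\<Phi> m2 (p + lsum js) ks t k (coord (h js) (ks[t := k])) \<in> carrier ?G"
        if "t < n2" "ks ! t < k" for t k
        using hom_in_carrier[OF Hoch_term_hom[OF graded_rep ks that] coord_closed[OF graded_rep upd[OF that(2)] hjs]]
        by (simp add: op_group_eq deg)
      have "op_Hoch E i m1 m2 p (operations h) js ks =
          finprod ?G (\<lambda>(t, k). Hoch_term ?\<Phi> m2 (p + lsum js) ks t k (coord (h js) (ks[t := k]))) ?S"
        unfolding op_Hoch_def Let_def
      proof (rule G.finprod_cong'[OF S[symmetric]])
        show "(\<lambda>(t, k). Hoch_term ?\<Phi> m2 (p + lsum js) ks t k (coord (h js) (ks[t := k]))) \<in> ?S \<rightarrow> carrier ?G"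
          using cl by auto
      qed (use ops[OF js upd] in \<open>auto simp: Hoch_term_def representable_simps op_degree_eq l_degree_eq op_group_eq deg\<close>)
      then show ?thesis
        using coord_dif[OF graded_rep ks hjs] ops[OF js ks]
        by (simp add: Hoch_bimodule_simps representable_simps op_degree_eq op_group_eq deg)
    qed
    have Tc: "coord (finprod ?K ?T ?P) ks = op_coHoch E i m1 m2 p (operations h) js ks"
    proof -
      have *: "coord (?T (t, j)) ks =
          Cmp E ?a (sum_list (js[t := j]) + m1) (sum_list ks + m2)
              (int (js ! t) - int j - 1) (op_degree (js[t := j]) ks p)
              (whisker E i (sum_list (take t js)) (js ! t) j (sum_list (drop (Suc t) js) + m1))
              (operations h (js[t := j]) ks)
            [^]\<^bsub>?G\<^esub> ksign (l_degree t js * (int (js ! t) - int j))"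
        if tj: "(t, j) \<in> ?P" for t j
      proof -
        have t: "t < length js" "1 \<le> j" "j < js ! t"
          using tj len by auto
        let ?w = "whisker E i (sum_list (take t js)) (js ! t) j (sum_list (drop (Suc t) js) + m1)"
        have w: "?w \<in> carrier (grp (Hom E ?a (sum_list (js[t := j]) + m1)) (int (js ! t) - int j - 1))"
          using whisker_closed_lower[OF t] .
        have js': "js[t := j] \<in> indices n1"
          using js t(2) by (rule indices_update)
        let ?A = "Act bim ?a (sum_list (js[t := j]) + m1) (int (js ! t) - int j - 1) ?w
            (p + lsum (js[t := j])) (h (js[t := j]))"
        have A: "?A \<in> carrier ?K"
          by (rule hom_in_carrier[OF contravariantD(3)[OF graded_bimodule w] h[OF js']])
            (simp add: lsum_update_nth[OF t(1)])
        have "coord (?T (t, j)) ks = coord ?A ks [^]\<^bsub>?G\<^esub> ksign (l_degree t js * (int (js ! t) - int j))"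
          using hom_int_pow[OF Kc A K.is_group G.is_group] by (simp add: coHoch_term_def l_degree_eq)
        also have "coord ?A ks = Cmp E ?a (sum_list (js[t := j]) + m1) (sum_list ks + m2)
            (int (js ! t) - int j - 1) (p + lsum (js[t := j]) - lsum ks) ?w (coord (h (js[t := j])) ks)"
          by (rule coord_Act_bimodule[OF w ks h[OF js']])
        finally show ?thesis
          by (simp only: ops[OF js' ks] op_degree_eq)
      qed
      have "coord (finprod ?K ?T ?P) ks = finprod ?G (\<lambda>z. coord (?T z) ks) ?P"
        by (rule hom_finprod[OF Kc K.comm_group_axioms G.comm_group_axioms T])
      also have "\<dots> = op_coHoch E i m1 m2 p (operations h) js ks"
        unfolding op_coHoch_def Let_def len
      proof (rule G.finprod_cong'[OF refl, symmetric])
        show "(\<lambda>z. coord (?T z) ks) \<in> ?P \<rightarrow> carrier ?G"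
          using hom_in_carrier[OF Kc] T by blast
      qed (use * in auto)
      finally show ?thesis .
    qed
    have fin: "finprod ?K ?T ?P \<in> carrier ?K"
      by (rule K.finprod_closed[OF T])
    have "coord (h' js) ks = (coord ?D ks \<otimes>\<^bsub>?G\<^esub> inv\<^bsub>?G\<^esub> coord (finprod ?K ?T ?P) ks) [^]\<^bsub>?G\<^esub> ksign (lsum js)"
      unfolding h'[OF js]
      using hom_int_pow[OF Kc K.m_closed[OF D K.inv_closed[OF fin]] K.is_group G.is_group]
        hom_mult[OF Kc D K.inv_closed[OF fin]]
        group_hom.hom_inv[OF group_hom.intro[OF K.is_group G.is_group group_hom_axioms.intro[OF Kc]] fin]
      by (simp only:)
    then show ?thesis
      unfolding Dc Tc using len by (simp add: l_degree_eq)
  qed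
  then show ?thesis
    unfolding formal_op_cx_def Let_def by (auto simp: operations_def[of h'] intro!: restrict_ext)
qed

text \<open>Reading off the indices \<open>js\<close> leaves an element of the bimodule, whose
  coordinates at \<open>ks\<close> are taken next. Injectivity and surjectivity are those of the two
  stages composed.\<close>

lemma coordinates_chain_iso:
  "coordinates n1 n2 \<in> chain_iso (coHoch_Hoch_cx E i (n1, m1) (n2, m2)) op_cx"
proof -
  let ?V = "Obj ((coHoch E i ^^ n1) bim) m1"
  have V: "coHoch_Hoch_cx E i (n1, m1) (n2, m2) = ?V"
    by (simp add: coHoch_Hoch_cx_def)
  have c: "coordinates n1 n2 p x = operations (coord x)" for p x
    by (simp add: coordinates_def operations_def coord_def)
  note cl = co_coord_closed[OF graded_bimodule]
  have "coordinates n1 n2 p \<in> iso (grp ?V p) (grp op_cx p)" for p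
    unfolding iso_def
  proof (intro CollectI conjI homI)
    show "coordinates n1 n2 p x \<in> carrier (grp op_cx p)" if "x \<in> carrier (grp ?V p)" for x
      unfolding c using cl[OF _ that] by (rule operations_closed)
    show "coordinates n1 n2 p (x \<otimes>\<^bsub>grp ?V p\<^esub> y) = coordinates n1 n2 p x \<otimes>\<^bsub>grp op_cx p\<^esub> coordinates n1 n2 p y"
      if "x \<in> carrier (grp ?V p)" "y \<in> carrier (grp ?V p)" for x y
      unfolding c using cl that co_coord_mult[OF graded_bimodule] by (intro operations_mult)
    show "bij_betw (coordinates n1 n2 p) (carrier (grp ?V p)) (carrier (grp op_cx p))"
    proof (rule bij_betwI')
      show "(coordinates n1 n2 p x = coordinates n1 n2 p y) = (x = y)"
        if "x \<in> carrier (grp ?V p)" "y \<in> carrier (grp ?V p)" for x y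
        unfolding c using operations_eqD[of "coord x" p "coord y"] cl that
          co_coord_eqI[OF graded_bimodule that] by metis
      show "coordinates n1 n2 p x \<in> carrier (grp op_cx p)" if "x \<in> carrier (grp ?V p)" for x
        unfolding c using cl[OF _ that] by (rule operations_closed)
      fix g assume "g \<in> carrier (grp op_cx p)"
      then obtain h where h: "\<And>js. js \<in> indices n1 \<Longrightarrow> h js \<in> carrier (coHoch_comp bim m1 p js)"
          "operations h = g"
        using operations_surj by blast
      from co_coord_surj[OF graded_bimodule h(1)] obtain x where
        "x \<in> carrier (grp ?V p)" "\<forall>js\<in>indices n1. coord x js = h js"
        by blast
      moreover from this have "operations (coord x) = operations h"
        by (auto simp: operations_def intro!: restrict_ext)
      ultimately show "\<exists>x\<in>carrier (grp ?V p). g = coordinates n1 n2 p x"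
        unfolding c using h(2) by metis
    qed
  qed
  moreover have "coordinates n1 n2 (p - 1) (dif ?V p x) = dif op_cx p (coordinates n1 n2 p x)"
    if "x \<in> carrier (grp ?V p)" for p x
    unfolding c using cl[OF _ that] co_coord_dif[OF graded_bimodule _ that] by (rule operations_dif)
  ultimately show ?thesis
    unfolding V chain_iso_def by blast
qed

section \<open>Natural operations and their values on generators\<close>

abbreviation Nat_ops :: "('a ufun \<Rightarrow> int \<Rightarrow> 'a univ \<Rightarrow> 'a univ) dgmod"
  where "Nat_ops \<equiv> Nat_cx E i (n1, m1) (n2, m2)"

lemma carrier_Nat:
  "\<alpha> \<in> carrier (grp Nat_ops p) \<longleftrightarrow>
    \<alpha> \<in> extensional {\<Phi>. dg_functor E \<Phi>} \<and>
    (\<forall>\<Phi> q. dg_functor E \<Phi> \<longrightarrow> \<alpha> \<Phi> q \<in> hom (src \<Phi> q) (tgt \<Phi> (q + p)) \<inter> extensional (carrier (src \<Phi> q))) \<and>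
    (\<forall>\<Phi> \<Psi> r q \<beta> x. dg_functor E \<Phi> \<longrightarrow> dg_functor E \<Psi> \<longrightarrow> \<beta> \<in> carrier (grp (nat_trans E \<Phi> \<Psi>) r) \<longrightarrow>
      x \<in> carrier (src \<Phi> q) \<longrightarrow>
      \<alpha> \<Psi> (q + r) (Hoch_iter_map E i n1 \<Psi> r \<beta> m1 q x) =
        Hoch_iter_map E i n2 \<Psi> r \<beta> m2 (q + p) (\<alpha> \<Phi> q x) [^]\<^bsub>tgt \<Psi> (q + r + p)\<^esub> ksign (r * p))"
  unfolding Nat_cx_def
  by (subst carrier_nat_trans) (auto simp: Fun_cat_def Hoch_fun_def PiE_iff carrier_hom_cx)

text \<open>Members of \<open>Nat_ops\<close> are tested against extensional transformations. A
  given \<beta> is replaced by its restriction to carriers, which induces the same iterated maps on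
  the elements in question.\<close>

lemma
  assumes \<alpha>: "\<alpha> \<in> carrier (grp Nat_ops p)"
  shows Nat_hom: "dg_functor E \<Phi> \<Longrightarrow> s = q + p \<Longrightarrow> \<alpha> \<Phi> q \<in> hom (src \<Phi> q) (tgt \<Phi> s)"
    and Nat_natural: "dg_functor E \<Phi> \<Longrightarrow> dg_functor E \<Psi> \<Longrightarrow> graded_map \<Phi> \<Psi> r \<beta> \<Longrightarrow> natural E \<Phi> \<Psi> r \<beta> \<Longrightarrow>
      x \<in> carrier (src \<Phi> q) \<Longrightarrow> s = q + r \<Longrightarrow>
      \<alpha> \<Psi> s (Hoch_iter_map E i n1 \<Psi> r \<beta> m1 q x) =
        Hoch_iter_map E i n2 \<Psi> r \<beta> m2 (q + p) (\<alpha> \<Phi> q x) [^]\<^bsub>tgt \<Psi> (s + p)\<^esub> ksign (r * p)"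
proof -
  show hom: "dg_functor E \<Phi> \<Longrightarrow> s = q + p \<Longrightarrow> \<alpha> \<Phi> q \<in> hom (src \<Phi> q) (tgt \<Phi> s)" for q s
    using \<alpha> unfolding carrier_Nat by blast
  assume \<Phi>: "dg_functor E \<Phi>" and \<Psi>: "dg_functor E \<Psi>" and gm: "graded_map \<Phi> \<Psi> r \<beta>"
    and nat: "natural E \<Phi> \<Psi> r \<beta>" and x: "x \<in> carrier (src \<Phi> q)" and s: "s = q + r"
  note g\<Phi> = dg_functor_graded[OF \<Phi> Ob_UNIV] and g\<Psi> = dg_functor_graded[OF \<Psi> Ob_UNIV]
  let ?\<beta> = "\<lambda>X q. restrict (\<beta> X q) (carrier (grp (Obj \<Phi> X) q))"
  have \<beta>: "?\<beta> \<in> carrier (grp (nat_trans E \<Phi> \<Psi>) r)"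
    by (rule restrict_nat_trans[OF gm nat g\<Phi>])
  note cong = Hoch_iter_map_cong[OF g\<Phi> g\<Psi> gm nat_transD(1)[OF \<beta>]]
  have ax: "\<alpha> \<Phi> q x \<in> carrier (tgt \<Phi> (q + p))"
    by (rule hom_in_carrier[OF hom[OF \<Phi> refl] x])
  have "\<alpha> \<Psi> (q + r) (Hoch_iter_map E i n1 \<Psi> r ?\<beta> m1 q x) =
        Hoch_iter_map E i n2 \<Psi> r ?\<beta> m2 (q + p) (\<alpha> \<Phi> q x) [^]\<^bsub>tgt \<Psi> (q + r + p)\<^esub> ksign (r * p)"
    using \<alpha> \<Phi> \<Psi> \<beta> x unfolding carrier_Nat by blast
  then show "\<alpha> \<Psi> s (Hoch_iter_map E i n1 \<Psi> r \<beta> m1 q x) =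
        Hoch_iter_map E i n2 \<Psi> r \<beta> m2 (q + p) (\<alpha> \<Phi> q x) [^]\<^bsub>tgt \<Psi> (s + p)\<^esub> ksign (r * p)"
    using cong[OF _ x] cong[OF _ ax] s by simp
qed

text \<open>The universal element \<open>id \<otimes> l\<close>, of degree
  \<open>lsum js\<close>.\<close>

definition gen :: "nat list \<Rightarrow> 'a univ"
  where "gen js = single (Rep js) n1 m1 js 0 (Idm E (sum_list js + m1))"

lemma
  assumes js: "js \<in> indices n1"
  shows gen_closed: "gen js \<in> carrier (src (Rep js) (lsum js))"
    and coord_gen: "ks \<in> indices n1 \<Longrightarrow> coord (gen js) ks =
      (if ks = js then Idm E (sum_list js + m1)
       else \<one>\<^bsub>Hoch_comp (Rep js) m1 (lsum js) ks\<^esub>)"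
proof -
  have *: "Idm E (sum_list js + m1) \<in> carrier (grp (Obj (Rep js) (sum_list js + m1)) 0)"
    using Idm_in by (simp add: representable_simps)
  show "gen js \<in> carrier (src (Rep js) (lsum js))"
    unfolding gen_def by (rule single_closed[OF graded_rep js *]) simp
  show "ks \<in> indices n1 \<Longrightarrow> coord (gen js) ks =
      (if ks = js then Idm E (sum_list js + m1)
       else \<one>\<^bsub>Hoch_comp (Rep js) m1 (lsum js) ks\<^esub>)"
    unfolding gen_def using coord_single[OF graded_rep js *] by simp
qed

definition evaluate :: "('a ufun \<Rightarrow> int \<Rightarrow> 'a univ \<Rightarrow> 'a univ) \<Rightarrow> nat list \<Rightarrow> 'a univ"
  where "evaluate \<alpha> js = \<alpha> (Rep js) (lsum js) (gen js)"

lemma evaluate_closed: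
  assumes "\<alpha> \<in> carrier (grp Nat_ops p)" "js \<in> indices n1"
  shows "evaluate \<alpha> js \<in> carrier (coHoch_comp bim m1 p js)"
  unfolding evaluate_def Hoch_bimodule_simps
  by (rule hom_in_carrier[OF Nat_hom[OF assms(1) dg_representable] gen_closed[OF assms(2)]]) simp

text \<open>The Yoneda transformation of \<open>v\<close> sends the identity, of degree 0, to
  \<open>v\<close> without a sign. The iterated map adds the sign for passing the generators, and
  the extra power on the left cancels it; at the other indices units go to units.\<close>

lemma Hoch_iter_map_yoneda_gen:
  assumes \<Phi>: "dg_functor E \<Phi>" and js: "js \<in> indices n1"
    and v: "v \<in> carrier (grp (Obj \<Phi> (sum_list js + m1)) s)" and q: "q = s + lsum js"
  shows "Hoch_iter_map E i n1 \<Phi> s (yoneda \<Phi> (sum_list js + m1) s v) m1 (lsum js) (gen js)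
      [^]\<^bsub>src \<Phi> q\<^esub> ksign (s * lsum js) = single \<Phi> n1 m1 js s v"
proof -
  let ?a = "sum_list js + m1"
  let ?y = "yoneda \<Phi> ?a s v"
  let ?h = "Hoch_iter_map E i n1 \<Phi> s ?y m1 (lsum js) (gen js)"
  note g\<Phi> = dg_functor_graded[OF \<Phi> Ob_UNIV]
  note gm = yoneda_graded_map[OF \<Phi> v]
  interpret S: comm_group "src \<Phi> q"
    by (rule iterD(1)[OF g\<Phi>])
  have h: "?h \<in> carrier (src \<Phi> q)"
    by (rule hom_in_carrier[OF graded_mapD[OF coord_iter_map(1)[OF graded_rep g\<Phi> gm]] gen_closed[OF js]])
      (simp add: q)
  show ?thesis
  proof (rule coord_eqI[OF g\<Phi>])
    show "?h [^]\<^bsub>src \<Phi> q\<^esub> ksign (s * lsum js) \<in> carrier (src \<Phi> q)"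
      by (rule S.int_pow_closed[OF h])
    show "single \<Phi> n1 m1 js s v \<in> carrier (src \<Phi> q)"
      by (rule single_closed[OF g\<Phi> js v q])
    fix ks assume ks: "ks \<in> indices n1"
    let ?G = "Hoch_comp \<Phi> m1 q ks"
    interpret G: comm_group ?G
      by (rule covariantD(1)[OF g\<Phi>])
    have deg: "lsum js + s = q" "s + (lsum js - lsum ks) = q - lsum ks"
      using q by simp_all
    have c: "coord (?h [^]\<^bsub>src \<Phi> q\<^esub> ksign (s * lsum js)) ks =
        (?y (sum_list ks + m1) (lsum js - lsum ks) (coord (gen js) ks) [^]\<^bsub>?G\<^esub> ksign (s * lsum ks))
          [^]\<^bsub>?G\<^esub> ksign (s * lsum js)"
      unfolding coord_pow[OF g\<Phi> ks h] coord_iter_map(2)[OF graded_rep g\<Phi> gm ks gen_closed[OF js]] deg ..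
    show "coord (?h [^]\<^bsub>src \<Phi> q\<^esub> ksign (s * lsum js)) ks = coord (single \<Phi> n1 m1 js s v) ks"
    proof (cases "ks = js")
      case True
      have y: "?y ?a 0 (Idm E ?a) = v"
        using group.int_pow_1[OF comm_imp_group[OF covariantD(1)[OF g\<Phi>]] v]
        by (simp add: yoneda_def Act_Idm[OF \<Phi> v] ksign_def)
      have "v \<in> carrier ?G"
        using v True q by simp
      then have "(v [^]\<^bsub>?G\<^esub> ksign (s * lsum js)) [^]\<^bsub>?G\<^esub> ksign (s * lsum js) = v"
        by (simp only: G.pow_ksign_ksign) (rule G.pow_ksign_even, simp_all)
      then show ?thesis
        unfolding c coord_gen[OF js ks] coord_single[OF g\<Phi> js v ks] using True y by simp
    next
      case False
      have "?y (sum_list ks + m1) (lsum js - lsum ks) \<one>\<^bsub>Hoch_comp (representable E ?a) m1 (lsum js) ks\<^esub> = \<one>\<^bsub>?G\<^esub>"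
        by (rule hom_one[OF graded_mapD[OF gm]])
          (use q comm_imp_group[OF covariantD(1)[OF graded_rep]] G.is_group in auto)
      with False show ?thesis
        unfolding c coord_gen[OF js ks] coord_single[OF g\<Phi> js v ks] by (simp only: if_False G.int_pow_one q[symmetric])
    qed
  qed
qed

text \<open>
  By naturality along the Yoneda transformations, an operation acts on \<open>x \<otimes> l\<close> by its value at
  \<open>id \<otimes> l\<close>; all signs cancel.
\<close>

lemma coord_Nat:
  assumes \<alpha>: "\<alpha> \<in> carrier (grp Nat_ops p)" and \<Phi>: "dg_functor E \<Phi>"
    and x: "x \<in> carrier (src \<Phi> q)" and ks: "ks \<in> indices n2"
  shows "coord (\<alpha> \<Phi> q x) ks =
    finprod (Hoch_comp \<Phi> m2 (q + p) ks)
      (\<lambda>js. Act \<Phi> (sum_list js + m1) (sum_list ks + m2) (op_degree js ks p)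
        (operations (evaluate \<alpha>) js ks) (q - lsum js) (coord x js))
      {js \<in> indices n1. coord x js \<noteq> \<one>\<^bsub>Hoch_comp \<Phi> m1 q js\<^esub>}"
proof -
  note g\<Phi> = dg_functor_graded[OF \<Phi> Ob_UNIV]
  let ?S = "{js \<in> indices n1. coord x js \<noteq> \<one>\<^bsub>Hoch_comp \<Phi> m1 q js\<^esub>}"
  let ?G = "Hoch_comp \<Phi> m2 (q + p) ks"
  interpret G: comm_group ?G
    by (rule covariantD(1)[OF g\<Phi>])
  interpret T: comm_group "tgt \<Phi> (q + p)"
    by (rule iterD(1)[OF g\<Phi>])
  interpret S: comm_group "src \<Phi> q"
    by (rule iterD(1)[OF g\<Phi>])
  let ?A = "\<lambda>js. Act \<Phi> (sum_list js + m1) (sum_list ks + m2) (op_degree js ks p)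
        (operations (evaluate \<alpha>) js ks) (q - lsum js) (coord x js)"
  let ?f = "\<lambda>js. single \<Phi> n1 m1 js (q - lsum js) (coord x js)"
  have v: "coord x js \<in> carrier (grp (Obj \<Phi> (sum_list js + m1)) (q - lsum js))" if "js \<in> indices n1" for js
    by (rule coord_closed[OF g\<Phi> that x])
  have f: "?f \<in> ?S \<rightarrow> carrier (src \<Phi> q)"
    using single_closed[OF g\<Phi> _ v] by auto
  have hom: "(\<lambda>z. coord (\<alpha> \<Phi> q z) ks) \<in> hom (src \<Phi> q) ?G"
    using hom_compose[OF Nat_hom[OF \<alpha> \<Phi> refl] coord_hom[OF g\<Phi> ks]] by (simp add: o_def)
  have one: "coord (\<alpha> \<Phi> q (?f js)) ks = ?A js \<and> ?A js \<in> carrier ?G" if js: "js \<in> indices n1" for js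
  proof -
    let ?s = "q - lsum js" and ?a = "sum_list js + m1"
    let ?R = "representable E ?a" and ?y = "yoneda \<Phi> ?a ?s (coord x js)"
    let ?h = "Hoch_iter_map E i n1 \<Phi> ?s ?y m1 (lsum js) (gen js)"
    let ?e = "evaluate \<alpha> js"
    note gm = yoneda_graded_map[OF \<Phi> v[OF js]]
    have q: "q = ?s + lsum js" "q = lsum js + ?s"
      by simp_all
    have h: "?h \<in> carrier (src \<Phi> q)"
      by (rule hom_in_carrier[OF graded_mapD[OF coord_iter_map(1)[OF graded_rep g\<Phi> gm]] gen_closed[OF js]]) simp
    have e: "?e \<in> carrier (tgt ?R (lsum js + p))"
      using evaluate_closed[OF \<alpha> js] by (simp add: Hoch_bimodule_simps add.commute)
    let ?k = "Hoch_iter_map E i n2 \<Phi> ?s ?y m2 (lsum js + p) ?e"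
    have k: "?k \<in> carrier (tgt \<Phi> (q + p))"
      by (rule hom_in_carrier[OF graded_mapD[OF coord_iter_map(1)[OF graded_rep g\<Phi> gm]] e]) simp
    have "\<alpha> \<Phi> q (?f js) = \<alpha> \<Phi> q ?h [^]\<^bsub>tgt \<Phi> (q + p)\<^esub> ksign (?s * lsum js)"
      unfolding Hoch_iter_map_yoneda_gen[OF \<Phi> js v[OF js] q(1), symmetric]
      by (rule hom_int_pow[OF Nat_hom[OF \<alpha> \<Phi> refl] h S.is_group T.is_group])
    also have "\<alpha> \<Phi> q ?h = ?k [^]\<^bsub>tgt \<Phi> (q + p)\<^esub> ksign (?s * p)"
      using Nat_natural[OF \<alpha> dg_representable \<Phi> gm natural_yoneda[OF \<Phi> v[OF js]] gen_closed[OF js] q(2)]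
      by (simp add: evaluate_def)
    also have "\<dots> [^]\<^bsub>tgt \<Phi> (q + p)\<^esub> ksign (?s * lsum js) = ?k [^]\<^bsub>tgt \<Phi> (q + p)\<^esub> ksign (?s * p + ?s * lsum js)"
      by (rule T.pow_ksign_ksign[OF k])
    finally have 1: "coord (\<alpha> \<Phi> q (?f js)) ks = coord ?k ks [^]\<^bsub>?G\<^esub> ksign (?s * p + ?s * lsum js)"
      by (simp only: coord_pow[OF g\<Phi> ks k])
    have ops: "operations (evaluate \<alpha>) js ks = coord ?e ks"
      using js ks by (simp add: operations_def)
    have ce: "coord ?e ks \<in> carrier (grp (Hom E ?a (sum_list ks + m2)) (op_degree js ks p))"
      using coord_closed[OF graded_rep ks e] by (simp add: representable_simps op_degree_eq add.commute)
    have A: "?A js \<in> carrier ?G"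
      unfolding ops by (rule hom_in_carrier[OF Act_hom1[OF \<Phi> v[OF js]] ce]) (simp add: op_degree_eq)
    have deg: "lsum js + p - lsum ks = op_degree js ks p" "lsum js + p + ?s = q + p"
      "?s + op_degree js ks p = q + p - lsum ks"
      by (simp_all add: op_degree_eq)
    have 2: "coord ?k ks = (?A js [^]\<^bsub>?G\<^esub> ksign (op_degree js ks p * ?s)) [^]\<^bsub>?G\<^esub> ksign (?s * lsum ks)"
      unfolding coord_iter_map(2)[OF graded_rep g\<Phi> gm ks e] deg ops
      unfolding yoneda_def deg ..
    have "coord (\<alpha> \<Phi> q (?f js)) ks =
        ?A js [^]\<^bsub>?G\<^esub> ksign (op_degree js ks p * ?s + ?s * lsum ks + (?s * p + ?s * lsum js))"
      unfolding 1 2 using A by (simp only: G.pow_ksign_ksign G.int_pow_closed)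
    \<comment> \<open>By the formula for \<open>op_degree\<close> the exponent equals
      \<open>2 * ?s * (p + lsum js)\<close>.\<close>
    also have "\<dots> = ?A js"
      by (rule G.pow_ksign_even[OF A]) (simp add: op_degree_eq algebra_simps)
    finally show ?thesis
      using A by simp
  qed
  have "coord (\<alpha> \<Phi> q x) ks = coord (\<alpha> \<Phi> q (finprod (src \<Phi> q) ?f ?S)) ks"
    using finprod_single_coord[OF g\<Phi> x] by simp
  also have "\<dots> = finprod ?G (\<lambda>js. coord (\<alpha> \<Phi> q (?f js)) ks) ?S"
    by (rule hom_finprod[OF hom S.comm_group_axioms G.comm_group_axioms f])
  also have "\<dots> = finprod ?G ?A ?S"
    using one by (intro G.finprod_cong') auto
  finally show ?thesis .
qed

section \<open>The operation defined by a family of components\<close>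

abbreviation supp :: "'a ufun \<Rightarrow> int \<Rightarrow> 'a univ \<Rightarrow> nat list set"
  where "supp \<Phi> q x \<equiv> {js \<in> indices n1. coord x js \<noteq> \<one>\<^bsub>Hoch_comp \<Phi> m1 q js\<^esub>}"

definition op_summand :: "int \<Rightarrow> (nat list \<Rightarrow> nat list \<Rightarrow> 'a univ) \<Rightarrow> 'a ufun \<Rightarrow> int \<Rightarrow> nat list \<Rightarrow> nat list \<Rightarrow> 'a univ \<Rightarrow> 'a univ"
  where "op_summand p g \<Phi> q ks js v =
    Act \<Phi> (sum_list js + m1) (sum_list ks + m2) (op_degree js ks p) (g js ks) (q - lsum js) v"

definition act_coord :: "int \<Rightarrow> (nat list \<Rightarrow> nat list \<Rightarrow> 'a univ) \<Rightarrow> 'a ufun \<Rightarrow> int \<Rightarrow> nat list \<Rightarrow> 'a univ \<Rightarrow> 'a univ"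
  where "act_coord p g \<Phi> q ks x =
    finprod (Hoch_comp \<Phi> m2 (q + p) ks) (\<lambda>js. op_summand p g \<Phi> q ks js (coord x js)) (supp \<Phi> q x)"

text \<open>Chosen through its coordinates, which are realised by \<open>coord_surj\<close>. They
  are the sums that \<open>coord_Nat\<close> forces on any operation with the components
  \<open>g\<close>.\<close>

definition op_action :: "int \<Rightarrow> (nat list \<Rightarrow> nat list \<Rightarrow> 'a univ) \<Rightarrow> 'a ufun \<Rightarrow> int \<Rightarrow> 'a univ \<Rightarrow> 'a univ"
  where "op_action p g \<Phi> q x =
    (SOME z. z \<in> carrier (tgt \<Phi> (q + p)) \<and> (\<forall>ks\<in>indices n2. coord z ks = act_coord p g \<Phi> q ks x))"

context
  fixes p :: int and g :: "nat list \<Rightarrow> nat list \<Rightarrow> 'a univ"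
  assumes g: "g \<in> carrier (grp op_cx p)"
begin

lemma g_closed:
  assumes "js \<in> indices n1" "ks \<in> indices n2"
  shows "g js ks \<in> carrier (grp (Hom E (sum_list js + m1) (sum_list ks + m2)) (op_degree js ks p))"
proof -
  have "g js \<in> carrier (sum_group (indices n2) (\<lambda>ks. op_group E m1 m2 js ks p))"
    using g assms(1) unfolding grp_op_cx by auto
  then show ?thesis
    using assms(2) unfolding carrier_sum_op_group by (auto simp: op_group_def)
qed

lemma g_finite:
  assumes "js \<in> indices n1"
  shows "finite {ks \<in> indices n2. g js ks \<noteq> \<one>\<^bsub>grp (Hom E (sum_list js + m1) (sum_list ks + m2)) (op_degree js ks p)\<^esub>}"
proof -
  have "g js \<in> carrier (sum_group (indices n2) (\<lambda>ks. op_group E m1 m2 js ks p))"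
    using g assms(1) unfolding grp_op_cx by auto
  then show ?thesis
    unfolding carrier_sum_op_group by (auto simp: op_group_def)
qed

context
  fixes \<Phi> :: "'a ufun"
  assumes \<Phi>: "dg_functor E \<Phi>"
begin

lemmas g\<Phi> = dg_functor_graded[OF \<Phi> Ob_UNIV]

lemma op_summand_hom:
  assumes "js \<in> indices n1" "ks \<in> indices n2"
  shows "op_summand p g \<Phi> q ks js \<in> hom (Hoch_comp \<Phi> m1 q js) (Hoch_comp \<Phi> m2 (q + p) ks)"
  unfolding op_summand_def
  by (rule covariantD(3)[OF g\<Phi> g_closed[OF assms]]) (simp add: op_degree_eq)

lemma op_summand_one:
  assumes "js \<in> indices n1" "ks \<in> indices n2"
  shows "op_summand p g \<Phi> q ks js \<one>\<^bsub>Hoch_comp \<Phi> m1 q js\<^esub> = \<one>\<^bsub>Hoch_comp \<Phi> m2 (q + p) ks\<^esub>"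
  by (rule hom_one[OF op_summand_hom[OF assms]]) (intro comm_imp_group covariantD(1)[OF g\<Phi>])+

lemma op_summand_closed:
  assumes "x \<in> carrier (src \<Phi> q)" "js \<in> indices n1" "ks \<in> indices n2"
  shows "op_summand p g \<Phi> q ks js (coord x js) \<in> carrier (Hoch_comp \<Phi> m2 (q + p) ks)"
  by (rule hom_in_carrier[OF op_summand_hom[OF assms(2,3)] coord_closed[OF g\<Phi> assms(2,1)]])

text \<open>Sums for different elements can be compared only over a common finite set; indices
  outside the support contribute values of homomorphisms at units.\<close>

lemma act_coord_superset:
  assumes x: "x \<in> carrier (src \<Phi> q)" and ks: "ks \<in> indices n2"
    and S: "finite S" "supp \<Phi> q x \<subseteq> S" "S \<subseteq> indices n1"
  shows "act_coord p g \<Phi> q ks x =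
    finprod (Hoch_comp \<Phi> m2 (q + p) ks) (\<lambda>js. op_summand p g \<Phi> q ks js (coord x js)) S"
proof -
  interpret G: comm_group "Hoch_comp \<Phi> m2 (q + p) ks"
    by (rule covariantD(1)[OF g\<Phi>])
  show ?thesis
    unfolding act_coord_def
  proof (rule G.finprod_mono_neutral_cong_left[OF S(1,2)])
    show "op_summand p g \<Phi> q ks js (coord x js) = \<one>\<^bsub>Hoch_comp \<Phi> m2 (q + p) ks\<^esub>"
      if js: "js \<in> S - supp \<Phi> q x" for js
    proof -
      have "js \<in> indices n1" "coord x js = \<one>\<^bsub>Hoch_comp \<Phi> m1 q js\<^esub>"
        using js S(3) by auto
      then show ?thesis
        using op_summand_one[OF _ ks] by simp
    qed
    show "(\<lambda>js. op_summand p g \<Phi> q ks js (coord x js)) \<in> S \<rightarrow> carrier (Hoch_comp \<Phi> m2 (q + p) ks)"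
      using op_summand_closed[OF x _ ks] S(3) by auto
  qed simp
qed

lemma act_coord_closed:
  assumes "x \<in> carrier (src \<Phi> q)" "ks \<in> indices n2"
  shows "act_coord p g \<Phi> q ks x \<in> carrier (Hoch_comp \<Phi> m2 (q + p) ks)"
proof -
  interpret G: comm_group "Hoch_comp \<Phi> m2 (q + p) ks"
    by (rule covariantD(1)[OF g\<Phi>])
  show ?thesis
    unfolding act_coord_def using op_summand_closed[OF assms(1) _ assms(2)] by (intro G.finprod_closed) auto
qed

text \<open>A nontrivial coordinate at \<open>ks\<close> requires \<open>g js ks\<close> to be
  nontrivial for some \<open>js\<close> in the support of \<open>x\<close>, so the support is
  contained in a finite union of finite sets.\<close>

lemma act_coord_finite:
  assumes x: "x \<in> carrier (src \<Phi> q)"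
  shows "finite {ks \<in> indices n2. act_coord p g \<Phi> q ks x \<noteq> \<one>\<^bsub>Hoch_comp \<Phi> m2 (q + p) ks\<^esub>}"
proof -
  let ?N = "\<lambda>js. {ks \<in> indices n2. g js ks \<noteq> \<one>\<^bsub>grp (Hom E (sum_list js + m1) (sum_list ks + m2)) (op_degree js ks p)\<^esub>}"
  have "{ks \<in> indices n2. act_coord p g \<Phi> q ks x \<noteq> \<one>\<^bsub>Hoch_comp \<Phi> m2 (q + p) ks\<^esub>} \<subseteq> (\<Union>js\<in>supp \<Phi> q x. ?N js)"
  proof clarify
    fix ks assume ks: "ks \<in> indices n2" and ne: "act_coord p g \<Phi> q ks x \<noteq> \<one>\<^bsub>Hoch_comp \<Phi> m2 (q + p) ks\<^esub>"
    interpret G: comm_group "Hoch_comp \<Phi> m2 (q + p) ks"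
      by (rule covariantD(1)[OF g\<Phi>])
    show "ks \<in> (\<Union>js\<in>supp \<Phi> q x. ?N js)"
    proof (rule ccontr)
      assume none: "ks \<notin> (\<Union>js\<in>supp \<Phi> q x. ?N js)"
      have "op_summand p g \<Phi> q ks js (coord x js) = \<one>\<^bsub>Hoch_comp \<Phi> m2 (q + p) ks\<^esub>" if js: "js \<in> supp \<Phi> q x" for js
      proof -
        have g1: "g js ks = \<one>\<^bsub>grp (Hom E (sum_list js + m1) (sum_list ks + m2)) (op_degree js ks p)\<^esub>"
          using none js ks by blast
        have js': "js \<in> indices n1"
          using js by simp
        have "(\<lambda>f. Act \<Phi> (sum_list js + m1) (sum_list ks + m2) (op_degree js ks p) f (q - lsum js) (coord x js))
            \<in> hom (grp (Hom E (sum_list js + m1) (sum_list ks + m2)) (op_degree js ks p)) (Hoch_comp \<Phi> m2 (q + p) ks)"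
          by (rule Act_hom1[OF \<Phi> coord_closed[OF g\<Phi> js' x]]) (simp add: op_degree_eq)
        from hom_one[OF this group_Hom G.is_group] show ?thesis
          unfolding op_summand_def g1 .
      qed
      then have "act_coord p g \<Phi> q ks x = \<one>\<^bsub>Hoch_comp \<Phi> m2 (q + p) ks\<^esub>"
        unfolding act_coord_def by (rule G.finprod_one_eqI)
      with ne show False ..
    qed
  qed
  moreover have "finite (\<Union>js\<in>supp \<Phi> q x. ?N js)"
    using g_finite by (intro finite_UN_I coord_finite[OF g\<Phi> x]) auto
  ultimately show ?thesis
    by (rule finite_subset)
qed

lemma
  assumes x: "x \<in> carrier (src \<Phi> q)"
  shows op_action_closed: "op_action p g \<Phi> q x \<in> carrier (tgt \<Phi> (q + p))"
    and coord_op_action: "ks \<in> indices n2 \<Longrightarrow> coord (op_action p g \<Phi> q x) ks = act_coord p g \<Phi> q ks x"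
proof -
  have "\<exists>z\<in>carrier (tgt \<Phi> (q + p)). \<forall>ks\<in>indices n2. coord z ks = act_coord p g \<Phi> q ks x"
    using act_coord_closed[OF x] act_coord_finite[OF x] by (rule coord_surj[OF g\<Phi>])
  then have "op_action p g \<Phi> q x \<in> carrier (tgt \<Phi> (q + p)) \<and>
      (\<forall>ks\<in>indices n2. coord (op_action p g \<Phi> q x) ks = act_coord p g \<Phi> q ks x)"
    unfolding op_action_def by (rule someI2_bex) blast
  then show "op_action p g \<Phi> q x \<in> carrier (tgt \<Phi> (q + p))"
    "ks \<in> indices n2 \<Longrightarrow> coord (op_action p g \<Phi> q x) ks = act_coord p g \<Phi> q ks x"
    by auto
qed

lemma op_action_hom: "op_action p g \<Phi> q \<in> hom (src \<Phi> q) (tgt \<Phi> (q + p))"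
proof (rule homI)
  show "op_action p g \<Phi> q x \<in> carrier (tgt \<Phi> (q + p))" if "x \<in> carrier (src \<Phi> q)" for x
    by (rule op_action_closed[OF that])
  fix x y assume x: "x \<in> carrier (src \<Phi> q)" and y: "y \<in> carrier (src \<Phi> q)"
  interpret S: comm_group "src \<Phi> q"
    by (rule iterD(1)[OF g\<Phi>])
  interpret T: comm_group "tgt \<Phi> (q + p)"
    by (rule iterD(1)[OF g\<Phi>])
  let ?xy = "x \<otimes>\<^bsub>src \<Phi> q\<^esub> y"
  have xy: "?xy \<in> carrier (src \<Phi> q)"
    by (rule S.m_closed[OF x y])
  show "op_action p g \<Phi> q ?xy = op_action p g \<Phi> q x \<otimes>\<^bsub>tgt \<Phi> (q + p)\<^esub> op_action p g \<Phi> q y"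
  proof (rule coord_eqI[OF g\<Phi> op_action_closed[OF xy] T.m_closed[OF op_action_closed[OF x] op_action_closed[OF y]]])
    fix ks assume ks: "ks \<in> indices n2"
    let ?G = "Hoch_comp \<Phi> m2 (q + p) ks"
    interpret G: comm_group ?G
      by (rule covariantD(1)[OF g\<Phi>])
    define S where "S = supp \<Phi> q x \<union> supp \<Phi> q y \<union> supp \<Phi> q ?xy"
    have S: "finite S" "S \<subseteq> indices n1"
      using coord_finite[OF g\<Phi> x] coord_finite[OF g\<Phi> y] coord_finite[OF g\<Phi> xy] by (auto simp: S_def)
    have sub: "supp \<Phi> q x \<subseteq> S" "supp \<Phi> q y \<subseteq> S" "supp \<Phi> q ?xy \<subseteq> S"
      unfolding S_def by blast+
    have cx: "(\<lambda>js. op_summand p g \<Phi> q ks js (coord x js)) \<in> S \<rightarrow> carrier ?G"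
      and cy: "(\<lambda>js. op_summand p g \<Phi> q ks js (coord y js)) \<in> S \<rightarrow> carrier ?G"
      using op_summand_closed[OF x _ ks] op_summand_closed[OF y _ ks] S(2) by auto
    have "act_coord p g \<Phi> q ks ?xy = finprod ?G (\<lambda>js. op_summand p g \<Phi> q ks js (coord ?xy js)) S"
      by (rule act_coord_superset[OF xy ks S(1) sub(3) S(2)])
    also have "\<dots> = finprod ?G (\<lambda>js. op_summand p g \<Phi> q ks js (coord x js) \<otimes>\<^bsub>?G\<^esub> op_summand p g \<Phi> q ks js (coord y js)) S"
    proof (rule G.finprod_cong'[OF refl])
      show "(\<lambda>js. op_summand p g \<Phi> q ks js (coord x js) \<otimes>\<^bsub>?G\<^esub> op_summand p g \<Phi> q ks js (coord y js)) \<in> S \<rightarrow> carrier ?G"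
        using cx cy by (auto simp: Pi_iff)
      fix js assume "js \<in> S"
      then have js: "js \<in> indices n1"
        using S(2) by blast
      show "op_summand p g \<Phi> q ks js (coord ?xy js) =
          op_summand p g \<Phi> q ks js (coord x js) \<otimes>\<^bsub>?G\<^esub> op_summand p g \<Phi> q ks js (coord y js)"
        unfolding coord_mult[OF g\<Phi> js x y]
        by (rule hom_mult[OF op_summand_hom[OF js ks] coord_closed[OF g\<Phi> js x] coord_closed[OF g\<Phi> js y]])
    qed
    also have "\<dots> = act_coord p g \<Phi> q ks x \<otimes>\<^bsub>?G\<^esub> act_coord p g \<Phi> q ks y"
      unfolding act_coord_superset[OF x ks S(1) sub(1) S(2)] act_coord_superset[OF y ks S(1) sub(2) S(2)]
      by (rule G.finprod_multf[OF cx cy])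
    finally show "coord (op_action p g \<Phi> q ?xy) ks =
        coord (op_action p g \<Phi> q x \<otimes>\<^bsub>tgt \<Phi> (q + p)\<^esub> op_action p g \<Phi> q y) ks"
      unfolding coord_op_action[OF xy ks] coord_mult[OF g\<Phi> ks op_action_closed[OF x] op_action_closed[OF y]]
        coord_op_action[OF x ks] coord_op_action[OF y ks] .
  qed
qed

end

text \<open>Naturality of \<beta> along \<open>g js ks\<close>, of degree t, costs the exponent
  \<open>t * r\<close>. With \<open>r * lsum ks\<close> and \<open>r * p\<close> from the target
  this has the parity of \<open>r * lsum js\<close>, the exponent with which the iterated map on the
  source applies \<beta>.\<close>

lemma op_action_natural:
  assumes \<Phi>: "dg_functor E \<Phi>" and \<Psi>: "dg_functor E \<Psi>"
    and gm: "graded_map \<Phi> \<Psi> r \<beta>" and nat: "natural E \<Phi> \<Psi> r \<beta>" and x: "x \<in> carrier (src \<Phi> q)"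
  shows "op_action p g \<Psi> (q + r) (Hoch_iter_map E i n1 \<Psi> r \<beta> m1 q x) =
    Hoch_iter_map E i n2 \<Psi> r \<beta> m2 (q + p) (op_action p g \<Phi> q x) [^]\<^bsub>tgt \<Psi> (q + r + p)\<^esub> ksign (r * p)"
proof -
  note g\<Phi> = g\<Phi>[OF \<Phi>] and g\<Psi> = g\<Phi>[OF \<Psi>]
  let ?h = "Hoch_iter_map E i n1 \<Psi> r \<beta> m1 q x"
  let ?z = "op_action p g \<Phi> q x"
  let ?k = "Hoch_iter_map E i n2 \<Psi> r \<beta> m2 (q + p) ?z"
  interpret T: comm_group "tgt \<Psi> (q + r + p)"
    by (rule iterD(1)[OF g\<Psi>])
  have h: "?h \<in> carrier (src \<Psi> (q + r))"
    by (rule hom_in_carrier[OF graded_mapD[OF coord_iter_map(1)[OF g\<Phi> g\<Psi> gm]] x]) simp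
  have z: "?z \<in> carrier (tgt \<Phi> (q + p))"
    by (rule op_action_closed[OF \<Phi> x])
  have k: "?k \<in> carrier (tgt \<Psi> (q + r + p))"
    by (rule hom_in_carrier[OF graded_mapD[OF coord_iter_map(1)[OF g\<Phi> g\<Psi> gm]] z]) simp
  show ?thesis
  proof (rule coord_eqI[OF g\<Psi> op_action_closed[OF \<Psi> h] T.int_pow_closed[OF k]])
    fix ks assume ks: "ks \<in> indices n2"
    let ?G = "Hoch_comp \<Psi> m2 (q + r + p) ks" and ?F = "Hoch_comp \<Phi> m2 (q + p) ks"
    interpret G: comm_group ?G
      by (rule covariantD(1)[OF g\<Psi>])
    interpret F: comm_group ?F
      by (rule covariantD(1)[OF g\<Phi>])
    let ?B = "\<beta> (sum_list ks + m2) (q + p - lsum ks)"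
    have B: "?B \<in> hom ?F ?G"
      by (rule graded_mapD[OF gm]) simp
    \<comment> \<open>As \<beta> may kill coordinates of \<open>x\<close>, the supports of
      \<open>x\<close> and of its image can differ.\<close>
    define S where "S = supp \<Phi> q x \<union> supp \<Psi> (q + r) ?h"
    have S: "finite S" "S \<subseteq> indices n1"
      using coord_finite[OF g\<Phi> x] coord_finite[OF g\<Psi> h] by (auto simp: S_def)
    have sub: "supp \<Phi> q x \<subseteq> S" "supp \<Psi> (q + r) ?h \<subseteq> S"
      unfolding S_def by blast+
    have deg: "q + p + r = q + r + p"
      by simp
    let ?c = "ksign (r * lsum ks + r * p)"
    let ?f = "\<lambda>js. op_summand p g \<Phi> q ks js (coord x js)"
    have f: "?f \<in> S \<rightarrow> carrier ?F"
      using op_summand_closed[OF \<Phi> x _ ks] S(2) by auto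
    have Bf: "(\<lambda>js. ?B (?f js)) \<in> S \<rightarrow> carrier ?G"
      using hom_in_carrier[OF B] f by (auto simp: Pi_iff)
    have Bz: "?B (act_coord p g \<Phi> q ks x) \<in> carrier ?G"
      by (rule hom_in_carrier[OF B act_coord_closed[OF \<Phi> x ks]])
    have "coord (?k [^]\<^bsub>tgt \<Psi> (q + r + p)\<^esub> ksign (r * p)) ks =
        (?B (act_coord p g \<Phi> q ks x) [^]\<^bsub>?G\<^esub> ksign (r * lsum ks)) [^]\<^bsub>?G\<^esub> ksign (r * p)"
      unfolding coord_pow[OF g\<Psi> ks k] coord_iter_map(2)[OF g\<Phi> g\<Psi> gm ks z] coord_op_action[OF \<Phi> x ks] deg ..
    also have "\<dots> = ?B (act_coord p g \<Phi> q ks x) [^]\<^bsub>?G\<^esub> ?c"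
      by (rule G.pow_ksign_ksign[OF Bz])
    also have "?B (act_coord p g \<Phi> q ks x) = finprod ?G (\<lambda>js. ?B (?f js)) S"
      unfolding act_coord_superset[OF \<Phi> x ks S(1) sub(1) S(2)]
      by (rule hom_finprod[OF B F.comm_group_axioms G.comm_group_axioms f])
    also have "\<dots> [^]\<^bsub>?G\<^esub> ?c = finprod ?G (\<lambda>js. ?B (?f js) [^]\<^bsub>?G\<^esub> ?c) S"
      by (rule G.finprod_pow[OF Bf])
    also have "\<dots> = finprod ?G (\<lambda>js. op_summand p g \<Psi> (q + r) ks js (coord ?h js)) S"
    proof (rule G.finprod_cong'[OF refl])
      show "(\<lambda>js. op_summand p g \<Psi> (q + r) ks js (coord ?h js)) \<in> S \<rightarrow> carrier ?G"
        using op_summand_closed[OF \<Psi> h _ ks] S(2) by auto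
      fix js assume "js \<in> S"
      then have js: "js \<in> indices n1"
        using S(2) by blast
      let ?a = "sum_list js + m1" and ?b = "sum_list ks + m2"
      let ?v = "coord x js" and ?s = "q - lsum js" and ?t = "op_degree js ks p"
      have v: "?v \<in> carrier (Hoch_comp \<Phi> m1 q js)"
        by (rule coord_closed[OF g\<Phi> js x])
      have bv: "\<beta> ?a ?s ?v \<in> carrier (Hoch_comp \<Psi> m1 (q + r) js)"
        by (rule hom_in_carrier[OF graded_mapD[OF gm] v]) simp
      have d: "?s + ?t = q + p - lsum ks" "?s + r = q + r - lsum js" "q + p - lsum ks + r = q + r + p - lsum ks"
        by (simp_all add: op_degree_eq)
      let ?w = "op_summand p g \<Psi> (q + r) ks js (\<beta> ?a ?s ?v)"
      have w: "?w \<in> carrier ?G"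
        by (rule hom_in_carrier[OF op_summand_hom[OF \<Psi> js ks] bv])
      have "\<beta> ?b (?s + ?t) (Act \<Phi> ?a ?b ?t (g js ks) ?s ?v) =
          Act \<Psi> ?a ?b ?t (g js ks) (?s + r) (\<beta> ?a ?s ?v) [^]\<^bsub>grp (Obj \<Psi> ?b) (?s + ?t + r)\<^esub> ksign (?t * r)"
        using nat g_closed[OF js ks] v unfolding natural_def by blast
      then have "?B (?f js) = ?w [^]\<^bsub>?G\<^esub> ksign (?t * r)"
        unfolding op_summand_def d .
      then have "?B (?f js) [^]\<^bsub>?G\<^esub> ?c = ?w [^]\<^bsub>?G\<^esub> ksign (?t * r + (r * lsum ks + r * p))"
        by (simp only: G.pow_ksign_ksign[OF w])
      also have "ksign (?t * r + (r * lsum ks + r * p)) = ksign (r * lsum js)"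
        by (rule ksign_cong) (simp add: op_degree_eq algebra_simps)
      also have "?w [^]\<^bsub>?G\<^esub> \<dots> = op_summand p g \<Psi> (q + r) ks js (\<beta> ?a ?s ?v [^]\<^bsub>Hoch_comp \<Psi> m1 (q + r) js\<^esub> ksign (r * lsum js))"
        by (rule hom_int_pow[OF op_summand_hom[OF \<Psi> js ks] bv, symmetric])
          (intro comm_imp_group covariantD(1)[OF g\<Psi>])+
      finally show "?B (?f js) [^]\<^bsub>?G\<^esub> ?c = op_summand p g \<Psi> (q + r) ks js (coord ?h js)"
        unfolding coord_iter_map(2)[OF g\<Phi> g\<Psi> gm js x] .
    qed
    also have "\<dots> = coord (op_action p g \<Psi> (q + r) ?h) ks"
      unfolding coord_op_action[OF \<Psi> h ks] by (rule act_coord_superset[OF \<Psi> h ks S(1) sub(2) S(2), symmetric])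
    finally show "coord (op_action p g \<Psi> (q + r) ?h) ks = coord (?k [^]\<^bsub>tgt \<Psi> (q + r + p)\<^esub> ksign (r * p)) ks" ..
  qed
qed

text \<open>The operation is the action of \<open>g\<close>. On the generator of index
  \<open>js\<close> only the summand of \<open>js\<close> survives, and there \<open>g js ks\<close>
  acts on the identity by composition.\<close>

lemma Nat_surj:
  shows "\<exists>\<alpha>\<in>carrier (grp Nat_ops p). operations (evaluate \<alpha>) = g"
proof
  define \<alpha> where "\<alpha> = (\<lambda>\<Phi>\<in>{\<Phi>. dg_functor E \<Phi>}. \<lambda>q. restrict (op_action p g \<Phi> q) (carrier (src \<Phi> q)))"
  have \<alpha>_eq: "\<alpha> \<Phi> q x = op_action p g \<Phi> q x" if "dg_functor E \<Phi>" "x \<in> carrier (src \<Phi> q)" for \<Phi> q x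
    using that by (simp add: \<alpha>_def)
  show "\<alpha> \<in> carrier (grp Nat_ops p)"
    unfolding carrier_Nat
  proof (intro conjI allI impI IntI)
    show "\<alpha> \<in> extensional {\<Phi>. dg_functor E \<Phi>}"
      by (simp add: \<alpha>_def)
    fix \<Phi> :: "'a ufun" and q assume \<Phi>: "dg_functor E \<Phi>"
    show "\<alpha> \<Phi> q \<in> extensional (carrier (src \<Phi> q))"
      using \<Phi> by (simp add: \<alpha>_def)
    interpret S: comm_group "src \<Phi> q"
      by (rule iterD(1)[OF g\<Phi>[OF \<Phi>]])
    show "\<alpha> \<Phi> q \<in> hom (src \<Phi> q) (tgt \<Phi> (q + p))"
    proof (rule homI)
      show "\<alpha> \<Phi> q x \<in> carrier (tgt \<Phi> (q + p))" if "x \<in> carrier (src \<Phi> q)" for x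
        unfolding \<alpha>_eq[OF \<Phi> that] by (rule op_action_closed[OF \<Phi> that])
      show "\<alpha> \<Phi> q (x \<otimes>\<^bsub>src \<Phi> q\<^esub> y) = \<alpha> \<Phi> q x \<otimes>\<^bsub>tgt \<Phi> (q + p)\<^esub> \<alpha> \<Phi> q y"
        if "x \<in> carrier (src \<Phi> q)" "y \<in> carrier (src \<Phi> q)" for x y
        unfolding \<alpha>_eq[OF \<Phi> that(1)] \<alpha>_eq[OF \<Phi> that(2)] \<alpha>_eq[OF \<Phi> S.m_closed[OF that]]
        by (rule hom_mult[OF op_action_hom[OF \<Phi>] that])
    qed
  next
    fix \<Phi> \<Psi> :: "'a ufun" and r q \<beta> x
    assume \<Phi>: "dg_functor E \<Phi>" and \<Psi>: "dg_functor E \<Psi>" and \<beta>: "\<beta> \<in> carrier (grp (nat_trans E \<Phi> \<Psi>) r)"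
      and x: "x \<in> carrier (src \<Phi> q)"
    have "Hoch_iter_map E i n1 \<Psi> r \<beta> m1 q x \<in> carrier (src \<Psi> (q + r))"
      by (rule hom_in_carrier[OF graded_mapD[OF coord_iter_map(1)[OF g\<Phi>[OF \<Phi>] g\<Phi>[OF \<Psi>] nat_transD(1)[OF \<beta>]]] x]) simp
    then show "\<alpha> \<Psi> (q + r) (Hoch_iter_map E i n1 \<Psi> r \<beta> m1 q x) =
        Hoch_iter_map E i n2 \<Psi> r \<beta> m2 (q + p) (\<alpha> \<Phi> q x) [^]\<^bsub>tgt \<Psi> (q + r + p)\<^esub> ksign (r * p)"
      using op_action_natural[OF \<Phi> \<Psi> nat_transD[OF \<beta>] x] by (simp add: \<alpha>_eq[OF \<Phi> x] \<alpha>_eq[OF \<Psi>])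
  qed
  have ev: "coord (evaluate \<alpha> js) ks = g js ks" if js: "js \<in> indices n1" and ks: "ks \<in> indices n2" for js ks
  proof -
    let ?R = "Rep js"
    note gen = gen_closed[OF js] and gR = graded_rep
    let ?G = "Hoch_comp ?R m2 (lsum js + p) ks"
    interpret G: comm_group ?G
      by (rule covariantD(1)[OF gR])
    have Geq: "?G = grp (Hom E (sum_list js + m1) (sum_list ks + m2)) (op_degree js ks p)"
      by (simp add: representable_simps op_degree_eq add.commute)
    have val: "op_summand p g ?R (lsum js) ks js (coord (gen js) js) = g js ks"
      using Cmp_Idm_left[OF _ _ g_closed[OF js ks]]
      by (simp add: op_summand_def coord_gen[OF js js] representable_simps Ob_UNIV)
    have sub: "supp ?R (lsum js) (gen js) \<subseteq> {js}"
      using coord_gen[OF js] by (auto split: if_splits)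
    have "coord (evaluate \<alpha> js) ks = act_coord p g ?R (lsum js) ks (gen js)"
      unfolding evaluate_def \<alpha>_eq[OF dg_representable gen] by (rule coord_op_action[OF dg_representable gen ks])
    also have "\<dots> = finprod ?G (\<lambda>ls. op_summand p g ?R (lsum js) ks ls (coord (gen js) ls)) {js}"
      using js by (intro act_coord_superset[OF dg_representable gen ks _ sub]) auto
    also have "\<dots> = g js ks"
      using g_closed[OF js ks] val unfolding Geq[symmetric] by (simp add: G.finprod_insert)
    finally show ?thesis .
  qed
  \<comment> \<open>So far the entries agree on the index sets; presenting \<open>g\<close> as
    \<open>operations h\<close> supplies the agreement outside them.\<close>
  obtain h where h: "\<And>js. js \<in> indices n1 \<Longrightarrow> h js \<in> carrier (coHoch_comp bim m1 p js)"
      "operations h = g"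
    using operations_surj[OF g] by blast
  have "coord (h js) ks = g js ks" if "js \<in> indices n1" "ks \<in> indices n2" for js ks
    using h(2) that by (auto simp: operations_def)
  then have "operations (evaluate \<alpha>) = operations h"
    using ev by (auto simp: operations_def intro!: restrict_ext)
  then show "operations (evaluate \<alpha>) = g"
    by (simp only: h(2))
qed

end

section \<open>The differential of a generator and the differential of an operation\<close>

context
  fixes js :: "nat list"
  assumes js: "js \<in> indices n1"
begin

abbreviation lower :: "(nat \<times> nat) set"
  where "lower \<equiv> {(t, j). t < n1 \<and> 1 \<le> j \<and> j < js ! t}"

definition lower_whisker :: "nat \<Rightarrow> nat \<Rightarrow> 'a univ"
  where "lower_whisker t j = whisker E i (sum_list (take t js)) (js ! t) j (sum_list (drop (Suc t) js) + m1)"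

definition lower_map :: "nat \<Rightarrow> nat \<Rightarrow> nat \<Rightarrow> int \<Rightarrow> 'a univ \<Rightarrow> 'a univ"
  where "lower_map t j =
    precomp (sum_list js + m1) (sum_list (js[t := j]) + m1) (int (js ! t) - int j - 1) (lower_whisker t j)"

text \<open>Up to sign this is \<open>f \<otimes> l\<close> with \<open>f\<close> the whiskered
  morphism and \<open>l\<close> indexed by the lowered list, written as the image of another
  generator under precomposition with \<open>f\<close>. In this form naturality of an operation
  applies to it.\<close>

definition lower_gen :: "nat \<Rightarrow> nat \<Rightarrow> 'a univ"
  where "lower_gen t j = Hoch_iter_map E i n1 (Rep js) (int (js ! t) - int j - 1)
    (lower_map t j) m1 (lsum (js[t := j])) (gen (js[t := j]))"

lemma
  assumes "(t, j) \<in> lower"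
  shows lower_length: "t < length js" and lower_update: "js[t := j] \<in> indices n1"
    and lower_whisker_closed: "lower_whisker t j \<in>
      carrier (grp (Hom E (sum_list js + m1) (sum_list (js[t := j]) + m1)) (int (js ! t) - int j - 1))"
    and lower_deg: "lsum (js[t := j]) + (int (js ! t) - int j - 1) = lsum js - 1"
proof -
  show t: "t < length js"
    using assms js by (simp add: indices_length)
  show "js[t := j] \<in> indices n1"
    using assms js by (simp add: indices_update)
  show "lower_whisker t j \<in>
      carrier (grp (Hom E (sum_list js + m1) (sum_list (js[t := j]) + m1)) (int (js ! t) - int j - 1))"
    unfolding lower_whisker_def using assms t by (intro whisker_closed_lower) auto
  show "lsum (js[t := j]) + (int (js ! t) - int j - 1) = lsum js - 1"
    by (simp add: lsum_update_nth[OF t])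
qed

lemmas lower_graded_map = precomp_graded_map[OF lower_whisker_closed, folded lower_map_def]
lemmas lower_natural = natural_precomp[OF lower_whisker_closed, folded lower_map_def]

lemma lower_gen_closed:
  assumes "(t, j) \<in> lower"
  shows "lower_gen t j \<in> carrier (src (Rep js) (lsum js - 1))"
  unfolding lower_gen_def
  by (rule hom_in_carrier[OF graded_mapD[OF coord_iter_map(1)[OF graded_rep graded_rep lower_graded_map[OF assms]]]
      gen_closed[OF lower_update[OF assms]]]) (simp only: lower_deg[OF assms])

abbreviation lower_sign :: "nat \<Rightarrow> nat \<Rightarrow> int"
  where "lower_sign t j \<equiv> lsum (take t js) * (int (js ! t) - int j)"

text \<open>Precomposition carries the identity to the whiskered morphism without a sign, the
  identity having degree 0; the remaining sign is that of the iterated map.\<close>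

lemma coord_lower_gen:
  assumes tj: "(t, j) \<in> lower" and ls: "ls \<in> indices n1"
  defines "G \<equiv> Hoch_comp (Rep js) m1 (lsum js - 1) ls"
  shows "coord (lower_gen t j) ls =
    (if ls = js[t := j] then lower_whisker t j [^]\<^bsub>G\<^esub> ksign ((int (js ! t) - int j - 1) * lsum (js[t := j])) else \<one>\<^bsub>G\<^esub>)"
proof -
  let ?js' = "js[t := j]" and ?r = "int (js ! t) - int j - 1"
  let ?a = "sum_list js + m1" and ?b = "sum_list (js[t := j]) + m1"
  interpret G: comm_group G
    unfolding G_def by (rule covariantD(1)[OF graded_rep])
  note gm = lower_graded_map[OF tj] and js' = lower_update[OF tj]
  have Geq: "Hoch_comp (representable E ?a) m1 (lsum ?js' + ?r) ls = G"
    unfolding G_def lower_deg[OF tj] ..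
  have c: "coord (lower_gen t j) ls =
      lower_map t j (sum_list ls + m1) (lsum ?js' - lsum ls) (coord (gen ?js') ls) [^]\<^bsub>G\<^esub> ksign (?r * lsum ls)"
    unfolding lower_gen_def coord_iter_map(2)[OF graded_rep graded_rep gm ls gen_closed[OF js']] Geq ..
  show ?thesis
  proof (cases "ls = ?js'")
    case True
    have w: "lower_whisker t j \<in> carrier (grp (Hom E ?a ?b) ?r)"
      by (rule lower_whisker_closed[OF tj])
    have "lower_map t j ?b 0 (Idm E ?b) = lower_whisker t j"
      using Cmp_Idm_right[OF _ _ w] group.int_pow_1[OF group_Hom w]
      by (simp add: lower_map_def precomp_def Ob_UNIV ksign_def)
    then show ?thesis
      unfolding c coord_gen[OF js' ls] using True by simp
  next
    case False
    have hom: "lower_map t j (sum_list ls + m1) (lsum ?js' - lsum ls)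
        \<in> hom (Hoch_comp (representable E ?b) m1 (lsum ?js') ls) G"
      unfolding G_def by (rule graded_mapD[OF gm]) (use lower_deg[OF tj] in linarith)
    have "lower_map t j (sum_list ls + m1) (lsum ?js' - lsum ls)
        \<one>\<^bsub>Hoch_comp (representable E ?b) m1 (lsum ?js') ls\<^esub> = \<one>\<^bsub>G\<^esub>"
      by (rule hom_one[OF hom comm_imp_group[OF covariantD(1)[OF graded_rep]] G.is_group])
    with False show ?thesis
      unfolding c coord_gen[OF js' ls] by (simp only: if_False G.int_pow_one)
  qed
qed

text \<open>The identity being a cycle, only terms that lower one entry of \<open>js\<close> remain.
  In the exponent, \<open>lower_sign\<close> is the sign of \<open>Hoch_term\<close>, whose
  coefficient here has degree 0, and the second summand removes the sign with which
  \<open>lower_gen\<close> carries its coefficient.\<close>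

lemma dif_gen:
  defines "R \<equiv> Rep js"
  shows "dif (Obj ((Hoch E i ^^ n1) R) m1) (lsum js) (gen js) =
    finprod (src R (lsum js - 1)) (\<lambda>(t, j). lower_gen t j
      [^]\<^bsub>src R (lsum js - 1)\<^esub> ksign (lower_sign t j + (int (js ! t) - int j - 1) * lsum (js[t := j]))) lower"
    (is "?d = finprod ?K (\<lambda>(t, j). ?f t j) _")
proof (rule coord_eqI[OF graded_rep[of "sum_list js + m1", folded R_def]])
  note gR = graded_rep[of "sum_list js + m1", folded R_def]
  note gen = gen_closed[OF js, folded R_def]
    and cgen = coord_gen[OF js, folded R_def]
  interpret K: comm_group ?K
    by (rule iterD(1)[OF gR])
  show "?d \<in> carrier ?K"
    by (rule hom_in_carrier[OF iterD(2)[OF gR refl] gen])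
  have f: "(\<lambda>(t, j). ?f t j) \<in> lower \<rightarrow> carrier ?K"
  proof (rule Pi_I)
    fix z assume z: "z \<in> lower"
    obtain t j where tj: "z = (t, j)"
      by fastforce
    show "(case z of (t, j) \<Rightarrow> ?f t j) \<in> carrier ?K"
      unfolding tj prod.case by (rule K.int_pow_closed[OF lower_gen_closed[OF z[unfolded tj], folded R_def]])
  qed
  then show "finprod ?K (\<lambda>(t, j). ?f t j) lower \<in> carrier ?K"
    by (rule K.finprod_closed)
  fix ls assume ls: "ls \<in> indices n1"
  let ?G = "Hoch_comp R m1 (lsum js - 1) ls"
  interpret G: comm_group ?G
    by (rule covariantD(1)[OF gR])
  have len: "length js = n1" "length ls = n1"
    using js ls by (simp_all add: indices_length)
  let ?a = "sum_list js + m1"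
  have wG: "lower_whisker t j \<in> carrier ?G" if "(t, j) \<in> lower" "ls = js[t := j]" for t j
  proof -
    have "int (js ! t) - int j - 1 = lsum js - 1 - lsum (js[t := j])"
      using lower_deg[OF that(1)] by linarith
    from lower_whisker_closed[OF that(1), unfolded this] show ?thesis
      unfolding that(2) R_def representable_simps .
  qed
  have cf: "coord (?f t j) ls =
      (if ls = js[t := j] then lower_whisker t j [^]\<^bsub>?G\<^esub> ksign (lower_sign t j) else \<one>\<^bsub>?G\<^esub>)" if tj: "(t, j) \<in> lower" for t j
  proof -
    let ?c = "(int (js ! t) - int j - 1) * lsum (js[t := j])"
    have 1: "coord (?f t j) ls = coord (lower_gen t j) ls [^]\<^bsub>?G\<^esub> ksign (lower_sign t j + ?c)"
      by (rule coord_pow[OF gR ls lower_gen_closed[OF tj, folded R_def]])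
    show ?thesis
    proof (cases "ls = js[t := j]")
      case True
      have "(lower_whisker t j [^]\<^bsub>?G\<^esub> ksign ?c) [^]\<^bsub>?G\<^esub> ksign (lower_sign t j + ?c) =
          lower_whisker t j [^]\<^bsub>?G\<^esub> ksign (?c + (lower_sign t j + ?c))"
        by (rule G.pow_ksign_ksign[OF wG[OF tj True]])
      also have "ksign (?c + (lower_sign t j + ?c)) = ksign (lower_sign t j)"
        by (rule ksign_cong) simp
      finally show ?thesis
        unfolding 1 coord_lower_gen[OF tj ls, folded R_def] if_P[OF True] .
    next
      case False
      then show ?thesis
        unfolding 1 coord_lower_gen[OF tj ls, folded R_def] by (simp only: if_False G.int_pow_one)
    qed
  qed
  have fc: "(\<lambda>z. coord (case z of (t, j) \<Rightarrow> ?f t j) ls) \<in> lower \<rightarrow> carrier ?G"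
    using funcset_mem[OF f] coord_closed[OF gR ls] by blast
  have rhs: "coord (finprod ?K (\<lambda>(t, j). ?f t j) lower) ls = finprod ?G (\<lambda>z. coord (case z of (t, j) \<Rightarrow> ?f t j) ls) lower"
    by (rule coord_finprod[OF gR ls f])
  let ?S = "{(t, k). t < n1 \<and> ls ! t < k \<and> coord (gen js) (ls[t := k]) \<noteq> \<one>\<^bsub>Hoch_comp R m1 (lsum js) (ls[t := k])\<^esub>}"
  let ?T = "\<lambda>(t, k). Hoch_term R m1 (lsum js) ls t k (coord (gen js) (ls[t := k]))"
  have S: "ls[t := k] = js" if "(t, k) \<in> ?S" for t k
  proof (rule ccontr)
    assume *: "ls[t := k] \<noteq> js"
    have "ls[t := k] \<in> indices n1"
      using that ls by (simp add: indices_update)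
    then show False
      using cgen[of "ls[t := k]"] * that by simp
  qed
  have D: "dif (Obj R (sum_list ls + m1)) (lsum js - lsum ls) (coord (gen js) ls) = \<one>\<^bsub>?G\<^esub>"
  proof (cases "ls = js")
    case True
    then show ?thesis
      using cgen[OF ls] Idm_cycle[of ?a] by (simp add: R_def representable_simps Ob_UNIV)
  next
    case False
    have "dif (Obj R (sum_list ls + m1)) (lsum js - lsum ls) \<one>\<^bsub>Hoch_comp R m1 (lsum js) ls\<^esub> = \<one>\<^bsub>?G\<^esub>"
      by (rule hom_one[OF covariantD(2)[OF gR] comm_imp_group[OF covariantD(1)[OF gR]] G.is_group]) simp
    with False show ?thesis
      using cgen[OF ls] by simp
  qed
  have Tcl: "?T (t, k) \<in> carrier ?G" if "t < n1" "ls ! t < k" for t k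
    using hom_in_carrier[OF Hoch_term_hom[OF gR ls that] coord_closed[OF gR indices_update[OF ls] gen]] that by simp
  have T: "?T \<in> ?S \<rightarrow> carrier ?G"
    using Tcl by auto
  have lhs: "coord ?d ls = finprod ?G ?T ?S"
    unfolding coord_dif[OF gR ls gen] D using G.finprod_closed[OF T] by (rule G.l_one)
  \<comment> \<open>By \<open>list_update_lower_inj\<close> the index \<open>ls\<close> arises from
    at most one lowering of \<open>js\<close>. Accordingly both products reduce to a single term, or
    both are trivial.\<close>
  show "coord ?d ls = coord (finprod ?K (\<lambda>(t, j). ?f t j) lower) ls"
  proof (cases "\<exists>t j. (t, j) \<in> lower \<and> ls = js[t := j]")
    case True
    then obtain t j where tj: "(t, j) \<in> lower" and lseq: "ls = js[t := j]"
      by blast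
    have t: "t < n1" "1 \<le> j" "j < js ! t" "ls ! t = j" "ls[t := js ! t] = js"
      using tj lseq len by auto
    have "finprod ?G (\<lambda>z. coord (case z of (t, j) \<Rightarrow> ?f t j) ls) lower = coord (case (t, j) of (t, j) \<Rightarrow> ?f t j) ls"
    proof (rule G.finprod_single)
      show "finite lower"
        by (rule finite_lower_updates)
      show "coord (case (t, j) of (t, j) \<Rightarrow> ?f t j) ls \<in> carrier ?G"
        using fc tj by blast
      show "coord (case z of (t, j) \<Rightarrow> ?f t j) ls = \<one>\<^bsub>?G\<^esub>" if z: "z \<in> lower" "z \<noteq> (t, j)" for z
      proof -
        obtain t' j' where z': "z = (t', j')"
          by fastforce
        have "ls \<noteq> js[t' := j']"
        proof
          assume "ls = js[t' := j']"
          then have "js[t := j] = js[t' := j']"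
            using lseq by simp
          from list_update_lower_inj[OF this] show False
            using t z z' len by auto
        qed
        then show ?thesis
          using cf[of t' j'] z(1) z' by simp
      qed
      show "coord (case (t, j) of (t, j) \<Rightarrow> ?f t j) ls = \<one>\<^bsub>?G\<^esub>" if "(t, j) \<notin> lower"
        using that tj by contradiction
    qed
    also have "\<dots> = lower_whisker t j [^]\<^bsub>?G\<^esub> ksign (lower_sign t j)"
      using cf[OF tj] lseq by simp
    finally have r: "coord (finprod ?K (\<lambda>(t, j). ?f t j) lower) ls = lower_whisker t j [^]\<^bsub>?G\<^esub> ksign (lower_sign t j)"
      unfolding rhs .
    have w: "lower_whisker t j \<in> carrier (grp (Hom E ?a (sum_list ls + m1)) (int (js ! t) - int j - 1))"
      using lower_whisker_closed[OF tj] lseq by simp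
    have "finprod ?G ?T ?S = ?T (t, js ! t)"
    proof (rule G.finprod_single)
      show "finite ?S"
        by (rule finite_coord_update[OF gR gen ls])
      show "?T (t, js ! t) \<in> carrier ?G"
        using Tcl[of t "js ! t"] t by simp
      show "?T z = \<one>\<^bsub>?G\<^esub>" if z: "z \<in> ?S" "z \<noteq> (t, js ! t)" for z
      proof -
        obtain t' k where z': "z = (t', k)"
          by fastforce
        have eq: "ls[t' := k] = js"
          using S z(1) z' by blast
        have "t' = t"
        proof (rule ccontr)
          assume "t' \<noteq> t"
          then have "js ! t = ls ! t"
            using arg_cong[OF eq, of "\<lambda>xs. xs ! t"] by simp
          with t show False
            by simp
        qed
        then have "k = js ! t"
          using arg_cong[OF eq, of "\<lambda>xs. xs ! t"] t(1) len by simp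
        with \<open>t' = t\<close> z(2) z' show ?thesis
          by simp
      qed
      \<comment> \<open>The pair can be missing from \<open>?S\<close> only if the identity is the
        zero element of its group of morphisms; then the term vanishes as well.\<close>
      show "?T (t, js ! t) = \<one>\<^bsub>?G\<^esub>" if "(t, js ! t) \<notin> ?S"
      proof -
        have one: "coord (gen js) (ls[t := js ! t]) = \<one>\<^bsub>Hoch_comp R m1 (lsum js) (ls[t := js ! t])\<^esub>"
          using that t by auto
        have h: "Hoch_term R m1 (lsum js) ls t (js ! t) \<in> hom (Hoch_comp R m1 (lsum js) (ls[t := js ! t])) ?G"
          by (rule Hoch_term_hom[OF gR ls]) (use t in auto)
        show ?thesis
          unfolding prod.case one
          by (rule hom_one[OF h comm_imp_group[OF covariantD(1)[OF gR]] G.is_group])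
      qed
    qed
    also have "\<dots> = lower_whisker t j [^]\<^bsub>?G\<^esub> ksign (lower_sign t j)"
    proof -
      have "take t ls = take t js" "drop (Suc t) ls = drop (Suc t) js"
        using lseq by simp_all
      then show ?thesis
        using t cgen[OF js] Cmp_Idm_left[OF _ _ w]
        by (simp add: Hoch_term_def R_def representable_simps lower_whisker_def Ob_UNIV)
    qed
    finally show ?thesis
      unfolding lhs r .
  next
    case False
    have "?S = {}"
    proof (rule equals0I)
      fix z assume z: "z \<in> ?S"
      then obtain t k where z': "z = (t, k)" "t < n1" "ls ! t < k"
        by blast
      have eq: "ls[t := k] = js"
        using S z z' by blast
      have "js ! t = k"
        using arg_cong[OF eq, of "\<lambda>xs. xs ! t"] z'(2) len by simp
      moreover have "js[t := ls ! t] = ls"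
        using arg_cong[OF eq, of "\<lambda>xs. xs[t := ls ! t]"] by simp
      ultimately have "(t, ls ! t) \<in> lower" "ls = js[t := ls ! t]"
        using z' indices_nth[OF ls, of t] by auto
      with False show False
        by blast
    qed
    moreover have "finprod ?G (\<lambda>z. coord (case z of (t, j) \<Rightarrow> ?f t j) ls) lower = \<one>\<^bsub>?G\<^esub>"
    proof (rule G.finprod_one_eqI)
      fix z assume z: "z \<in> lower"
      obtain t' j' where z': "z = (t', j')"
        by fastforce
      then show "coord (case z of (t, j) \<Rightarrow> ?f t j) ls = \<one>\<^bsub>?G\<^esub>"
        using cf[of t' j'] z False by auto
    qed
    ultimately show ?thesis
      unfolding lhs rhs by (simp only: G.finprod_empty)
  qed
qed

text \<open>The differential of \<open>hom_cx\<close> at the generator is, up to the sign of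
  exponent \<open>lsum js\<close>, the differential of the value minus the value at the
  differential. The lemma \<open>dif_gen\<close> and naturality along \<open>lower_map\<close> turn
  the latter into the coHochschild terms.\<close>

lemma evaluate_dif:
  assumes \<alpha>: "\<alpha> \<in> carrier (grp Nat_ops p)"
  defines "B \<equiv> bim"
  shows "evaluate (dif Nat_ops p \<alpha>) js =
    (dif (Obj B (sum_list js + m1)) (p + lsum js) (evaluate \<alpha> js)
        \<otimes>\<^bsub>coHoch_comp B m1 (p - 1) js\<^esub> inv\<^bsub>coHoch_comp B m1 (p - 1) js\<^esub>
      finprod (coHoch_comp B m1 (p - 1) js) (\<lambda>(t, j). coHoch_term B m1 p js t j (evaluate \<alpha> (js[t := j])))
        lower) [^]\<^bsub>coHoch_comp B m1 (p - 1) js\<^esub> ksign (lsum js)"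
proof -
  let ?a = "sum_list js + m1"
  let ?R = "representable E ?a"
  let ?K = "coHoch_comp B m1 (p - 1) js" and ?L = "src ?R (lsum js - 1)"
  note gR = graded_rep and dR = dg_representable
  interpret K: comm_group ?K
    unfolding B_def by (rule contravariantD(1)[OF graded_bimodule])
  interpret L: comm_group ?L
    by (rule iterD(1)[OF gR])
  have Keq: "tgt ?R (lsum js + p - 1) = ?K"
    unfolding B_def Hoch_bimodule_simps by (simp add: algebra_simps)
  let ?r = "\<lambda>t j. int (js ! t) - int j - 1"
  let ?e = "\<lambda>t j. lower_sign t j + ?r t j * lsum (js[t := j])"
  let ?f = "\<lambda>(t, j). lower_gen t j [^]\<^bsub>?L\<^esub> ksign (?e t j)"
  have f: "?f \<in> lower \<rightarrow> carrier ?L"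
  proof (rule Pi_I)
    fix z assume z: "z \<in> lower"
    obtain t j where tj: "z = (t, j)"
      by fastforce
    show "?f z \<in> carrier ?L"
      unfolding tj prod.case by (rule L.int_pow_closed[OF lower_gen_closed[OF z[unfolded tj]]])
  qed
  have hom: "\<alpha> ?R (lsum js - 1) \<in> hom ?L ?K"
    unfolding Keq[symmetric] by (rule Nat_hom[OF \<alpha> dR]) simp
  have trm: "\<alpha> ?R (lsum js - 1) (?f (t, j)) = coHoch_term B m1 p js t j (evaluate \<alpha> (js[t := j])) \<and>
      coHoch_term B m1 p js t j (evaluate \<alpha> (js[t := j])) \<in> carrier ?K"
    if tj: "(t, j) \<in> lower" for t j
  proof -
    let ?js' = "js[t := j]"
    let ?b = "sum_list ?js' + m1"
    let ?v = "evaluate \<alpha> ?js'"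
    note js' = lower_update[OF tj] and gm = lower_graded_map[OF tj] and nat = lower_natural[OF tj]
    have v: "?v \<in> carrier (tgt (representable E ?b) (lsum ?js' + p))"
      using evaluate_closed[OF \<alpha> js'] by (simp add: Hoch_bimodule_simps add.commute)
    let ?k = "Hoch_iter_map E i n2 ?R (?r t j) (lower_map t j) m2 (lsum ?js' + p) ?v"
    have k: "?k \<in> carrier ?K"
      unfolding Keq[symmetric]
      by (rule hom_in_carrier[OF graded_mapD[OF coord_iter_map(1)[OF gR gR gm]] v])
        (use lower_deg[OF tj] in simp)
    have deg: "lsum js - 1 + p = lsum js + p - 1" "p + lsum ?js' + ?r t j = lsum js + p - 1"
      using lower_deg[OF tj] by simp_all
    have "\<alpha> ?R (lsum js - 1) (?f (t, j)) = \<alpha> ?R (lsum js - 1) (lower_gen t j) [^]\<^bsub>?K\<^esub> ksign (?e t j)"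
      unfolding prod.case by (rule hom_int_pow[OF hom lower_gen_closed[OF tj] L.is_group K.is_group])
    also have "\<alpha> ?R (lsum js - 1) (lower_gen t j) = ?k [^]\<^bsub>?K\<^esub> ksign (?r t j * p)"
      using Nat_natural[OF \<alpha> dR dR gm nat gen_closed[OF js'] lower_deg[OF tj, symmetric]]
      unfolding lower_gen_def evaluate_def deg Keq .
    also have "\<dots> [^]\<^bsub>?K\<^esub> ksign (?e t j) = ?k [^]\<^bsub>?K\<^esub> ksign (?r t j * p + ?e t j)"
      by (rule K.pow_ksign_ksign[OF k])
    finally have 1: "\<alpha> ?R (lsum js - 1) (?f (t, j)) = ?k [^]\<^bsub>?K\<^esub> ksign (?r t j * p + ?e t j)" .
    have "coHoch_term B m1 p js t j ?v = (?k [^]\<^bsub>?K\<^esub> ksign (?r t j * (p + lsum ?js'))) [^]\<^bsub>?K\<^esub> ksign (lower_sign t j)"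
      unfolding coHoch_term_def B_def Hoch_bimodule_simps(2) lower_whisker_def[symmetric] lower_map_def[symmetric] deg
        Keq[unfolded B_def]
      by (simp add: add.commute)
    also have "\<dots> = ?k [^]\<^bsub>?K\<^esub> ksign (?r t j * (p + lsum ?js') + lower_sign t j)"
      by (rule K.pow_ksign_ksign[OF k])
    \<comment> \<open>Here the exponents agree exactly: naturality supplies
      \<open>?r t j * p\<close>, and \<open>dif_gen\<close> the part
      \<open>?r t j * lsum ?js'\<close> of the bimodule sign as well as
      \<open>lower_sign\<close>.\<close>
    also have "?r t j * (p + lsum ?js') + lower_sign t j = ?r t j * p + ?e t j"
      by (simp add: algebra_simps)
    finally show ?thesis
      using 1 k by simp
  qed
  have "\<alpha> ?R (lsum js - 1) (dif (Obj ((Hoch E i ^^ n1) ?R) m1) (lsum js) (gen js)) =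
      finprod ?K (\<lambda>z. \<alpha> ?R (lsum js - 1) (?f z)) lower"
    unfolding dif_gen by (rule hom_finprod[OF hom L.comm_group_axioms K.comm_group_axioms f])
  also have "\<dots> = finprod ?K (\<lambda>(t, j). coHoch_term B m1 p js t j (evaluate \<alpha> (js[t := j]))) lower"
    using trm by (intro K.finprod_cong') auto
  finally have "\<alpha> ?R (lsum js - 1) (dif (Obj ((Hoch E i ^^ n1) ?R) m1) (lsum js) (gen js)) = \<dots>" .
  moreover have "evaluate (dif Nat_ops p \<alpha>) js =
      (dif (Obj ((Hoch E i ^^ n2) ?R) m2) (lsum js + p) (\<alpha> ?R (lsum js) (gen js))
         \<otimes>\<^bsub>?K\<^esub> inv\<^bsub>?K\<^esub> \<alpha> ?R (lsum js - 1) (dif (Obj ((Hoch E i ^^ n1) ?R) m1) (lsum js) (gen js)))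
        [^]\<^bsub>?K\<^esub> ksign (lsum js)"
    unfolding Keq[symmetric] using gen_closed[OF js] dR
    by (simp add: evaluate_def Nat_cx_def nat_trans_def Fun_cat_def Hoch_fun_def hom_cx_def)
  ultimately show ?thesis
    by (simp add: B_def Hoch_bimodule_simps(1) evaluate_def add.commute)
qed

end

text \<open>By \<open>coord_Nat\<close> an operation is determined by its components on generators,
  which gives injectivity; surjectivity is \<open>Nat_surj\<close>, and \<open>evaluate_dif\<close>
  has the form that \<open>operations_dif\<close> expects.\<close>

lemma Nat_chain_iso:
  "(\<lambda>p \<alpha>. operations (evaluate \<alpha>)) \<in> chain_iso Nat_ops op_cx"
proof -
  let ?\<phi> = "\<lambda>\<alpha>. operations (evaluate \<alpha>)"
  note dR = dg_representable
  have cl: "?\<phi> \<alpha> \<in> carrier (grp op_cx p)" if "\<alpha> \<in> carrier (grp Nat_ops p)" for \<alpha> p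
    by (rule operations_closed[OF evaluate_closed[OF that]])
  have inj: "\<alpha> = \<beta>"
    if \<alpha>: "\<alpha> \<in> carrier (grp Nat_ops p)" and \<beta>: "\<beta> \<in> carrier (grp Nat_ops p)"
      and eq: "?\<phi> \<alpha> = ?\<phi> \<beta>" for \<alpha> \<beta> p
  proof (rule extensionalityI)
    show "\<alpha> \<in> extensional {\<Phi>. dg_functor E \<Phi>}" "\<beta> \<in> extensional {\<Phi>. dg_functor E \<Phi>}"
      using \<alpha> \<beta> unfolding carrier_Nat by blast+
    fix \<Phi> :: "'a ufun" assume "\<Phi> \<in> {\<Phi>. dg_functor E \<Phi>}"
    then have \<Phi>: "dg_functor E \<Phi>"
      by simp
    show "\<alpha> \<Phi> = \<beta> \<Phi>"
    proof (rule ext, rule extensionalityI)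
      fix q
      show "\<alpha> \<Phi> q \<in> extensional (carrier (src \<Phi> q))" "\<beta> \<Phi> q \<in> extensional (carrier (src \<Phi> q))"
        using \<alpha> \<beta> \<Phi> unfolding carrier_Nat by blast+
      fix x assume x: "x \<in> carrier (src \<Phi> q)"
      show "\<alpha> \<Phi> q x = \<beta> \<Phi> q x"
        by (rule coord_eqI[OF dg_functor_graded[OF \<Phi> Ob_UNIV] hom_in_carrier[OF Nat_hom[OF \<alpha> \<Phi> refl] x]
              hom_in_carrier[OF Nat_hom[OF \<beta> \<Phi> refl] x]])
          (simp add: coord_Nat[OF \<alpha> \<Phi> x] coord_Nat[OF \<beta> \<Phi> x] eq)
    qed
  qed
  have mult: "?\<phi> (\<alpha> \<otimes>\<^bsub>grp Nat_ops p\<^esub> \<beta>) = ?\<phi> \<alpha> \<otimes>\<^bsub>grp op_cx p\<^esub> ?\<phi> \<beta>"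
    if \<alpha>: "\<alpha> \<in> carrier (grp Nat_ops p)" and \<beta>: "\<beta> \<in> carrier (grp Nat_ops p)" for \<alpha> \<beta> p
  proof (rule operations_mult[OF evaluate_closed[OF \<alpha>] evaluate_closed[OF \<beta>]])
    fix js assume js: "js \<in> indices n1"
    show "evaluate (\<alpha> \<otimes>\<^bsub>grp Nat_ops p\<^esub> \<beta>) js =
        evaluate \<alpha> js \<otimes>\<^bsub>coHoch_comp bim m1 p js\<^esub> evaluate \<beta> js"
      using gen_closed[OF js] dR
      by (simp add: evaluate_def Nat_cx_def nat_trans_def Fun_cat_def Hoch_fun_def hom_cx_def Hoch_bimodule_simps add.commute)
  qed
  have "?\<phi> \<in> iso (grp Nat_ops p) (grp op_cx p)" for p
    unfolding iso_def
  proof (intro CollectI conjI homI)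
    show "bij_betw ?\<phi> (carrier (grp Nat_ops p)) (carrier (grp op_cx p))"
    proof (rule bij_betwI')
      show "(?\<phi> \<alpha> = ?\<phi> \<beta>) = (\<alpha> = \<beta>)"
        if "\<alpha> \<in> carrier (grp Nat_ops p)" "\<beta> \<in> carrier (grp Nat_ops p)" for \<alpha> \<beta>
        using inj[OF that] by blast
      show "\<exists>\<alpha>\<in>carrier (grp Nat_ops p). g = ?\<phi> \<alpha>" if "g \<in> carrier (grp op_cx p)" for g
        using Nat_surj[OF that] by metis
    qed (rule cl)
  qed (rule cl mult; assumption)+
  moreover have "?\<phi> (dif Nat_ops p \<alpha>) = dif op_cx p (?\<phi> \<alpha>)"
    if "\<alpha> \<in> carrier (grp Nat_ops p)" for p \<alpha>
    by (rule operations_dif[OF evaluate_closed[OF that] evaluate_dif[OF _ that]])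
  ultimately show ?thesis
    unfolding chain_iso_def by blast
qed

end

theorem theorem1:
  fixes E :: "'a univ dgprop"
    and i :: "nat \<Rightarrow> nat \<Rightarrow> int \<Rightarrow> (forest \<Rightarrow>\<^sub>0 int) \<Rightarrow> 'a univ"
    and n1 m1 n2 m2 :: nat
  assumes "prop_with_A_infinity_mult E i"
  shows "(\<exists>\<phi>. \<phi> \<in> chain_iso (Nat_cx E i (n1, m1) (n2, m2)) (formal_op_cx E i (n1, m1) (n2, m2))) \<and>
    coordinates n1 n2 \<in>
      chain_iso (coHoch_Hoch_cx E i (n1, m1) (n2, m2)) (formal_op_cx E i (n1, m1) (n2, m2))"
proof -
  interpret operation_complexes E i n1 m1 n2 m2
    using assms by (simp add: operation_complexes_def A_infinity_prop_def prop_with_A_infinity_mult_def)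
  show ?thesis
    using Nat_chain_iso coordinates_chain_iso by blast
qed

end
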